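(* There is an isomorphism and an equivalence of 2-categories $$\mathbf{Clan}\;\cong\;\mathbf{CompCat}^{\mathrm{str2}}_{\mathrm{rtd},\mathrm{repl},\mathrm{compcl}}\;\simeq\;\mathbf{CompCat}_{\mathrm{rtd},\mathrm{repl},\mathrm{compcl}},$$ where the last two are the 2-categories of rooted, replete, composition-closed comprehension categories, with strict and pseudo maps respectively; here "strict" maps preserve comprehension strictly, but not necessarily the root.
   Context: **Comprehension categories.** A comprehension category $(\mathcal C,\mathcal T,p,\chi)$ is a category $\mathcal C$, a fibration $p:\mathcal T\to\mathcal C$, and a functor $\chi:\mathcal T\to\mathcal C^{\to}$ to the arrow category with $\mathrm{cod}\circ\chi=p$ strictly, sending $p$-cartesian maps to pullback squares. For $A\in\mathcal T_\Gamma=p^{-1}(\Gamma)$ the domain of $\chi(A)$ is written $\Gamma.A$. A *pseudo map* $(F,\bar F,\varphi)$ is a functor $F:\mathcal C\to\mathcal C'$, a functor $\bar F:\mathcal T\to\mathcal T'$ strictly over $F$ preserving cartesian maps, and a natural isomorphism $\varphi:\chi'\bar F\cong F^{\to}\chi$ lying strictly over the identity of $F$; it is *strict* if $\chi'\bar F=F^{\to}\chi$ and $\varphi$ is the identity. A *transformation* $(F,\bar F,\varphi)\Rightarrow(G,\bar G,\gamma)$ is a natural transformation $\alpha:F\Rightarrow G$ and another $\bar\alpha:\bar F\Rightarrow\bar G$ strictly over $\alpha$, with $\gamma_A\circ\chi'(\bar\alpha_A)=\alpha_{\Gamma.A}\circ\varphi_A$ for all $A\in\mathcal T_\Gamma$.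 A comprehension category is *subcategorical* if $\chi$ is a full subcategory inclusion (full, faithful, injective on objects; $\mathcal T$ is identified with its image, a full subcategory of $\mathcal C^{\to}$); *replete* if moreover $\mathcal T$ is a replete (isomorphism-closed) subcategory of $\mathcal C^{\to}$; *composition-closed* (assuming subcategorical) if the class of maps in $\mathcal T$ is closed under composition and includes identities. It is *rooted* if equipped with a distinguished terminal object $1$ such that every object is isomorphic to an iterated context extension $1.A_0\ldots A_{n-1}$, $n\ge0$, with each $A_k\in\mathcal T_{1.A_0\ldots A_{k-1}}$. Maps of rooted comprehension categories preserve $1$ up to specified isomorphism, and transformations commute at $1$ with these isomorphisms. **Clans.** A display map category is a category $\mathcal C$ with a replete (isomorphism-invariant) class $\mathcal D$ of morphisms, the display maps, such that for any display map $d$ and any map $f$ into its target there is a display map that is a pullback of $d$ along $f$. It is rooted if $\mathcal C$ has a terminal object and all morphisms to it are composites of display maps (and isomorphisms). $\mathbf{DMC}_{\mathrm{rtd}}$ is the 2-category of rooted display map categories, functors preserving display maps, pullbacks thereof, and terminal objects, and all natural transformations. A *clan* is a rooted display map category $(\mathcal C,\mathcal D)$ with $\mathcal D$ closed under composition and containing all identities; $\mathbf{Clan}$ is the full sub-2-category of $\mathbf{DMC}_{\mathrm{rtd}}$ on clans. For the isomorphism of 2-categories, a terminal object is regarded as chosen (but need only be preserved up to isomorphism). **Conventions.** 2-categories and 2-functors are strict; $\cong$ is isomorphism of 2-categories; an equivalence $\simeq$ is a 2-functor inducing equivalences on hom-categories and surjective on objects up to internal equivalence. *)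

theory Defs
  imports Main "HOL-Library.FuncSet"
begin

section \<open>Categories, functors, natural transformations\<close>

text \<open>
  Objects and arrows form sets inside arbitrary types.  All operations are
  \<^const>\<open>undefined\<close> outside their domain, so that equality of records is
  equality of the mathematical structures (which matters for isomorphisms of 2-categories).
\<close>

record ('o, 'm) cat =
  Obj :: "'o set"
  Arr :: "'m set"
  Dom :: "'m \<Rightarrow> 'o"
  Cod :: "'m \<Rightarrow> 'o"
  Id :: "'o \<Rightarrow> 'm"
  Comp :: "'m \<Rightarrow> 'm \<Rightarrow> 'm"

abbreviation comp_arr :: "'m \<Rightarrow> ('o, 'm) cat \<Rightarrow> 'm \<Rightarrow> 'm"  ("(_ /\<cdot>\<^bsub>_\<^esub> _)" [71, 0, 70] 70)
  where "g \<cdot>\<^bsub>C\<^esub> f \<equiv> Comp C g f"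

definition hom :: "('o, 'm) cat \<Rightarrow> 'o \<Rightarrow> 'o \<Rightarrow> 'm set"
  where "hom C x y = {f \<in> Arr C. Dom C f = x \<and> Cod C f = y}"

locale category =
  fixes C :: "('o, 'm) cat"
  assumes Dom_mem: "Dom C \<in> Arr C \<rightarrow>\<^sub>E Obj C"
    and Cod_mem: "Cod C \<in> Arr C \<rightarrow>\<^sub>E Obj C"
    and Id_ext: "Id C \<in> extensional (Obj C)"
    and Id_mem: "x \<in> Obj C \<Longrightarrow> Id C x \<in> hom C x x"
    and Comp_ext: "\<not> (f \<in> Arr C \<and> g \<in> Arr C \<and> Cod C f = Dom C g) \<Longrightarrow> g \<cdot>\<^bsub>C\<^esub> f = undefined"
    and Comp_mem: "\<lbrakk>f \<in> hom C x y; g \<in> hom C y z\<rbrakk> \<Longrightarrow> g \<cdot>\<^bsub>C\<^esub> f \<in> hom C x z"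
    and Comp_Id_right: "f \<in> hom C x y \<Longrightarrow> f \<cdot>\<^bsub>C\<^esub> Id C x = f"
    and Comp_Id_left: "f \<in> hom C x y \<Longrightarrow> Id C y \<cdot>\<^bsub>C\<^esub> f = f"
    and Comp_assoc: "\<lbrakk>f \<in> hom C w x; g \<in> hom C x y; h \<in> hom C y z\<rbrakk>
      \<Longrightarrow> (h \<cdot>\<^bsub>C\<^esub> g) \<cdot>\<^bsub>C\<^esub> f = h \<cdot>\<^bsub>C\<^esub> (g \<cdot>\<^bsub>C\<^esub> f)"

definition iso_arr :: "('o, 'm) cat \<Rightarrow> 'm \<Rightarrow> bool"
  where "iso_arr C f \<longleftrightarrow> f \<in> Arr C \<and>
    (\<exists>g \<in> hom C (Cod C f) (Dom C f). g \<cdot>\<^bsub>C\<^esub> f = Id C (Dom C f) \<and> f \<cdot>\<^bsub>C\<^esub> g = Id C (Cod C f))"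

definition isomorphic :: "('o, 'm) cat \<Rightarrow> 'o \<Rightarrow> 'o \<Rightarrow> bool"
  where "isomorphic C x y \<longleftrightarrow> (\<exists>f \<in> hom C x y. iso_arr C f)"

definition iso_closed :: "('o, 'm) cat \<Rightarrow> 'o set \<Rightarrow> bool"
  where "iso_closed C S \<longleftrightarrow> (\<forall>x \<in> S. \<forall>y \<in> Obj C. isomorphic C x y \<longrightarrow> y \<in> S)"

definition terminal :: "('o, 'm) cat \<Rightarrow> 'o \<Rightarrow> bool"
  where "terminal C t \<longleftrightarrow> t \<in> Obj C \<and> (\<forall>x \<in> Obj C. \<exists>!f. f \<in> hom C x t)"

definition full_subcat :: "('o, 'm) cat \<Rightarrow> 'o set \<Rightarrow> ('o, 'm) cat"
  where "full_subcat C S =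
    (let A = {f \<in> Arr C. Dom C f \<in> S \<and> Cod C f \<in> S} in
     \<lparr> Obj = Obj C \<inter> S,
       Arr = A,
       Dom = restrict (Dom C) A,
       Cod = restrict (Cod C) A,
       Id = restrict (Id C) (Obj C \<inter> S),
       Comp = (\<lambda>g f. if f \<in> A \<and> g \<in> A then g \<cdot>\<^bsub>C\<^esub> f else undefined) \<rparr>)"

record ('o, 'm, 'p, 'n) ftor =
  fobj :: "'o \<Rightarrow> 'p"
  farr :: "'m \<Rightarrow> 'n"

definition is_functor :: "('o, 'm) cat \<Rightarrow> ('p, 'n) cat \<Rightarrow> ('o, 'm, 'p, 'n) ftor \<Rightarrow> bool"
  where "is_functor C D F \<longleftrightarrow> category C \<and> category D \<and>
    fobj F \<in> Obj C \<rightarrow>\<^sub>E Obj D \<and>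
    farr F \<in> extensional (Arr C) \<and>
    (\<forall>x y. \<forall>f \<in> hom C x y. farr F f \<in> hom D (fobj F x) (fobj F y)) \<and>
    (\<forall>x \<in> Obj C. farr F (Id C x) = Id D (fobj F x)) \<and>
    (\<forall>x y z. \<forall>f \<in> hom C x y. \<forall>g \<in> hom C y z. farr F (g \<cdot>\<^bsub>C\<^esub> f) = farr F g \<cdot>\<^bsub>D\<^esub> farr F f)"

definition id_ftor :: "('o, 'm) cat \<Rightarrow> ('o, 'm, 'o, 'm) ftor"
  where "id_ftor C = \<lparr> fobj = (\<lambda>x \<in> Obj C. x), farr = (\<lambda>f \<in> Arr C. f) \<rparr>"

text \<open>The first argument of \<open>comp_ftor C G F\<close> is the source category of \<open>F\<close>.\<close>

definition comp_ftor ::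
    "('o, 'm) cat \<Rightarrow> ('p, 'n, 'q, 'k) ftor \<Rightarrow> ('o, 'm, 'p, 'n) ftor \<Rightarrow> ('o, 'm, 'q, 'k) ftor"
  where "comp_ftor C G F =
    \<lparr> fobj = (\<lambda>x \<in> Obj C. fobj G (fobj F x)), farr = (\<lambda>f \<in> Arr C. farr G (farr F f)) \<rparr>"

definition full_ftor :: "('o, 'm) cat \<Rightarrow> ('p, 'n) cat \<Rightarrow> ('o, 'm, 'p, 'n) ftor \<Rightarrow> bool"
  where "full_ftor C D F \<longleftrightarrow>
    (\<forall>x \<in> Obj C. \<forall>y \<in> Obj C. hom D (fobj F x) (fobj F y) \<subseteq> farr F ` hom C x y)"

definition faithful_ftor :: "('o, 'm) cat \<Rightarrow> ('o, 'm, 'p, 'n) ftor \<Rightarrow> bool"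
  where "faithful_ftor C F \<longleftrightarrow> (\<forall>x \<in> Obj C. \<forall>y \<in> Obj C. inj_on (farr F) (hom C x y))"

definition nat_trans :: "('o, 'm) cat \<Rightarrow> ('p, 'n) cat \<Rightarrow>
    ('o, 'm, 'p, 'n) ftor \<Rightarrow> ('o, 'm, 'p, 'n) ftor \<Rightarrow> ('o \<Rightarrow> 'n) \<Rightarrow> bool"
  where "nat_trans C D F G \<alpha> \<longleftrightarrow> is_functor C D F \<and> is_functor C D G \<and>
    \<alpha> \<in> extensional (Obj C) \<and>
    (\<forall>x \<in> Obj C. \<alpha> x \<in> hom D (fobj F x) (fobj G x)) \<and>
    (\<forall>x y. \<forall>f \<in> hom C x y. \<alpha> y \<cdot>\<^bsub>D\<^esub> farr F f = farr G f \<cdot>\<^bsub>D\<^esub> \<alpha> x)"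

definition nat_iso :: "('o, 'm) cat \<Rightarrow> ('p, 'n) cat \<Rightarrow>
    ('o, 'm, 'p, 'n) ftor \<Rightarrow> ('o, 'm, 'p, 'n) ftor \<Rightarrow> ('o \<Rightarrow> 'n) \<Rightarrow> bool"
  where "nat_iso C D F G \<alpha> \<longleftrightarrow> nat_trans C D F G \<alpha> \<and> (\<forall>x \<in> Obj C. iso_arr D (\<alpha> x))"

definition id_nat :: "('o, 'm) cat \<Rightarrow> ('p, 'n) cat \<Rightarrow> ('o, 'm, 'p, 'n) ftor \<Rightarrow> 'o \<Rightarrow> 'n"
  where "id_nat C D F = (\<lambda>x \<in> Obj C. Id D (fobj F x))"

definition vcomp :: "('o, 'm) cat \<Rightarrow> ('p, 'n) cat \<Rightarrow> ('o \<Rightarrow> 'n) \<Rightarrow> ('o \<Rightarrow> 'n) \<Rightarrow> 'o \<Rightarrow> 'n"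
  where "vcomp C D \<beta> \<alpha> = (\<lambda>x \<in> Obj C. \<beta> x \<cdot>\<^bsub>D\<^esub> \<alpha> x)"

text \<open>
  For \<open>\<alpha> : F \<Rightarrow> F'\<close> between functors from \<open>C\<close>, and \<open>\<beta> : G \<Rightarrow> G'\<close> between functors into \<open>E\<close>,
  \<open>hcomp C E G F' \<beta> \<alpha>\<close> is the horizontal composite \<open>G F \<Rightarrow> G' F'\<close>.
\<close>

definition hcomp :: "('o, 'm) cat \<Rightarrow> ('q, 'k) cat \<Rightarrow> ('p, 'n, 'q, 'k) ftor \<Rightarrow> ('o, 'm, 'p, 'n) ftor \<Rightarrow>
    ('p \<Rightarrow> 'k) \<Rightarrow> ('o \<Rightarrow> 'n) \<Rightarrow> 'o \<Rightarrow> 'k"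
  where "hcomp C E G F' \<beta> \<alpha> = (\<lambda>x \<in> Obj C. \<beta> (fobj F' x) \<cdot>\<^bsub>E\<^esub> farr G (\<alpha> x))"

definition is_equivalence :: "('o, 'm) cat \<Rightarrow> ('p, 'n) cat \<Rightarrow> ('o, 'm, 'p, 'n) ftor \<Rightarrow> bool"
  where "is_equivalence C D F \<longleftrightarrow> is_functor C D F \<and>
    (\<exists>G. is_functor D C G \<and>
      (\<exists>\<eta>. nat_iso C C (id_ftor C) (comp_ftor C G F) \<eta>) \<and>
      (\<exists>\<epsilon>. nat_iso D D (comp_ftor D F G) (id_ftor D) \<epsilon>))"


section \<open>Arrow categories, pullbacks, fibrations\<close>

text \<open>
  \<open>Sq a b t u\<close> is the commutative square from \<open>a\<close> to \<open>b\<close> with \<open>t\<close> between the domains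
  and \<open>u\<close> between the codomains.
\<close>

datatype 'm sq = Sq (ssrc: 'm) (stgt: 'm) (stop: 'm) (sbot: 'm)

definition squares :: "('o, 'm) cat \<Rightarrow> 'm sq set"
  where "squares C = {s. ssrc s \<in> Arr C \<and> stgt s \<in> Arr C \<and>
    stop s \<in> hom C (Dom C (ssrc s)) (Dom C (stgt s)) \<and>
    sbot s \<in> hom C (Cod C (ssrc s)) (Cod C (stgt s)) \<and>
    stgt s \<cdot>\<^bsub>C\<^esub> stop s = sbot s \<cdot>\<^bsub>C\<^esub> ssrc s}"

definition arrow_cat :: "('o, 'm) cat \<Rightarrow> ('m, 'm sq) cat"
  where "arrow_cat C =
    \<lparr> Obj = Arr C,
      Arr = squares C,
      Dom = restrict ssrc (squares C),
      Cod = restrict stgt (squares C),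
      Id = (\<lambda>a \<in> Arr C. Sq a a (Id C (Dom C a)) (Id C (Cod C a))),
      Comp = (\<lambda>t s. if s \<in> squares C \<and> t \<in> squares C \<and> stgt s = ssrc t
        then Sq (ssrc s) (stgt t) (stop t \<cdot>\<^bsub>C\<^esub> stop s) (sbot t \<cdot>\<^bsub>C\<^esub> sbot s) else undefined) \<rparr>"

definition cod_ftor :: "('o, 'm) cat \<Rightarrow> ('m, 'm sq, 'o, 'm) ftor"
  where "cod_ftor C = \<lparr> fobj = restrict (Cod C) (Arr C), farr = restrict sbot (squares C) \<rparr>"

definition arrow_ftor :: "('o, 'm) cat \<Rightarrow> ('o, 'm, 'p, 'n) ftor \<Rightarrow> ('m, 'm sq, 'n, 'n sq) ftor"
  where "arrow_ftor C F =
    \<lparr> fobj = restrict (farr F) (Arr C), farr = restrict (map_sq (farr F)) (squares C) \<rparr>"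

definition pullback_square :: "('o, 'm) cat \<Rightarrow> 'm sq \<Rightarrow> bool"
  where "pullback_square C s \<longleftrightarrow> s \<in> squares C \<and>
    (\<forall>x a b. a \<in> hom C x (Cod C (ssrc s)) \<longrightarrow> b \<in> hom C x (Dom C (stgt s)) \<longrightarrow>
      sbot s \<cdot>\<^bsub>C\<^esub> a = stgt s \<cdot>\<^bsub>C\<^esub> b \<longrightarrow>
      (\<exists>!u. u \<in> hom C x (Dom C (ssrc s)) \<and> ssrc s \<cdot>\<^bsub>C\<^esub> u = a \<and> stop s \<cdot>\<^bsub>C\<^esub> u = b))"

definition cartesian ::
    "('t, 'n) cat \<Rightarrow> ('o, 'm) cat \<Rightarrow> ('t, 'n, 'o, 'm) ftor \<Rightarrow> 'n \<Rightarrow> bool"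
  where "cartesian T C p u \<longleftrightarrow> u \<in> Arr T \<and>
    (\<forall>X. \<forall>v \<in> hom T X (Cod T u). \<forall>h \<in> hom C (fobj p X) (fobj p (Dom T u)).
      farr p u \<cdot>\<^bsub>C\<^esub> h = farr p v \<longrightarrow>
      (\<exists>!w. w \<in> hom T X (Dom T u) \<and> farr p w = h \<and> u \<cdot>\<^bsub>T\<^esub> w = v))"

definition fibration :: "('t, 'n) cat \<Rightarrow> ('o, 'm) cat \<Rightarrow> ('t, 'n, 'o, 'm) ftor \<Rightarrow> bool"
  where "fibration T C p \<longleftrightarrow> is_functor T C p \<and>
    (\<forall>B \<in> Obj T. \<forall>f \<in> Arr C. Cod C f = fobj p B \<longrightarrow>
      (\<exists>u. cartesian T C p u \<and> Cod T u = B \<and> farr p u = f))"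


section \<open>Strict 2-categories\<close>

text \<open>
  1-cells need not determine their endpoints, so horizontal composition takes the three
  0-cells \<open>x y z\<close> as arguments: \<open>Comp1 K x y z g f\<close> for \<open>f : x \<rightarrow> y\<close> and \<open>g : y \<rightarrow> z\<close>.
  Vertical composition is the composition of the hom-categories.
\<close>

record ('x, 'f, 't) twocat =
  Cell0 :: "'x set"
  HomCat :: "'x \<Rightarrow> 'x \<Rightarrow> ('f, 't) cat"
  Id1 :: "'x \<Rightarrow> 'f"
  Comp1 :: "'x \<Rightarrow> 'x \<Rightarrow> 'x \<Rightarrow> 'f \<Rightarrow> 'f \<Rightarrow> 'f"
  Comp2 :: "'x \<Rightarrow> 'x \<Rightarrow> 'x \<Rightarrow> 't \<Rightarrow> 't \<Rightarrow> 't"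

locale two_category =
  fixes K :: "('x, 'f, 't) twocat"
  assumes HomCat_category:
      "\<lbrakk>x \<in> Cell0 K; y \<in> Cell0 K\<rbrakk> \<Longrightarrow> category (HomCat K x y)"
    and Id1_mem:
      "x \<in> Cell0 K \<Longrightarrow> Id1 K x \<in> Obj (HomCat K x x)"
    and Comp1_mem:
      "\<lbrakk>x \<in> Cell0 K; y \<in> Cell0 K; z \<in> Cell0 K; f \<in> Obj (HomCat K x y); g \<in> Obj (HomCat K y z)\<rbrakk>
      \<Longrightarrow> Comp1 K x y z g f \<in> Obj (HomCat K x z)"
    and Comp2_mem:
      "\<lbrakk>x \<in> Cell0 K; y \<in> Cell0 K; z \<in> Cell0 K;
        \<alpha> \<in> hom (HomCat K x y) f f'; \<beta> \<in> hom (HomCat K y z) g g'\<rbrakk>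
      \<Longrightarrow> Comp2 K x y z \<beta> \<alpha> \<in> hom (HomCat K x z) (Comp1 K x y z g f) (Comp1 K x y z g' f')"
    and Comp2_Id:
      "\<lbrakk>x \<in> Cell0 K; y \<in> Cell0 K; z \<in> Cell0 K; f \<in> Obj (HomCat K x y); g \<in> Obj (HomCat K y z)\<rbrakk>
      \<Longrightarrow> Comp2 K x y z (Id (HomCat K y z) g) (Id (HomCat K x y) f)
        = Id (HomCat K x z) (Comp1 K x y z g f)"
    and interchange:
      "\<lbrakk>x \<in> Cell0 K; y \<in> Cell0 K; z \<in> Cell0 K;
        \<alpha> \<in> hom (HomCat K x y) f f'; \<alpha>' \<in> hom (HomCat K x y) f' f'';
        \<beta> \<in> hom (HomCat K y z) g g'; \<beta>' \<in> hom (HomCat K y z) g' g''\<rbrakk>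
      \<Longrightarrow> Comp2 K x y z (\<beta>' \<cdot>\<^bsub>HomCat K y z\<^esub> \<beta>) (\<alpha>' \<cdot>\<^bsub>HomCat K x y\<^esub> \<alpha>)
        = Comp2 K x y z \<beta>' \<alpha>' \<cdot>\<^bsub>HomCat K x z\<^esub> Comp2 K x y z \<beta> \<alpha>"
    and Comp1_Id_right:
      "\<lbrakk>x \<in> Cell0 K; y \<in> Cell0 K; f \<in> Obj (HomCat K x y)\<rbrakk> \<Longrightarrow> Comp1 K x x y f (Id1 K x) = f"
    and Comp1_Id_left:
      "\<lbrakk>x \<in> Cell0 K; y \<in> Cell0 K; f \<in> Obj (HomCat K x y)\<rbrakk> \<Longrightarrow> Comp1 K x y y (Id1 K y) f = f"
    and Comp2_Id_right:
      "\<lbrakk>x \<in> Cell0 K; y \<in> Cell0 K; \<alpha> \<in> Arr (HomCat K x y)\<rbrakk>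
      \<Longrightarrow> Comp2 K x x y \<alpha> (Id (HomCat K x x) (Id1 K x)) = \<alpha>"
    and Comp2_Id_left:
      "\<lbrakk>x \<in> Cell0 K; y \<in> Cell0 K; \<alpha> \<in> Arr (HomCat K x y)\<rbrakk>
      \<Longrightarrow> Comp2 K x y y (Id (HomCat K y y) (Id1 K y)) \<alpha> = \<alpha>"
    and Comp1_assoc:
      "\<lbrakk>w \<in> Cell0 K; x \<in> Cell0 K; y \<in> Cell0 K; z \<in> Cell0 K;
        f \<in> Obj (HomCat K w x); g \<in> Obj (HomCat K x y); h \<in> Obj (HomCat K y z)\<rbrakk>
      \<Longrightarrow> Comp1 K w x z (Comp1 K x y z h g) f = Comp1 K w y z h (Comp1 K w x y g f)"
    and Comp2_assoc:
      "\<lbrakk>w \<in> Cell0 K; x \<in> Cell0 K; y \<in> Cell0 K; z \<in> Cell0 K;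
        \<alpha> \<in> Arr (HomCat K w x); \<beta> \<in> Arr (HomCat K x y); \<gamma> \<in> Arr (HomCat K y z)\<rbrakk>
      \<Longrightarrow> Comp2 K w x z (Comp2 K x y z \<gamma> \<beta>) \<alpha> = Comp2 K w y z \<gamma> (Comp2 K w x y \<beta> \<alpha>)"

record ('x, 'f, 't, 'y, 'g, 'u) twoftor =
  On0 :: "'x \<Rightarrow> 'y"
  OnHom :: "'x \<Rightarrow> 'x \<Rightarrow> ('f, 't, 'g, 'u) ftor"

definition is_2functor ::
    "('x, 'f, 't) twocat \<Rightarrow> ('y, 'g, 'u) twocat \<Rightarrow> ('x, 'f, 't, 'y, 'g, 'u) twoftor \<Rightarrow> bool"
  where "is_2functor K L F \<longleftrightarrow> two_category K \<and> two_category L \<and>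
    (\<forall>x \<in> Cell0 K. On0 F x \<in> Cell0 L) \<and>
    (\<forall>x \<in> Cell0 K. \<forall>y \<in> Cell0 K.
      is_functor (HomCat K x y) (HomCat L (On0 F x) (On0 F y)) (OnHom F x y)) \<and>
    (\<forall>x \<in> Cell0 K. fobj (OnHom F x x) (Id1 K x) = Id1 L (On0 F x)) \<and>
    (\<forall>x \<in> Cell0 K. \<forall>y \<in> Cell0 K. \<forall>z \<in> Cell0 K.
      (\<forall>f \<in> Obj (HomCat K x y). \<forall>g \<in> Obj (HomCat K y z).
        fobj (OnHom F x z) (Comp1 K x y z g f)
          = Comp1 L (On0 F x) (On0 F y) (On0 F z) (fobj (OnHom F y z) g) (fobj (OnHom F x y) f)) \<and>
      (\<forall>\<alpha> \<in> Arr (HomCat K x y). \<forall>\<beta> \<in> Arr (HomCat K y z).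
        farr (OnHom F x z) (Comp2 K x y z \<beta> \<alpha>)
          = Comp2 L (On0 F x) (On0 F y) (On0 F z) (farr (OnHom F y z) \<beta>) (farr (OnHom F x y) \<alpha>)))"

definition retracts_2functor ::
    "('x, 'f, 't) twocat \<Rightarrow> ('y, 'g, 'u, 'x, 'f, 't) twoftor \<Rightarrow> ('x, 'f, 't, 'y, 'g, 'u) twoftor \<Rightarrow> bool"
  where "retracts_2functor K G F \<longleftrightarrow>
    (\<forall>x \<in> Cell0 K. On0 G (On0 F x) = x) \<and>
    (\<forall>x \<in> Cell0 K. \<forall>y \<in> Cell0 K.
      comp_ftor (HomCat K x y) (OnHom G (On0 F x) (On0 F y)) (OnHom F x y) = id_ftor (HomCat K x y))"

definition isomorphic_2cat :: "('x, 'f, 't) twocat \<Rightarrow> ('y, 'g, 'u) twocat \<Rightarrow> bool"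
  where "isomorphic_2cat K L \<longleftrightarrow> (\<exists>F G. is_2functor K L F \<and> is_2functor L K G \<and>
    retracts_2functor K G F \<and> retracts_2functor L F G)"

definition internally_equivalent :: "('x, 'f, 't) twocat \<Rightarrow> 'x \<Rightarrow> 'x \<Rightarrow> bool"
  where "internally_equivalent K x y \<longleftrightarrow>
    (\<exists>f \<in> Obj (HomCat K x y). \<exists>g \<in> Obj (HomCat K y x).
      isomorphic (HomCat K x x) (Comp1 K x y x g f) (Id1 K x) \<and>
      isomorphic (HomCat K y y) (Comp1 K y x y f g) (Id1 K y))"

definition is_2equivalence ::
    "('x, 'f, 't) twocat \<Rightarrow> ('y, 'g, 'u) twocat \<Rightarrow> ('x, 'f, 't, 'y, 'g, 'u) twoftor \<Rightarrow> bool"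
  where "is_2equivalence K L F \<longleftrightarrow> is_2functor K L F \<and>
    (\<forall>x \<in> Cell0 K. \<forall>y \<in> Cell0 K.
      is_equivalence (HomCat K x y) (HomCat L (On0 F x) (On0 F y)) (OnHom F x y)) \<and>
    (\<forall>y \<in> Cell0 L. \<exists>x \<in> Cell0 K. internally_equivalent L (On0 F x) y)"

definition equivalent_2cat :: "('x, 'f, 't) twocat \<Rightarrow> ('y, 'g, 'u) twocat \<Rightarrow> bool"
  where "equivalent_2cat K L \<longleftrightarrow> (\<exists>F. is_2equivalence K L F)"

definition full_sub2cat :: "('x, 'f, 't) twocat \<Rightarrow> ('x \<Rightarrow> bool) \<Rightarrow> ('x, 'f, 't) twocat"
  where "full_sub2cat K P = K\<lparr> Cell0 := {x \<in> Cell0 K. P x} \<rparr>"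

definition locally_full_sub2cat ::
    "('x, 'f, 't) twocat \<Rightarrow> ('x \<Rightarrow> 'x \<Rightarrow> 'f \<Rightarrow> bool) \<Rightarrow> ('x, 'f, 't) twocat"
  where "locally_full_sub2cat K Q =
    K\<lparr> HomCat := (\<lambda>x y. full_subcat (HomCat K x y) {f. Q x y f}) \<rparr>"

text \<open>A 2-cell records its source and target 1-cells together with its components.\<close>

datatype ('f, 'a) cell = Cell (csrc: 'f) (ctgt: 'f) (ccomp: 'a)


section \<open>Display map categories and clans\<close>

record ('o, 'm) dmc =
  Ucat :: "('o, 'm) cat"
  Disp :: "'m set"

record ('o, 'm) rdmc = "('o, 'm) dmc" +
  Term :: "'o"

definition display_map_category :: "('o, 'm, 'z) dmc_scheme \<Rightarrow> bool"
  where "display_map_category X \<longleftrightarrow> category (Ucat X) \<and> Disp X \<subseteq> Arr (Ucat X) \<and>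
    iso_closed (arrow_cat (Ucat X)) (Disp X) \<and>
    (\<forall>d \<in> Disp X. \<forall>f \<in> Arr (Ucat X). Cod (Ucat X) f = Cod (Ucat X) d \<longrightarrow>
      (\<exists>s. pullback_square (Ucat X) s \<and> ssrc s \<in> Disp X \<and> stgt s = d \<and> sbot s = f))"

inductive_set composites :: "('o, 'm) cat \<Rightarrow> 'm set \<Rightarrow> 'm set"
  for C :: "('o, 'm) cat" and D :: "'m set" where
  base: "d \<in> D \<Longrightarrow> d \<in> composites C D"
| iso: "iso_arr C f \<Longrightarrow> f \<in> composites C D"
| comp: "\<lbrakk>f \<in> composites C D; g \<in> composites C D; Cod C f = Dom C g\<rbrakk> \<Longrightarrow> g \<cdot>\<^bsub>C\<^esub> f \<in> composites C D"

definition rooted_dmc :: "('o, 'm) rdmc \<Rightarrow> bool"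
  where "rooted_dmc X \<longleftrightarrow> display_map_category X \<and> terminal (Ucat X) (Term X) \<and>
    (\<forall>f \<in> Arr (Ucat X). Cod (Ucat X) f = Term X \<longrightarrow> f \<in> composites (Ucat X) (Disp X))"

definition dmc_map :: "('o, 'm) rdmc \<Rightarrow> ('o, 'm) rdmc \<Rightarrow> ('o, 'm, 'o, 'm) ftor \<Rightarrow> bool"
  where "dmc_map X Y F \<longleftrightarrow> is_functor (Ucat X) (Ucat Y) F \<and>
    (\<forall>d \<in> Disp X. farr F d \<in> Disp Y) \<and>
    (\<forall>s. pullback_square (Ucat X) s \<longrightarrow> stgt s \<in> Disp X \<longrightarrow>
      pullback_square (Ucat Y) (map_sq (farr F) s)) \<and>
    (\<forall>t. terminal (Ucat X) t \<longrightarrow> terminal (Ucat Y) (fobj F t))"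

type_synonym ('o, 'm) dmc_2cell = "(('o, 'm, 'o, 'm) ftor, 'o \<Rightarrow> 'm) cell"

definition dmc_hom ::
    "('o, 'm) rdmc \<Rightarrow> ('o, 'm) rdmc \<Rightarrow> (('o, 'm, 'o, 'm) ftor, ('o, 'm) dmc_2cell) cat"
  where "dmc_hom X Y =
    (let C = Ucat X; D = Ucat Y; O1 = {F. dmc_map X Y F};
         A = {Cell F G \<alpha> | F G \<alpha>. F \<in> O1 \<and> G \<in> O1 \<and> nat_trans C D F G \<alpha>} in
     \<lparr> Obj = O1,
       Arr = A,
       Dom = restrict csrc A,
       Cod = restrict ctgt A,
       Id = (\<lambda>F \<in> O1. Cell F F (id_nat C D F)),
       Comp = (\<lambda>b a. if a \<in> A \<and> b \<in> A \<and> ctgt a = csrc b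
         then Cell (csrc a) (ctgt b) (vcomp C D (ccomp b) (ccomp a)) else undefined) \<rparr>)"

definition DMC_rtd ::
    "(('o, 'm) rdmc, ('o, 'm, 'o, 'm) ftor, ('o, 'm) dmc_2cell) twocat"
  where "DMC_rtd =
    \<lparr> Cell0 = {X. rooted_dmc X},
      HomCat = dmc_hom,
      Id1 = (\<lambda>X. id_ftor (Ucat X)),
      Comp1 = (\<lambda>X Y Z G F. comp_ftor (Ucat X) G F),
      Comp2 = (\<lambda>X Y Z b a.
        Cell (comp_ftor (Ucat X) (csrc b) (csrc a)) (comp_ftor (Ucat X) (ctgt b) (ctgt a))
          (hcomp (Ucat X) (Ucat Z) (csrc b) (ctgt a) (ccomp b) (ccomp a))) \<rparr>"

definition wide_comp_closed :: "('o, 'm) cat \<Rightarrow> 'm set \<Rightarrow> bool"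
  where "wide_comp_closed C D \<longleftrightarrow> (\<forall>x \<in> Obj C. Id C x \<in> D) \<and>
    (\<forall>f \<in> D. \<forall>g \<in> D. Cod C f = Dom C g \<longrightarrow> g \<cdot>\<^bsub>C\<^esub> f \<in> D)"

type_synonym ('o, 'm) DMC_2cat =
  "(('o, 'm) rdmc, ('o, 'm, 'o, 'm) ftor, ('o, 'm) dmc_2cell) twocat"

definition Clan :: "('o, 'm) DMC_2cat"
  where "Clan = full_sub2cat DMC_rtd (\<lambda>X. wide_comp_closed (Ucat X) (Disp X))"


section \<open>Comprehension categories\<close>

record ('o, 'm, 't, 'n) compcat =
  Base :: "('o, 'm) cat"
  Tot :: "('t, 'n) cat"
  Proj :: "('t, 'n, 'o, 'm) ftor"
  Chi :: "('t, 'n, 'm, 'm sq) ftor"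

record ('o, 'm, 't, 'n) rcompcat = "('o, 'm, 't, 'n) compcat" +
  Root :: "'o"

definition comprehension_category :: "('o, 'm, 't, 'n, 'z) compcat_scheme \<Rightarrow> bool"
  where "comprehension_category X \<longleftrightarrow>
    fibration (Tot X) (Base X) (Proj X) \<and>
    is_functor (Tot X) (arrow_cat (Base X)) (Chi X) \<and>
    comp_ftor (Tot X) (cod_ftor (Base X)) (Chi X) = Proj X \<and>
    (\<forall>u. cartesian (Tot X) (Base X) (Proj X) u \<longrightarrow> pullback_square (Base X) (farr (Chi X) u))"

definition ctx_ext :: "('o, 'm, 't, 'n, 'z) compcat_scheme \<Rightarrow> 't \<Rightarrow> 'o"
  where "ctx_ext X A = Dom (Base X) (fobj (Chi X) A)"

inductive_set iterated_ctx :: "('o, 'm, 't, 'n) rcompcat \<Rightarrow> 'o set"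
  for X :: "('o, 'm, 't, 'n) rcompcat" where
  root: "Root X \<in> iterated_ctx X"
| ext: "\<lbrakk>\<Gamma> \<in> iterated_ctx X; A \<in> Obj (Tot X); fobj (Proj X) A = \<Gamma>\<rbrakk> \<Longrightarrow> ctx_ext X A \<in> iterated_ctx X"

definition rooted_compcat :: "('o, 'm, 't, 'n) rcompcat \<Rightarrow> bool"
  where "rooted_compcat X \<longleftrightarrow> comprehension_category X \<and> terminal (Base X) (Root X) \<and>
    (\<forall>x \<in> Obj (Base X). \<exists>\<Gamma> \<in> iterated_ctx X. isomorphic (Base X) x \<Gamma>)"

text \<open>
  In the subcategorical case the total category is identified with its image under the
  comprehension functor: its objects literally are arrows of the base, its arrows literally
  are squares.  Hence the specialised type.
\<close>

definition subcategorical :: "('o, 'm, 'm, 'm sq, 'z) compcat_scheme \<Rightarrow> bool"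
  where "subcategorical X \<longleftrightarrow>
    full_ftor (Tot X) (arrow_cat (Base X)) (Chi X) \<and>
    faithful_ftor (Tot X) (Chi X) \<and>
    inj_on (fobj (Chi X)) (Obj (Tot X)) \<and>
    Tot X = full_subcat (arrow_cat (Base X)) (fobj (Chi X) ` Obj (Tot X)) \<and>
    Chi X = id_ftor (Tot X)"

definition replete :: "('o, 'm, 'm, 'm sq, 'z) compcat_scheme \<Rightarrow> bool"
  where "replete X \<longleftrightarrow> subcategorical X \<and> iso_closed (arrow_cat (Base X)) (Obj (Tot X))"

definition composition_closed :: "('o, 'm, 'm, 'm sq, 'z) compcat_scheme \<Rightarrow> bool"
  where "composition_closed X \<longleftrightarrow> subcategorical X \<and> wide_comp_closed (Base X) (Obj (Tot X))"

record ('o, 'm, 't, 'n) ccmap =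
  BaseF :: "('o, 'm, 'o, 'm) ftor"
  TotF :: "('t, 'n, 't, 'n) ftor"
  Phi :: "'t \<Rightarrow> 'm sq"

text \<open>\<open>RootIso\<close> is the specified isomorphism \<open>F 1 \<rightarrow> 1'\<close>.\<close>

record ('o, 'm, 't, 'n) rccmap = "('o, 'm, 't, 'n) ccmap" +
  RootIso :: "'m"

definition pseudo_map :: "('o, 'm, 't, 'n, 'z) compcat_scheme \<Rightarrow> ('o, 'm, 't, 'n, 'z) compcat_scheme \<Rightarrow>
    ('o, 'm, 't, 'n, 'w) ccmap_scheme \<Rightarrow> bool"
  where "pseudo_map X Y M \<longleftrightarrow>
    is_functor (Base X) (Base Y) (BaseF M) \<and>
    is_functor (Tot X) (Tot Y) (TotF M) \<and>
    comp_ftor (Tot X) (Proj Y) (TotF M) = comp_ftor (Tot X) (BaseF M) (Proj X) \<and>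
    (\<forall>u. cartesian (Tot X) (Base X) (Proj X) u \<longrightarrow>
      cartesian (Tot Y) (Base Y) (Proj Y) (farr (TotF M) u)) \<and>
    nat_iso (Tot X) (arrow_cat (Base Y))
      (comp_ftor (Tot X) (Chi Y) (TotF M))
      (comp_ftor (Tot X) (arrow_ftor (Base X) (BaseF M)) (Chi X)) (Phi M) \<and>
    (\<forall>A \<in> Obj (Tot X). sbot (Phi M A) = Id (Base Y) (fobj (BaseF M) (fobj (Proj X) A)))"

definition strict_map :: "('o, 'm, 't, 'n, 'z) compcat_scheme \<Rightarrow> ('o, 'm, 't, 'n, 'z) compcat_scheme \<Rightarrow>
    ('o, 'm, 't, 'n, 'w) ccmap_scheme \<Rightarrow> bool"
  where "strict_map X Y M \<longleftrightarrow> pseudo_map X Y M \<and>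
    comp_ftor (Tot X) (Chi Y) (TotF M) = comp_ftor (Tot X) (arrow_ftor (Base X) (BaseF M)) (Chi X) \<and>
    Phi M = id_nat (Tot X) (arrow_cat (Base Y)) (comp_ftor (Tot X) (Chi Y) (TotF M))"

definition rooted_map :: "('o, 'm, 't, 'n) rcompcat \<Rightarrow> ('o, 'm, 't, 'n) rcompcat \<Rightarrow>
    ('o, 'm, 't, 'n) rccmap \<Rightarrow> bool"
  where "rooted_map X Y M \<longleftrightarrow> pseudo_map X Y M \<and>
    RootIso M \<in> hom (Base Y) (fobj (BaseF M) (Root X)) (Root Y) \<and> iso_arr (Base Y) (RootIso M)"

definition cc_transformation ::
    "('o, 'm, 't, 'n, 'z) compcat_scheme \<Rightarrow> ('o, 'm, 't, 'n, 'z) compcat_scheme \<Rightarrow>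
     ('o, 'm, 't, 'n, 'w) ccmap_scheme \<Rightarrow> ('o, 'm, 't, 'n, 'w) ccmap_scheme \<Rightarrow>
     ('o \<Rightarrow> 'm) \<times> ('t \<Rightarrow> 'n) \<Rightarrow> bool"
  where "cc_transformation X Y M N a \<longleftrightarrow> (case a of (\<alpha>, \<alpha>') \<Rightarrow>
    nat_trans (Base X) (Base Y) (BaseF M) (BaseF N) \<alpha> \<and>
    nat_trans (Tot X) (Tot Y) (TotF M) (TotF N) \<alpha>' \<and>
    (\<forall>A \<in> Obj (Tot X). farr (Proj Y) (\<alpha>' A) = \<alpha> (fobj (Proj X) A)) \<and>
    (\<forall>A \<in> Obj (Tot X).
      stop (Phi N A) \<cdot>\<^bsub>Base Y\<^esub> stop (farr (Chi Y) (\<alpha>' A)) = \<alpha> (ctx_ext X A) \<cdot>\<^bsub>Base Y\<^esub> stop (Phi M A)))"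

definition rooted_transformation ::
    "('o, 'm, 't, 'n) rcompcat \<Rightarrow> ('o, 'm, 't, 'n) rcompcat \<Rightarrow>
     ('o, 'm, 't, 'n) rccmap \<Rightarrow> ('o, 'm, 't, 'n) rccmap \<Rightarrow> ('o \<Rightarrow> 'm) \<times> ('t \<Rightarrow> 'n) \<Rightarrow> bool"
  where "rooted_transformation X Y M N a \<longleftrightarrow> cc_transformation X Y M N a \<and>
    RootIso N \<cdot>\<^bsub>Base Y\<^esub> fst a (Root X) = RootIso M"

definition id_rccmap :: "('o, 'm, 't, 'n) rcompcat \<Rightarrow> ('o, 'm, 't, 'n) rccmap"
  where "id_rccmap X =
    \<lparr> BaseF = id_ftor (Base X),
      TotF = id_ftor (Tot X),
      Phi = id_nat (Tot X) (arrow_cat (Base X)) (Chi X),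
      RootIso = Id (Base X) (Root X) \<rparr>"

definition comp_rccmap ::
    "('o, 'm, 't, 'n) rcompcat \<Rightarrow> ('o, 'm, 't, 'n) rcompcat \<Rightarrow> ('o, 'm, 't, 'n) rcompcat \<Rightarrow>
     ('o, 'm, 't, 'n) rccmap \<Rightarrow> ('o, 'm, 't, 'n) rccmap \<Rightarrow> ('o, 'm, 't, 'n) rccmap"
  where "comp_rccmap X Y Z N M =
    \<lparr> BaseF = comp_ftor (Base X) (BaseF N) (BaseF M),
      TotF = comp_ftor (Tot X) (TotF N) (TotF M),
      Phi = (\<lambda>A \<in> Obj (Tot X).
        farr (arrow_ftor (Base Y) (BaseF N)) (Phi M A) \<cdot>\<^bsub>arrow_cat (Base Z)\<^esub> Phi N (fobj (TotF M) A)),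
      RootIso = RootIso N \<cdot>\<^bsub>Base Z\<^esub> farr (BaseF N) (RootIso M) \<rparr>"

type_synonym ('o, 'm, 't, 'n) cc_2cell =
  "(('o, 'm, 't, 'n) rccmap, ('o \<Rightarrow> 'm) \<times> ('t \<Rightarrow> 'n)) cell"

definition cc_hom :: "('o, 'm, 't, 'n) rcompcat \<Rightarrow> ('o, 'm, 't, 'n) rcompcat \<Rightarrow>
    (('o, 'm, 't, 'n) rccmap, ('o, 'm, 't, 'n) cc_2cell) cat"
  where "cc_hom X Y =
    (let O1 = {M. rooted_map X Y M};
         A = {Cell M N a | M N a. M \<in> O1 \<and> N \<in> O1 \<and> rooted_transformation X Y M N a} in
     \<lparr> Obj = O1,
       Arr = A,
       Dom = restrict csrc A,
       Cod = restrict ctgt A,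
       Id = (\<lambda>M \<in> O1. Cell M M
         (id_nat (Base X) (Base Y) (BaseF M), id_nat (Tot X) (Tot Y) (TotF M))),
       Comp = (\<lambda>b a. if a \<in> A \<and> b \<in> A \<and> ctgt a = csrc b
         then Cell (csrc a) (ctgt b)
           (vcomp (Base X) (Base Y) (fst (ccomp b)) (fst (ccomp a)),
            vcomp (Tot X) (Tot Y) (snd (ccomp b)) (snd (ccomp a))) else undefined) \<rparr>)"

definition CompCat_rtd ::
    "(('o, 'm, 't, 'n) rcompcat, ('o, 'm, 't, 'n) rccmap, ('o, 'm, 't, 'n) cc_2cell) twocat"
  where "CompCat_rtd =
    \<lparr> Cell0 = {X. rooted_compcat X},
      HomCat = cc_hom,
      Id1 = id_rccmap,
      Comp1 = comp_rccmap,
      Comp2 = (\<lambda>X Y Z b a.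
        Cell (comp_rccmap X Y Z (csrc b) (csrc a)) (comp_rccmap X Y Z (ctgt b) (ctgt a))
          (hcomp (Base X) (Base Z) (BaseF (csrc b)) (BaseF (ctgt a)) (fst (ccomp b)) (fst (ccomp a)),
           hcomp (Tot X) (Tot Z) (TotF (csrc b)) (TotF (ctgt a)) (snd (ccomp b)) (snd (ccomp a)))) \<rparr>"

text \<open>\<open>strict_map\<close> imposes no condition on \<open>RootIso\<close>: the root is preserved up to isomorphism only.\<close>

definition CompCat_str2_rtd ::
    "(('o, 'm, 't, 'n) rcompcat, ('o, 'm, 't, 'n) rccmap, ('o, 'm, 't, 'n) cc_2cell) twocat"
  where "CompCat_str2_rtd = locally_full_sub2cat CompCat_rtd strict_map"

type_synonym ('o, 'm) subcat_CompCat =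
  "(('o, 'm, 'm, 'm sq) rcompcat, ('o, 'm, 'm, 'm sq) rccmap, ('o, 'm, 'm, 'm sq) cc_2cell) twocat"

definition CompCat_rtd_repl_compcl :: "('o, 'm) subcat_CompCat"
  where "CompCat_rtd_repl_compcl =
    full_sub2cat CompCat_rtd (\<lambda>X. replete X \<and> composition_closed X)"

definition CompCat_str2_rtd_repl_compcl :: "('o, 'm) subcat_CompCat"
  where "CompCat_str2_rtd_repl_compcl =
    full_sub2cat CompCat_str2_rtd (\<lambda>X. replete X \<and> composition_closed X)"

end

theory Submission
  imports Defs
begin

text \<open>
  A replete, composition-closed subcategorical comprehension category is determined by its base \<open>C\<close>,
  its class \<open>D\<close> of display maps and its root, because \<open>Tot\<close> is the full subcategory of the arrow
  category on \<open>D\<close>.  Since \<open>D\<close> contains the identities, a square between display maps is cartesian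
  exactly when it is a pullback, so the fibration condition is the display map condition; since \<open>D\<close>
  is closed under composition and isomorphism, both rootedness conditions say that every map to the
  root is in \<open>D\<close>.  A strict map is determined by its base functor and a transformation by its base
  component, so forgetting the total part is a 2-functor that is bijective on 0-cells, 1-cells and
  2-cells.  Finally, if \<open>M\<close> is a pseudo map, its comparison \<open>Phi M\<close> together with an identity on the
  base is an invertible 2-cell from \<open>M\<close> to the strict map with the same base functor; repleteness
  makes this strict map land in \<open>D\<close>.
\<close>

section \<open>Categories and functors in terms of arrows\<close>

text \<open>The axioms of a 2-category are proved once, for pseudo maps; the strict 2-category is a
  locally full part of it, and the 2-functor behind the equivalence is the inclusion, which is the
  identity on 0-cells. For the isomorphism, only forgetting is shown to be a 2-functor; its inverse
  is obtained from bijectivity, so no composite of reconstructed maps or of lifted transformations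
  is ever computed. Two points need an argument beyond determination by the base. A clan map must
  preserve all pullback squares over display maps and all terminal objects, whereas a map of
  comprehension categories preserves cartesian arrows and one root: uniqueness of pullbacks and
  repleteness make each such square cartesian, the components of \<open>Phi\<close> carry its image
  under \<open>TotF\<close> to its image under \<open>BaseF\<close>, and \<open>RootIso\<close>
  carries terminality. Moreover the isomorphisms at the root are extra data of a 1-cell and an extra
  condition on a 2-cell: since the target root is terminal, the data are unique and the condition is
  automatic.\<close>

lemma hom_iff: "f \<in> hom C x y \<longleftrightarrow> f \<in> Arr C \<and> Dom C f = x \<and> Cod C f = y"
  by (auto simp: hom_def)

context category begin

lemma Dom_Obj [simp]: "f \<in> Arr C \<Longrightarrow> Dom C f \<in> Obj C"
  using Dom_mem by auto

lemma Cod_Obj [simp]: "f \<in> Arr C \<Longrightarrow> Cod C f \<in> Obj C"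
  using Cod_mem by auto

lemma Id_Arr [simp]: "x \<in> Obj C \<Longrightarrow> Id C x \<in> Arr C"
  and Dom_Id [simp]: "x \<in> Obj C \<Longrightarrow> Dom C (Id C x) = x"
  and Cod_Id [simp]: "x \<in> Obj C \<Longrightarrow> Cod C (Id C x) = x"
  using Id_mem by (auto simp: hom_iff)

lemma Comp_Arr [simp]: "\<lbrakk>f \<in> Arr C; g \<in> Arr C; Cod C f = Dom C g\<rbrakk> \<Longrightarrow> g \<cdot>\<^bsub>C\<^esub> f \<in> Arr C"
  and Dom_Comp [simp]: "\<lbrakk>f \<in> Arr C; g \<in> Arr C; Cod C f = Dom C g\<rbrakk> \<Longrightarrow> Dom C (g \<cdot>\<^bsub>C\<^esub> f) = Dom C f"
  and Cod_Comp [simp]: "\<lbrakk>f \<in> Arr C; g \<in> Arr C; Cod C f = Dom C g\<rbrakk> \<Longrightarrow> Cod C (g \<cdot>\<^bsub>C\<^esub> f) = Cod C g"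
  using Comp_mem[of f "Dom C f" "Cod C f" g "Cod C g"] by (auto simp: hom_iff)

lemma Comp_Id_r [simp]: "\<lbrakk>f \<in> Arr C; Dom C f = x\<rbrakk> \<Longrightarrow> f \<cdot>\<^bsub>C\<^esub> Id C x = f"
  using Comp_Id_right by (auto simp: hom_iff)

lemma Comp_Id_l [simp]: "\<lbrakk>f \<in> Arr C; Cod C f = x\<rbrakk> \<Longrightarrow> Id C x \<cdot>\<^bsub>C\<^esub> f = f"
  using Comp_Id_left by (auto simp: hom_iff)

text \<open>Composability is phrased through \<open>Dom\<close> and \<open>Cod\<close> so that the
  simplifier can discharge it. Right-nested composites are its normal form; proofs that cancel an
  inner pair first undo the nesting by using this rule backwards.\<close>

lemma Comp_assoc' [simp]:
  "\<lbrakk>f \<in> Arr C; g \<in> Arr C; h \<in> Arr C; Cod C f = Dom C g; Cod C g = Dom C h\<rbrakk>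
    \<Longrightarrow> (h \<cdot>\<^bsub>C\<^esub> g) \<cdot>\<^bsub>C\<^esub> f = h \<cdot>\<^bsub>C\<^esub> (g \<cdot>\<^bsub>C\<^esub> f)"
  using Comp_assoc by (auto simp: hom_iff)

end

lemma categoryI:
  assumes "Dom C \<in> extensional (Arr C)" "Cod C \<in> extensional (Arr C)" "Id C \<in> extensional (Obj C)"
    and "\<And>f. f \<in> Arr C \<Longrightarrow> Dom C f \<in> Obj C" "\<And>f. f \<in> Arr C \<Longrightarrow> Cod C f \<in> Obj C"
    and "\<And>x. x \<in> Obj C \<Longrightarrow> Id C x \<in> Arr C \<and> Dom C (Id C x) = x \<and> Cod C (Id C x) = x"
    and "\<And>f g. \<not> (f \<in> Arr C \<and> g \<in> Arr C \<and> Cod C f = Dom C g) \<Longrightarrow> g \<cdot>\<^bsub>C\<^esub> f = undefined"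
    and "\<And>f g. \<lbrakk>f \<in> Arr C; g \<in> Arr C; Cod C f = Dom C g\<rbrakk>
      \<Longrightarrow> g \<cdot>\<^bsub>C\<^esub> f \<in> Arr C \<and> Dom C (g \<cdot>\<^bsub>C\<^esub> f) = Dom C f \<and> Cod C (g \<cdot>\<^bsub>C\<^esub> f) = Cod C g"
    and "\<And>f. f \<in> Arr C \<Longrightarrow> f \<cdot>\<^bsub>C\<^esub> Id C (Dom C f) = f"
    and "\<And>f. f \<in> Arr C \<Longrightarrow> Id C (Cod C f) \<cdot>\<^bsub>C\<^esub> f = f"
    and "\<And>f g h. \<lbrakk>f \<in> Arr C; g \<in> Arr C; h \<in> Arr C; Cod C f = Dom C g; Cod C g = Dom C h\<rbrakk>
      \<Longrightarrow> (h \<cdot>\<^bsub>C\<^esub> g) \<cdot>\<^bsub>C\<^esub> f = h \<cdot>\<^bsub>C\<^esub> (g \<cdot>\<^bsub>C\<^esub> f)"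
  shows "category C"
  using assms by unfold_locales (auto simp: hom_iff PiE_iff)

lemma iso_arrE:
  assumes "iso_arr C f"
  obtains g where "f \<in> Arr C" "g \<in> Arr C" "Dom C g = Cod C f" "Cod C g = Dom C f"
    "g \<cdot>\<^bsub>C\<^esub> f = Id C (Dom C f)" "f \<cdot>\<^bsub>C\<^esub> g = Id C (Cod C f)"
  using assms by (auto simp: iso_arr_def hom_iff)

lemma iso_arrI:
  "\<lbrakk>f \<in> Arr C; g \<in> Arr C; Dom C g = Cod C f; Cod C g = Dom C f;
    g \<cdot>\<^bsub>C\<^esub> f = Id C (Dom C f); f \<cdot>\<^bsub>C\<^esub> g = Id C (Cod C f)\<rbrakk> \<Longrightarrow> iso_arr C f"
  by (auto simp: iso_arr_def hom_iff)

lemma iso_arr_Arr: "iso_arr C f \<Longrightarrow> f \<in> Arr C"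
  by (simp add: iso_arr_def)

lemma isomorphicI: "\<lbrakk>iso_arr C f; Dom C f = x; Cod C f = y\<rbrakk> \<Longrightarrow> isomorphic C x y"
  by (auto simp: isomorphic_def hom_iff iso_arr_def)

context category begin

lemma iso_arr_Id: "x \<in> Obj C \<Longrightarrow> iso_arr C (Id C x)"
  by (rule iso_arrI[where g = "Id C x"]) auto

lemma iso_arr_Comp:
  assumes f: "iso_arr C f" and g: "iso_arr C g" and fg: "Cod C f = Dom C g"
  shows "iso_arr C (g \<cdot>\<^bsub>C\<^esub> f)"
proof -
  obtain f' where f': "f \<in> Arr C" "f' \<in> Arr C" "Dom C f' = Cod C f" "Cod C f' = Dom C f"
    "f' \<cdot>\<^bsub>C\<^esub> f = Id C (Dom C f)" "f \<cdot>\<^bsub>C\<^esub> f' = Id C (Cod C f)" using f by (rule iso_arrE)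
  obtain g' where g': "g \<in> Arr C" "g' \<in> Arr C" "Dom C g' = Cod C g" "Cod C g' = Dom C g"
    "g' \<cdot>\<^bsub>C\<^esub> g = Id C (Dom C g)" "g \<cdot>\<^bsub>C\<^esub> g' = Id C (Cod C g)" using g by (rule iso_arrE)
  have 1: "g' \<cdot>\<^bsub>C\<^esub> (g \<cdot>\<^bsub>C\<^esub> f) = f"
    using f' g' fg by (simp flip: Comp_assoc')
  have 2: "f \<cdot>\<^bsub>C\<^esub> (f' \<cdot>\<^bsub>C\<^esub> g') = g'"
    using f' g' fg by (simp flip: Comp_assoc')
  show ?thesis
    by (rule iso_arrI[where g = "f' \<cdot>\<^bsub>C\<^esub> g'"]) (use f' g' fg 1 2 in simp_all)
qed

lemma iso_arr_inverse:
  assumes "iso_arr C f"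
  obtains g where "iso_arr C g" "f \<in> Arr C" "g \<in> Arr C" "Dom C g = Cod C f" "Cod C g = Dom C f"
    "g \<cdot>\<^bsub>C\<^esub> f = Id C (Dom C f)" "f \<cdot>\<^bsub>C\<^esub> g = Id C (Cod C f)"
proof -
  obtain g where g: "f \<in> Arr C" "g \<in> Arr C" "Dom C g = Cod C f" "Cod C g = Dom C f"
    "g \<cdot>\<^bsub>C\<^esub> f = Id C (Dom C f)" "f \<cdot>\<^bsub>C\<^esub> g = Id C (Cod C f)" using assms by (rule iso_arrE)
  moreover have "iso_arr C g"
    by (rule iso_arrI[where g = f]) (use g in auto)
  ultimately show ?thesis using that by blast
qed

lemma iso_arr_mono:
  assumes "iso_arr C f" "u \<in> Arr C" "v \<in> Arr C" "Cod C u = Dom C f" "Cod C v = Dom C f"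
    and eq: "f \<cdot>\<^bsub>C\<^esub> u = f \<cdot>\<^bsub>C\<^esub> v"
  shows "u = v"
proof -
  obtain g where g: "f \<in> Arr C" "g \<in> Arr C" "Dom C g = Cod C f" "Cod C g = Dom C f"
    "g \<cdot>\<^bsub>C\<^esub> f = Id C (Dom C f)" using assms(1) by (rule iso_arrE)
  have "(g \<cdot>\<^bsub>C\<^esub> f) \<cdot>\<^bsub>C\<^esub> u = (g \<cdot>\<^bsub>C\<^esub> f) \<cdot>\<^bsub>C\<^esub> v"
    using eq g(1-4) assms(2-5) by simp
  then show ?thesis using g assms by (simp del: Comp_assoc')
qed

lemma terminal_unique:
  assumes "terminal C t" "f \<in> Arr C" "g \<in> Arr C" "Cod C f = t" "Cod C g = t" "Dom C f = Dom C g"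
  shows "f = g"
  using assms unfolding terminal_def hom_iff by (metis Dom_Obj)

lemma terminal_iso:
  assumes s: "terminal C s" and t: "terminal C t" and f: "f \<in> Arr C" "Dom C f = s" "Cod C f = t"
  shows "iso_arr C f"
proof -
  obtain g where g: "g \<in> Arr C" "Dom C g = t" "Cod C g = s"
    using s t unfolding terminal_def hom_iff by metis
  have "s \<in> Obj C" "t \<in> Obj C" using s t by (auto simp: terminal_def)
  then show ?thesis
    by (intro iso_arrI[where g = g] terminal_unique[OF s] terminal_unique[OF t]) (use f g in auto)
qed

text \<open>An arrow into \<open>s\<close> is determined by its composite with the isomorphism
  \<open>f\<close>, and that composite is the unique arrow into \<open>t\<close>.\<close>

lemma terminal_isomorphic:
  assumes t: "terminal C t" and f: "iso_arr C f" "Dom C f = s" "Cod C f = t"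
  shows "terminal C s"
proof -
  obtain g where g: "f \<in> Arr C" "g \<in> Arr C" "Dom C g = Cod C f" "Cod C g = Dom C f"
    "g \<cdot>\<^bsub>C\<^esub> f = Id C (Dom C f)" "f \<cdot>\<^bsub>C\<^esub> g = Id C (Cod C f)" using f(1) by (rule iso_arrE)
  have "\<exists>!h. h \<in> hom C x s" if x: "x \<in> Obj C" for x
  proof -
    obtain k where k: "k \<in> Arr C" "Dom C k = x" "Cod C k = t"
      using t x unfolding terminal_def hom_iff by metis
    show ?thesis
    proof (rule ex1I[of _ "g \<cdot>\<^bsub>C\<^esub> k"])
      show "g \<cdot>\<^bsub>C\<^esub> k \<in> hom C x s" using g k f by (simp add: hom_iff)
      fix h assume h: "h \<in> hom C x s"
      have "f \<cdot>\<^bsub>C\<^esub> h = k"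
        by (rule terminal_unique[OF t]) (use g k f h in \<open>auto simp: hom_iff\<close>)
      then show "h = g \<cdot>\<^bsub>C\<^esub> k"
        using g h f by (auto simp: hom_iff simp flip: Comp_assoc')
    qed
  qed
  then show ?thesis using g f by (auto simp: terminal_def)
qed

end

section \<open>Functors: typing rules, equality and composition\<close>

locale func =
  fixes C :: "('o, 'm) cat" and D :: "('p, 'n) cat" and F :: "('o, 'm, 'p, 'n) ftor"
  assumes is_functor: "is_functor C D F"

sublocale func \<subseteq> S: category C using is_functor by (simp add: is_functor_def)
sublocale func \<subseteq> T: category D using is_functor by (simp add: is_functor_def)

context func begin

lemma fobj_ext: "fobj F \<in> extensional (Obj C)"
  and farr_ext: "farr F \<in> extensional (Arr C)"
  using is_functor by (auto simp: is_functor_def PiE_iff)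

lemma fobj_Obj [simp]: "x \<in> Obj C \<Longrightarrow> fobj F x \<in> Obj D"
  using is_functor by (auto simp: is_functor_def)

lemma farr_Arr [simp]: "f \<in> Arr C \<Longrightarrow> farr F f \<in> Arr D"
  and Dom_farr [simp]: "f \<in> Arr C \<Longrightarrow> Dom D (farr F f) = fobj F (Dom C f)"
  and Cod_farr [simp]: "f \<in> Arr C \<Longrightarrow> Cod D (farr F f) = fobj F (Cod C f)"
  using is_functor by (auto simp: is_functor_def hom_iff)

lemma farr_Id [simp]: "x \<in> Obj C \<Longrightarrow> farr F (Id C x) = Id D (fobj F x)"
  using is_functor by (auto simp: is_functor_def)

lemma farr_Comp [simp]: "\<lbrakk>f \<in> Arr C; g \<in> Arr C; Cod C f = Dom C g\<rbrakk>
    \<Longrightarrow> farr F (g \<cdot>\<^bsub>C\<^esub> f) = farr F g \<cdot>\<^bsub>D\<^esub> farr F f"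
  using is_functor by (auto simp: is_functor_def hom_iff)

lemma iso_arr_farr:
  assumes "iso_arr C f" shows "iso_arr D (farr F f)"
proof -
  obtain g where g: "f \<in> Arr C" "g \<in> Arr C" "Dom C g = Cod C f" "Cod C g = Dom C f"
    "g \<cdot>\<^bsub>C\<^esub> f = Id C (Dom C f)" "f \<cdot>\<^bsub>C\<^esub> g = Id C (Cod C f)" using assms by (rule iso_arrE)
  show ?thesis
    by (rule iso_arrI[where g = "farr F g"]) (use g in \<open>simp_all flip: farr_Comp\<close>)
qed

end

lemma is_functorI:
  assumes "category C" "category D"
    and "fobj F \<in> extensional (Obj C)" "farr F \<in> extensional (Arr C)"
    and "\<And>x. x \<in> Obj C \<Longrightarrow> fobj F x \<in> Obj D"
    and "\<And>f. f \<in> Arr C \<Longrightarrow> farr F f \<in> Arr D \<and> Dom D (farr F f) = fobj F (Dom C f) \<and>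
      Cod D (farr F f) = fobj F (Cod C f)"
    and "\<And>x. x \<in> Obj C \<Longrightarrow> farr F (Id C x) = Id D (fobj F x)"
    and "\<And>f g. \<lbrakk>f \<in> Arr C; g \<in> Arr C; Cod C f = Dom C g\<rbrakk>
      \<Longrightarrow> farr F (g \<cdot>\<^bsub>C\<^esub> f) = farr F g \<cdot>\<^bsub>D\<^esub> farr F f"
  shows "is_functor C D F"
  using assms unfolding is_functor_def by (auto simp: hom_iff PiE_iff)

text \<open>Functors are \<open>undefined\<close> outside their domain, so agreement on objects and
  arrows is equality of records. The two codomain categories may differ, since the record does not
  store them.\<close>

lemma ftor_eqI:
  assumes "is_functor C D F" "is_functor C D' G"
    and "\<And>x. x \<in> Obj C \<Longrightarrow> fobj F x = fobj G x" "\<And>f. f \<in> Arr C \<Longrightarrow> farr F f = farr G f"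
  shows "F = G"
proof -
  interpret F: func C D F by unfold_locales fact
  interpret G: func C D' G by unfold_locales fact
  have "fobj F = fobj G" "farr F = farr G"
    using assms(3,4) F.fobj_ext F.farr_ext G.fobj_ext G.farr_ext by (auto intro!: extensionalityI)
  then show ?thesis by simp
qed

lemma fobj_id_ftor [simp]: "x \<in> Obj C \<Longrightarrow> fobj (id_ftor C) x = x"
  and farr_id_ftor [simp]: "f \<in> Arr C \<Longrightarrow> farr (id_ftor C) f = f"
  by (simp_all add: id_ftor_def)

lemma fobj_comp_ftor [simp]: "x \<in> Obj C \<Longrightarrow> fobj (comp_ftor C G F) x = fobj G (fobj F x)"
  and farr_comp_ftor [simp]: "f \<in> Arr C \<Longrightarrow> farr (comp_ftor C G F) f = farr G (farr F f)"
  by (simp_all add: comp_ftor_def)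

lemma (in category) is_functor_id: "is_functor C C (id_ftor C)"
  by (rule is_functorI) (auto simp: category_axioms id_ftor_def)

lemma is_functor_comp:
  assumes "is_functor C D F" "is_functor D E G"
  shows "is_functor C E (comp_ftor C G F)"
proof -
  interpret F: func C D F by unfold_locales fact
  interpret G: func D E G by unfold_locales fact
  show ?thesis
    by (rule is_functorI) (auto simp: F.S.category_axioms G.T.category_axioms comp_ftor_def)
qed

lemma comp_ftor_id_right: assumes "is_functor C D F" shows "comp_ftor C F (id_ftor C) = F"
proof -
  interpret F: func C D F by unfold_locales fact
  show ?thesis
    by (rule ftor_eqI[OF is_functor_comp[OF F.S.is_functor_id assms] assms]) auto
qed

lemma comp_ftor_id_left: assumes "is_functor C D F" shows "comp_ftor C (id_ftor D) F = F"
proof -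
  interpret F: func C D F by unfold_locales fact
  show ?thesis
    by (rule ftor_eqI[OF is_functor_comp[OF assms F.T.is_functor_id] assms]) auto
qed

text \<open>Since \<open>F\<close> lands in \<open>C\<close>, the restriction built into
  \<open>comp_ftor C H G\<close> has no effect after \<open>F\<close>.\<close>

lemma comp_ftor_assoc:
  assumes "is_functor B C F"
  shows "comp_ftor B (comp_ftor C H G) F = comp_ftor B H (comp_ftor B G F)"
proof -
  interpret F: func B C F by unfold_locales fact
  show ?thesis by (auto simp: comp_ftor_def restrict_def fun_eq_iff)
qed

section \<open>Natural transformations\<close>

locale ntrans =
  fixes C :: "('o, 'm) cat" and D :: "('p, 'n) cat" and F G \<alpha>
  assumes nat_trans: "nat_trans C D F G \<alpha>"

sublocale ntrans \<subseteq> F: func C D F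
  using nat_trans by unfold_locales (simp add: nat_trans_def)
sublocale ntrans \<subseteq> G: func C D G
  using nat_trans by unfold_locales (simp add: nat_trans_def)

context ntrans begin

lemma ext: "\<alpha> \<in> extensional (Obj C)"
  using nat_trans by (simp add: nat_trans_def)

lemma Arr [simp]: "x \<in> Obj C \<Longrightarrow> \<alpha> x \<in> Arr D"
  and Dom [simp]: "x \<in> Obj C \<Longrightarrow> Dom D (\<alpha> x) = fobj F x"
  and Cod [simp]: "x \<in> Obj C \<Longrightarrow> Cod D (\<alpha> x) = fobj G x"
  using nat_trans by (auto simp: nat_trans_def hom_iff)

lemma naturality:
  "\<lbrakk>f \<in> Arr C; Cod C f = y\<rbrakk> \<Longrightarrow> \<alpha> y \<cdot>\<^bsub>D\<^esub> farr F f = farr G f \<cdot>\<^bsub>D\<^esub> \<alpha> (Dom C f)"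
  using nat_trans by (auto simp: nat_trans_def hom_iff)

text \<open>Right-nesting hides the left-hand side of \<open>naturality\<close> inside longer
  composites; this form applies there.\<close>

lemma naturality':
  assumes "f \<in> Arr C" "Cod C f = y" "h \<in> Arr D" "Cod D h = fobj F (Dom C f)"
  shows "\<alpha> y \<cdot>\<^bsub>D\<^esub> (farr F f \<cdot>\<^bsub>D\<^esub> h) = farr G f \<cdot>\<^bsub>D\<^esub> (\<alpha> (Dom C f) \<cdot>\<^bsub>D\<^esub> h)"
  using assms naturality[OF assms(1,2)] F.S.Cod_Obj[OF assms(1)] by (simp flip: F.T.Comp_assoc')

end

lemma nat_transI:
  assumes "is_functor C D F" "is_functor C D G" "\<alpha> \<in> extensional (Obj C)"
    and "\<And>x. x \<in> Obj C \<Longrightarrow> \<alpha> x \<in> Arr D \<and> Dom D (\<alpha> x) = fobj F x \<and> Cod D (\<alpha> x) = fobj G x"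
    and "\<And>f. f \<in> Arr C \<Longrightarrow> \<alpha> (Cod C f) \<cdot>\<^bsub>D\<^esub> farr F f = farr G f \<cdot>\<^bsub>D\<^esub> \<alpha> (Dom C f)"
  shows "nat_trans C D F G \<alpha>"
  using assms by (auto simp: nat_trans_def hom_iff)

lemma nat_trans_eqI:
  assumes "nat_trans C D F G \<alpha>" "nat_trans C D F' G' \<beta>" "\<And>x. x \<in> Obj C \<Longrightarrow> \<alpha> x = \<beta> x"
  shows "\<alpha> = \<beta>"
  using assms by (auto simp: nat_trans_def intro: extensionalityI)

lemma id_nat_app [simp]: "x \<in> Obj C \<Longrightarrow> id_nat C D F x = Id D (fobj F x)"
  and vcomp_app [simp]: "x \<in> Obj C \<Longrightarrow> vcomp C D \<beta> \<alpha> x = \<beta> x \<cdot>\<^bsub>D\<^esub> \<alpha> x"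
  by (simp_all add: id_nat_def vcomp_def)

lemma hcomp_app [simp]:
  "x \<in> Obj C \<Longrightarrow> hcomp C E G F' \<beta> \<alpha> x = \<beta> (fobj F' x) \<cdot>\<^bsub>E\<^esub> farr G (\<alpha> x)"
  by (simp add: hcomp_def)

lemma nat_trans_id:
  assumes "is_functor C D F" shows "nat_trans C D F F (id_nat C D F)"
proof -
  interpret F: func C D F by unfold_locales fact
  show ?thesis by (rule nat_transI) (auto simp: assms id_nat_def)
qed

lemma nat_trans_vcomp:
  assumes "nat_trans C D F G \<alpha>" "nat_trans C D G H \<beta>"
  shows "nat_trans C D F H (vcomp C D \<beta> \<alpha>)"
proof -
  interpret a: ntrans C D F G \<alpha> by unfold_locales fact
  interpret b: ntrans C D G H \<beta> by unfold_locales fact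
  show ?thesis
    by (rule nat_transI)
      (auto simp: a.F.is_functor b.G.is_functor vcomp_def a.naturality b.naturality')
qed

lemma nat_trans_hcomp:
  assumes "nat_trans C D F F' \<alpha>" "nat_trans D E G G' \<beta>"
  shows "nat_trans C E (comp_ftor C G F) (comp_ftor C G' F') (hcomp C E G F' \<beta> \<alpha>)"
proof -
  interpret a: ntrans C D F F' \<alpha> by unfold_locales fact
  interpret b: ntrans D E G G' \<beta> by unfold_locales fact
  show ?thesis
  proof (rule nat_transI)
    fix f assume f: "f \<in> Arr C"
    have "farr G (\<alpha> (Cod C f)) \<cdot>\<^bsub>E\<^esub> farr G (farr F f) = farr G (farr F' f) \<cdot>\<^bsub>E\<^esub> farr G (\<alpha> (Dom C f))"
      using f by (simp add: a.naturality flip: b.F.farr_Comp)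
    then show "hcomp C E G F' \<beta> \<alpha> (Cod C f) \<cdot>\<^bsub>E\<^esub> farr (comp_ftor C G F) f
        = farr (comp_ftor C G' F') f \<cdot>\<^bsub>E\<^esub> hcomp C E G F' \<beta> \<alpha> (Dom C f)"
      using f by (simp add: b.naturality')
  qed (auto simp: hcomp_def intro!: is_functor_comp[OF a.F.is_functor b.F.is_functor]
      is_functor_comp[OF a.G.is_functor b.G.is_functor])
qed

lemma vcomp_id_right:
  assumes "nat_trans C D F G \<alpha>" shows "vcomp C D \<alpha> (id_nat C D F) = \<alpha>"
proof -
  interpret a: ntrans C D F G \<alpha> by unfold_locales fact
  show ?thesis
    by (rule nat_trans_eqI[OF nat_trans_vcomp[OF nat_trans_id assms] assms])
      (auto simp: a.F.is_functor)
qed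

lemma vcomp_id_left:
  assumes "nat_trans C D F G \<alpha>" shows "vcomp C D (id_nat C D G) \<alpha> = \<alpha>"
proof -
  interpret a: ntrans C D F G \<alpha> by unfold_locales fact
  show ?thesis
    by (rule nat_trans_eqI[OF nat_trans_vcomp[OF assms nat_trans_id] assms])
      (auto simp: a.G.is_functor)
qed

lemma vcomp_assoc:
  assumes "nat_trans C D F G \<alpha>" "nat_trans C D G H \<beta>" "nat_trans C D H I \<gamma>"
  shows "vcomp C D (vcomp C D \<gamma> \<beta>) \<alpha> = vcomp C D \<gamma> (vcomp C D \<beta> \<alpha>)"
proof -
  interpret a: ntrans C D F G \<alpha> by unfold_locales fact
  interpret b: ntrans C D G H \<beta> by unfold_locales fact
  interpret c: ntrans C D H I \<gamma> by unfold_locales fact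
  show ?thesis
    by (rule nat_trans_eqI[OF nat_trans_vcomp[OF assms(1) nat_trans_vcomp[OF assms(2,3)]]
      nat_trans_vcomp[OF nat_trans_vcomp[OF assms(1,2)] assms(3)]]) auto
qed

lemma hcomp_id:
  assumes "is_functor C D F" "is_functor D E G"
  shows "hcomp C E G F (id_nat D E G) (id_nat C D F) = id_nat C E (comp_ftor C G F)"
proof -
  interpret F: func C D F by unfold_locales fact
  interpret G: func D E G by unfold_locales fact
  show ?thesis by (auto simp: hcomp_def id_nat_def fun_eq_iff restrict_def)
qed

text \<open>Interchange is the naturality of \<open>\<beta>\<close> at the arrow
  \<open>\<alpha>' x\<close>, which exchanges the two middle factors of the fourfold
  composite.\<close>

lemma hcomp_vcomp:
  assumes "nat_trans C D F F' \<alpha>" "nat_trans C D F' F'' \<alpha>'"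
    "nat_trans D E G G' \<beta>" "nat_trans D E G' G'' \<beta>'"
  shows "hcomp C E G F'' (vcomp D E \<beta>' \<beta>) (vcomp C D \<alpha>' \<alpha>)
    = vcomp C E (hcomp C E G' F'' \<beta>' \<alpha>') (hcomp C E G F' \<beta> \<alpha>)"
proof -
  interpret a: ntrans C D F F' \<alpha> by unfold_locales fact
  interpret a': ntrans C D F' F'' \<alpha>' by unfold_locales fact
  interpret b: ntrans D E G G' \<beta> by unfold_locales fact
  interpret b': ntrans D E G' G'' \<beta>' by unfold_locales fact
  have "(\<beta>' (fobj F'' x) \<cdot>\<^bsub>E\<^esub> \<beta> (fobj F'' x)) \<cdot>\<^bsub>E\<^esub> farr G (\<alpha>' x \<cdot>\<^bsub>D\<^esub> \<alpha> x) =
    (\<beta>' (fobj F'' x) \<cdot>\<^bsub>E\<^esub> farr G' (\<alpha>' x)) \<cdot>\<^bsub>E\<^esub> (\<beta> (fobj F' x) \<cdot>\<^bsub>E\<^esub> farr G (\<alpha> x))" if "x \<in> Obj C" for x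
    using that by (simp add: b.naturality')
  then show ?thesis by (auto simp: hcomp_def vcomp_def restrict_def fun_eq_iff)
qed

lemma hcomp_id_right:
  assumes "nat_trans C D F G \<alpha>"
  shows "hcomp C D F (id_ftor C) \<alpha> (id_nat C C (id_ftor C)) = \<alpha>"
proof -
  interpret a: ntrans C D F G \<alpha> by unfold_locales fact
  show ?thesis using a.ext
    by (intro extensionalityI[where A = "Obj C"]) (auto simp: hcomp_def)
qed

lemma hcomp_id_left:
  assumes "nat_trans C D F G \<alpha>"
  shows "hcomp C D (id_ftor D) G (id_nat D D (id_ftor D)) \<alpha> = \<alpha>"
proof -
  interpret a: ntrans C D F G \<alpha> by unfold_locales fact
  show ?thesis using a.ext
    by (intro extensionalityI[where A = "Obj C"]) (auto simp: hcomp_def)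
qed

lemma hcomp_assoc:
  assumes "nat_trans B C F F' \<alpha>" "nat_trans C D G G' \<beta>" "nat_trans D E H H' \<gamma>"
  shows "hcomp B E (comp_ftor C H G) F' (hcomp C E H G' \<gamma> \<beta>) \<alpha>
    = hcomp B E H (comp_ftor B G' F') \<gamma> (hcomp B D G F' \<beta> \<alpha>)"
proof -
  interpret a: ntrans B C F F' \<alpha> by unfold_locales fact
  interpret b: ntrans C D G G' \<beta> by unfold_locales fact
  interpret c: ntrans D E H H' \<gamma> by unfold_locales fact
  show ?thesis by (auto simp: hcomp_def fun_eq_iff restrict_def)
qed

section \<open>Full subcategories\<close>

lemma full_subcat_simps:
  "Obj (full_subcat C S) = Obj C \<inter> S"
  "Arr (full_subcat C S) = {f \<in> Arr C. Dom C f \<in> S \<and> Cod C f \<in> S}"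
  "\<lbrakk>f \<in> Arr C; Dom C f \<in> S; Cod C f \<in> S\<rbrakk> \<Longrightarrow> Dom (full_subcat C S) f = Dom C f"
  "\<lbrakk>f \<in> Arr C; Dom C f \<in> S; Cod C f \<in> S\<rbrakk> \<Longrightarrow> Cod (full_subcat C S) f = Cod C f"
  "\<lbrakk>x \<in> Obj C; x \<in> S\<rbrakk> \<Longrightarrow> Id (full_subcat C S) x = Id C x"
  "\<lbrakk>f \<in> Arr C; Dom C f \<in> S; Cod C f \<in> S; g \<in> Arr C; Dom C g \<in> S; Cod C g \<in> S\<rbrakk>
    \<Longrightarrow> g \<cdot>\<^bsub>full_subcat C S\<^esub> f = g \<cdot>\<^bsub>C\<^esub> f"
  by (auto simp: full_subcat_def Let_def)

lemma hom_full_subcat: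
  "f \<in> hom (full_subcat C S) x y \<longleftrightarrow> f \<in> hom C x y \<and> x \<in> S \<and> y \<in> S"
  by (auto simp: hom_iff full_subcat_simps)

lemma (in category) category_full_subcat: "category (full_subcat C S)"
proof (rule categoryI)
  fix f g assume "\<not> (f \<in> Arr (full_subcat C S) \<and> g \<in> Arr (full_subcat C S)
    \<and> Cod (full_subcat C S) f = Dom (full_subcat C S) g)"
  then show "g \<cdot>\<^bsub>full_subcat C S\<^esub> f = undefined"
    using Comp_ext by (auto simp: full_subcat_def Let_def)
qed (auto simp: full_subcat_simps, auto simp: full_subcat_def Let_def)

lemma (in category) is_functor_full_subcat:
  "is_functor (full_subcat C S) C (id_ftor (full_subcat C S))"
  by (rule is_functorI)
    (auto simp: category_full_subcat category_axioms full_subcat_simps id_ftor_def)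

lemma (in category) iso_arr_full_subcat:
  assumes f: "iso_arr C f" and S: "Dom C f \<in> S" "Cod C f \<in> S"
  shows "iso_arr (full_subcat C S) f"
proof -
  obtain g where g: "f \<in> Arr C" "g \<in> Arr C" "Dom C g = Cod C f" "Cod C g = Dom C f"
    "g \<cdot>\<^bsub>C\<^esub> f = Id C (Dom C f)" "f \<cdot>\<^bsub>C\<^esub> g = Id C (Cod C f)" using f by (rule iso_arrE)
  show ?thesis
    by (rule iso_arrI[where g = g]) (use g S in \<open>simp_all add: full_subcat_simps\<close>)
qed

text \<open>Choice picks for each \<open>x\<close> an isomorphism \<open>e x\<close> onto
  \<open>x\<close> from an object of \<open>S\<close>. Conjugation by these isomorphisms is a
  functor back; their inverses \<open>i\<close> form the unit and they themselves the
  counit.\<close>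

lemma (in category) equivalence_full_subcat:
  assumes ess: "\<And>x. x \<in> Obj C \<Longrightarrow> \<exists>y \<in> Obj C \<inter> S. isomorphic C y x"
  shows "is_equivalence (full_subcat C S) C (id_ftor (full_subcat C S))"
proof -
  let ?S = "full_subcat C S"
  let ?I = "id_ftor ?S"
  have "\<exists>e. iso_arr C e \<and> Dom C e \<in> S \<and> Cod C e = x" if "x \<in> Obj C" for x
    using ess[OF that] by (auto simp: isomorphic_def hom_iff)
  then obtain e where e: "\<And>x. x \<in> Obj C \<Longrightarrow> iso_arr C (e x)"
      "\<And>x. x \<in> Obj C \<Longrightarrow> Dom C (e x) \<in> S" "\<And>x. x \<in> Obj C \<Longrightarrow> Cod C (e x) = x"
    by metis
  have "\<forall>x \<in> Obj C. \<exists>i. iso_arr C i \<and> Dom C i = x \<and> Cod C i = Dom C (e x)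
      \<and> i \<cdot>\<^bsub>C\<^esub> e x = Id C (Dom C (e x)) \<and> e x \<cdot>\<^bsub>C\<^esub> i = Id C x"
  proof
    fix x assume x: "x \<in> Obj C"
    obtain g where "iso_arr C g" "Dom C g = Cod C (e x)" "Cod C g = Dom C (e x)"
      "g \<cdot>\<^bsub>C\<^esub> e x = Id C (Dom C (e x))" "e x \<cdot>\<^bsub>C\<^esub> g = Id C (Cod C (e x))"
      using e(1)[OF x] by (rule iso_arr_inverse)
    then show "\<exists>i. iso_arr C i \<and> Dom C i = x \<and> Cod C i = Dom C (e x)
      \<and> i \<cdot>\<^bsub>C\<^esub> e x = Id C (Dom C (e x)) \<and> e x \<cdot>\<^bsub>C\<^esub> i = Id C x"
      using e(3)[OF x] by metis
  qed
  then obtain i where i: "\<And>x. x \<in> Obj C \<Longrightarrow> iso_arr C (i x)" "\<And>x. x \<in> Obj C \<Longrightarrow> Dom C (i x) = x"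
      "\<And>x. x \<in> Obj C \<Longrightarrow> Cod C (i x) = Dom C (e x)"
      "\<And>x. x \<in> Obj C \<Longrightarrow> i x \<cdot>\<^bsub>C\<^esub> e x = Id C (Dom C (e x))"
      "\<And>x. x \<in> Obj C \<Longrightarrow> e x \<cdot>\<^bsub>C\<^esub> i x = Id C x"
    by metis
  note arr [simp] = iso_arr_Arr[OF e(1)] iso_arr_Arr[OF i(1)]
  note [simp] = e(2,3) i(2-5)
  have cancel [simp]: "e x \<cdot>\<^bsub>C\<^esub> (i x \<cdot>\<^bsub>C\<^esub> h) = h"
    if "x \<in> Obj C" "h \<in> Arr C" "Cod C h = x" for x h
    using that by (simp flip: Comp_assoc')
  \<comment> \<open>In the image of a composite the inner \<open>e x\<close> and \<open>i x\<close>
    cancel, which gives functoriality.\<close>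
  let ?G = "\<lparr> fobj = (\<lambda>x \<in> Obj C. Dom C (e x)),
    farr = (\<lambda>f \<in> Arr C. i (Cod C f) \<cdot>\<^bsub>C\<^esub> (f \<cdot>\<^bsub>C\<^esub> e (Dom C f))) \<rparr>"
  have I: "is_functor ?S C ?I" by (rule is_functor_full_subcat)
  have G: "is_functor C ?S ?G"
    by (rule is_functorI)
      (auto simp: category_full_subcat category_axioms full_subcat_simps)
  have "nat_iso ?S ?S (id_ftor ?S) (comp_ftor ?S ?G ?I) (restrict i (Obj ?S))"
    unfolding nat_iso_def
  proof (intro conjI ballI nat_transI)
    show "is_functor ?S ?S (id_ftor ?S)" by (rule category.is_functor_id[OF category_full_subcat])
    show "is_functor ?S ?S (comp_ftor ?S ?G ?I)" by (rule is_functor_comp[OF I G])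
    show "iso_arr ?S (restrict i (Obj ?S) x)" if "x \<in> Obj ?S" for x
      using that by (auto simp: full_subcat_simps intro!: iso_arr_full_subcat i)
  qed (auto simp: full_subcat_simps)
  moreover have "nat_iso C C (comp_ftor C ?I ?G) (id_ftor C) (restrict e (Obj C))"
    unfolding nat_iso_def
  proof (intro conjI ballI nat_transI)
    show "is_functor C C (id_ftor C)" by (rule is_functor_id)
    show "is_functor C C (comp_ftor C ?I ?G)" by (rule is_functor_comp[OF G I])
  qed (auto simp: full_subcat_simps e)
  ultimately show ?thesis
    unfolding is_equivalence_def using I G by blast
qed

section \<open>Strict 2-categories\<close>

lemma two_category_full_sub2cat:
  assumes "two_category K" shows "two_category (full_sub2cat K P)"
proof -
  interpret two_category K by fact
  show ?thesis
    by (rule two_category.intro)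
      (auto simp: full_sub2cat_def HomCat_category Id1_mem Comp1_mem Comp2_Id interchange
        Comp1_Id_right Comp1_Id_left Comp2_Id_right Comp2_Id_left Comp1_assoc Comp2_assoc
        intro!: Comp2_mem)
qed

text \<open>Only closure of the 1-cells has to be checked: the equations between 2-cells are those
  of \<open>K\<close>, read in full subcategories of its hom-categories.\<close>

lemma two_category_locally_full_sub2cat:
  assumes "two_category K"
    and Q_Id: "\<And>x. x \<in> Cell0 K \<Longrightarrow> Q x x (Id1 K x)"
    and Q_Comp: "\<And>x y z f g. \<lbrakk>x \<in> Cell0 K; y \<in> Cell0 K; z \<in> Cell0 K; f \<in> Obj (HomCat K x y);
      g \<in> Obj (HomCat K y z); Q x y f; Q y z g\<rbrakk> \<Longrightarrow> Q x z (Comp1 K x y z g f)"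
  shows "two_category (locally_full_sub2cat K Q)"
proof -
  interpret two_category K by fact
  have objs: "f \<in> Obj (HomCat K x y)" "f' \<in> Obj (HomCat K x y)"
    if "x \<in> Cell0 K" "y \<in> Cell0 K" "\<alpha> \<in> hom (HomCat K x y) f f'" for x y f f' \<alpha>
    using that category.Dom_Obj[OF HomCat_category] category.Cod_Obj[OF HomCat_category]
    by (auto simp: hom_iff)
  show ?thesis
  proof (rule two_category.intro, goal_cases)
    case (1 x y)
    then show ?case
      by (simp add: locally_full_sub2cat_def category.category_full_subcat HomCat_category)
  next
    case (2 x)
    then show ?case
      by (simp add: locally_full_sub2cat_def full_subcat_simps Id1_mem Q_Id)
  next
    case (3 x y z f g)
    then show ?case
      by (simp add: locally_full_sub2cat_def full_subcat_simps Comp1_mem Q_Comp)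
  next
    case (4 x y z \<alpha> f f' \<beta> g g')
    then show ?case
      using objs by (auto simp: locally_full_sub2cat_def hom_full_subcat intro!: Comp2_mem Q_Comp)
  next
    case (5 x y z f g)
    then show ?case
      by (simp add: locally_full_sub2cat_def full_subcat_simps Comp1_mem Q_Comp Comp2_Id)
  next
    case (6 x y z \<alpha> f f' \<alpha>' f'' \<beta> g g' \<beta>' g'')
    then have *: "x \<in> Cell0 K" "y \<in> Cell0 K" "z \<in> Cell0 K"
      "\<alpha> \<in> hom (HomCat K x y) f f'" "\<alpha>' \<in> hom (HomCat K x y) f' f''"
      "\<beta> \<in> hom (HomCat K y z) g g'" "\<beta>' \<in> hom (HomCat K y z) g' g''"
      and Q: "Q x y f" "Q x y f'" "Q x y f''" "Q y z g" "Q y z g'" "Q y z g''"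
      by (auto simp: locally_full_sub2cat_def hom_full_subcat)
    \<comment> \<open>Composition in a full subcategory is \<open>undefined\<close> off its arrows,
      so both horizontal composites must first be placed in it.\<close>
    have "Comp2 K x y z \<beta> \<alpha> \<in> hom (HomCat K x z) (Comp1 K x y z g f) (Comp1 K x y z g' f')"
      "Comp2 K x y z \<beta>' \<alpha>' \<in> hom (HomCat K x z) (Comp1 K x y z g' f') (Comp1 K x y z g'' f'')"
      using * by (auto intro: Comp2_mem)
    moreover have "Q x z (Comp1 K x y z g f)" "Q x z (Comp1 K x y z g' f')"
      "Q x z (Comp1 K x y z g'' f'')"
      using * Q objs by (auto intro!: Q_Comp)
    ultimately show ?case
      using * Q interchange[OF *]
      by (simp add: locally_full_sub2cat_def hom_iff full_subcat_simps)
  next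
    case (7 x y f)
    then show ?case by (simp add: locally_full_sub2cat_def full_subcat_simps Comp1_Id_right)
  next
    case (8 x y f)
    then show ?case by (simp add: locally_full_sub2cat_def full_subcat_simps Comp1_Id_left)
  next
    case (9 x y \<alpha>)
    then show ?case
      by (simp add: locally_full_sub2cat_def full_subcat_simps Comp2_Id_right Id1_mem Q_Id)
  next
    case (10 x y \<alpha>)
    then show ?case
      by (simp add: locally_full_sub2cat_def full_subcat_simps Comp2_Id_left Id1_mem Q_Id)
  next
    case (11 w x y z f g h)
    then show ?case by (simp add: locally_full_sub2cat_def full_subcat_simps Comp1_assoc)
  next
    case (12 w x y z \<alpha> \<beta> \<gamma>)
    then show ?case by (simp add: locally_full_sub2cat_def full_subcat_simps Comp2_assoc)
  qed
qed

text \<open>The inclusion is the identity on 0-cells, so identity 1-cells witness surjectivity up to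
  internal equivalence. On hom-categories it is the inclusion of a full subcategory, which
  \<open>ess\<close> makes essentially surjective.\<close>

lemma equivalent_2cat_locally_full:
  assumes K: "two_category K" and L: "two_category (locally_full_sub2cat K Q)"
    and ess: "\<And>x y f. \<lbrakk>x \<in> Cell0 K; y \<in> Cell0 K; f \<in> Obj (HomCat K x y)\<rbrakk>
      \<Longrightarrow> \<exists>g \<in> Obj (HomCat K x y). Q x y g \<and> isomorphic (HomCat K x y) g f"
  shows "equivalent_2cat (locally_full_sub2cat K Q) K"
proof -
  interpret K: two_category K by fact
  let ?L = "locally_full_sub2cat K Q"
  interpret L: two_category ?L by fact
  let ?F = "\<lparr> On0 = (\<lambda>x. x), OnHom = (\<lambda>x y. id_ftor (HomCat ?L x y)) \<rparr>"
  have L_simps [simp]: "Cell0 ?L = Cell0 K" "Id1 ?L = Id1 K" "Comp1 ?L = Comp1 K"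
    "Comp2 ?L = Comp2 K" "\<And>x y. HomCat ?L x y = full_subcat (HomCat K x y) {f. Q x y f}"
    by (simp_all add: locally_full_sub2cat_def)
  have equiv: "is_equivalence (HomCat ?L x y) (HomCat K x y) (id_ftor (HomCat ?L x y))"
    if "x \<in> Cell0 K" "y \<in> Cell0 K" for x y
    using that ess[OF that]
    by (auto intro!: category.equivalence_full_subcat K.HomCat_category)
  have "is_2functor ?L K ?F"
    unfolding is_2functor_def
  proof (intro conjI ballI)
    fix x y z assume xyz: "x \<in> Cell0 ?L" "y \<in> Cell0 ?L" "z \<in> Cell0 ?L"
    fix \<alpha> \<beta> assume \<alpha>: "\<alpha> \<in> Arr (HomCat ?L x y)" and \<beta>: "\<beta> \<in> Arr (HomCat ?L y z)"
    \<comment> \<open>The identity functor on a hom-category of \<open>?L\<close> evaluates only at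
      cells of \<open>?L\<close>, so the composite has to be shown to be one.\<close>
    have "Comp2 K x y z \<beta> \<alpha> \<in> Arr (HomCat ?L x z)"
      using L.Comp2_mem[OF xyz, of \<alpha> "Dom (HomCat ?L x y) \<alpha>" "Cod (HomCat ?L x y) \<alpha>"
          \<beta> "Dom (HomCat ?L y z) \<beta>" "Cod (HomCat ?L y z) \<beta>"] \<alpha> \<beta>
      by (auto simp: hom_iff)
    then show "farr (OnHom ?F x z) (Comp2 ?L x y z \<beta> \<alpha>) = Comp2 K (On0 ?F x) (On0 ?F y) (On0 ?F z)
        (farr (OnHom ?F y z) \<beta>) (farr (OnHom ?F x y) \<alpha>)"
      using \<alpha> \<beta> by (simp del: L_simps(5))
  next
    fix x y z f g assume "x \<in> Cell0 ?L" "y \<in> Cell0 ?L" "z \<in> Cell0 ?L"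
      "f \<in> Obj (HomCat ?L x y)" "g \<in> Obj (HomCat ?L y z)"
    then show "fobj (OnHom ?F x z) (Comp1 ?L x y z g f) = Comp1 K (On0 ?F x) (On0 ?F y) (On0 ?F z)
        (fobj (OnHom ?F y z) g) (fobj (OnHom ?F x y) f)"
      using L.Comp1_mem[of x y z f g] by (simp del: L_simps(5))
  next
    fix x assume "x \<in> Cell0 ?L"
    then show "fobj (OnHom ?F x x) (Id1 ?L x) = Id1 K (On0 ?F x)"
      using L.Id1_mem[of x] by (simp del: L_simps(5))
  qed (use K L equiv in \<open>auto simp: is_equivalence_def\<close>)
  moreover have "internally_equivalent K x x" if x: "x \<in> Cell0 K" for x
  proof -
    interpret H: category "HomCat K x x" by (rule K.HomCat_category[OF x x])
    have "isomorphic (HomCat K x x) (Id1 K x) (Id1 K x)"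
      using x K.Id1_mem by (intro isomorphicI[OF H.iso_arr_Id]) auto
    then show ?thesis
      unfolding internally_equivalent_def using x K.Id1_mem K.Comp1_Id_left by metis
  qed
  ultimately have "is_2equivalence ?L K ?F"
    unfolding is_2equivalence_def using equiv by auto
  then show ?thesis unfolding equivalent_2cat_def by blast
qed

section \<open>Isomorphisms of 2-categories from bijections on cells\<close>

definition inv_ftor :: "('o, 'm) cat \<Rightarrow> ('p, 'n) cat \<Rightarrow> ('o, 'm, 'p, 'n) ftor \<Rightarrow> ('p, 'n, 'o, 'm) ftor"
  where "inv_ftor C D F = \<lparr> fobj = (\<lambda>y \<in> Obj D. inv_into (Obj C) (fobj F) y),
    farr = (\<lambda>g \<in> Arr D. inv_into (Arr C) (farr F) g) \<rparr>"

locale iso_ftor = func +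
  assumes bij_fobj: "bij_betw (fobj F) (Obj C) (Obj D)"
    and bij_farr: "bij_betw (farr F) (Arr C) (Arr D)"
begin

lemma fobj_inv [simp]: "x \<in> Obj C \<Longrightarrow> fobj (inv_ftor C D F) (fobj F x) = x"
  and farr_inv [simp]: "f \<in> Arr C \<Longrightarrow> farr (inv_ftor C D F) (farr F f) = f"
  using bij_betw_inv_into_left[OF bij_fobj] bij_betw_inv_into_left[OF bij_farr]
  by (simp_all add: inv_ftor_def)

lemma ObjE: assumes "y \<in> Obj D" obtains x where "x \<in> Obj C" "y = fobj F x"
  using assms bij_fobj by (auto simp: bij_betw_def)

lemma ArrE: assumes "g \<in> Arr D" obtains f where "f \<in> Arr C" "g = farr F f"
  using assms bij_farr by (auto simp: bij_betw_def)

lemma fobj_eq_iff: "\<lbrakk>x \<in> Obj C; y \<in> Obj C\<rbrakk> \<Longrightarrow> fobj F x = fobj F y \<longleftrightarrow> x = y"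
  using bij_fobj by (auto simp: bij_betw_def inj_on_def)

lemma is_functor_inv: "is_functor D C (inv_ftor C D F)"
proof (rule is_functorI)
  fix y assume "y \<in> Obj D"
  then obtain x where x: "x \<in> Obj C" "y = fobj F x" by (rule ObjE)
  then show "fobj (inv_ftor C D F) y \<in> Obj C" by simp
  show "farr (inv_ftor C D F) (Id D y) = Id C (fobj (inv_ftor C D F) y)"
    using x by (simp flip: farr_Id)
next
  fix g assume "g \<in> Arr D"
  then obtain f where f: "f \<in> Arr C" "g = farr F f" by (rule ArrE)
  then show "farr (inv_ftor C D F) g \<in> Arr C \<and>
      Dom C (farr (inv_ftor C D F) g) = fobj (inv_ftor C D F) (Dom D g) \<and>
      Cod C (farr (inv_ftor C D F) g) = fobj (inv_ftor C D F) (Cod D g)" by simp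
  fix g' assume "g' \<in> Arr D" and seq: "Cod D g = Dom D g'"
  then obtain f' where f': "f' \<in> Arr C" "g' = farr F f'" using ArrE by blast
  \<comment> \<open>Injectivity on objects turns \<open>seq\<close> into composability of
    \<open>f\<close> and \<open>f'\<close> in \<open>C\<close>.\<close>
  then show "farr (inv_ftor C D F) (g' \<cdot>\<^bsub>D\<^esub> g)
      = farr (inv_ftor C D F) g' \<cdot>\<^bsub>C\<^esub> farr (inv_ftor C D F) g"
    using f seq by (simp add: fobj_eq_iff flip: farr_Comp)
qed (auto simp: inv_ftor_def S.category_axioms T.category_axioms)

lemma comp_inv_left: "comp_ftor C (inv_ftor C D F) F = id_ftor C"
  by (rule ftor_eqI[OF is_functor_comp[OF is_functor is_functor_inv] S.is_functor_id]) auto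

lemma comp_inv_right: "comp_ftor D F (inv_ftor C D F) = id_ftor D"
  by (rule ftor_eqI[OF is_functor_comp[OF is_functor_inv is_functor] T.is_functor_id])
    (auto elim: ObjE ArrE)

end

text \<open>Every cell of \<open>K\<close> is the image of a cell of \<open>L\<close>, so each law
  for the inverse is obtained by cancelling \<open>U\<close> from the same law for \<open>U\<close>.
  The inverse thus needs no explicit description, and no separate check that it respects
  composition.\<close>

lemma isomorphic_2catI:
  assumes U: "is_2functor L K U"
    and bij0: "bij_betw (On0 U) (Cell0 L) (Cell0 K)"
    and bij1: "\<And>x y. \<lbrakk>x \<in> Cell0 L; y \<in> Cell0 L\<rbrakk> \<Longrightarrow>
      bij_betw (fobj (OnHom U x y)) (Obj (HomCat L x y)) (Obj (HomCat K (On0 U x) (On0 U y)))"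
    and bij2: "\<And>x y. \<lbrakk>x \<in> Cell0 L; y \<in> Cell0 L\<rbrakk> \<Longrightarrow>
      bij_betw (farr (OnHom U x y)) (Arr (HomCat L x y)) (Arr (HomCat K (On0 U x) (On0 U y)))"
  shows "isomorphic_2cat K L"
proof -
  have K: "two_category K" and L: "two_category L" using U by (auto simp: is_2functor_def)
  interpret K: two_category K by fact
  interpret L: two_category L by fact
  define i where "i = inv_into (Cell0 L) (On0 U)"
  have i_mem: "i x \<in> Cell0 L" "On0 U (i x) = x" if "x \<in> Cell0 K" for x
    using that bij0 by (auto simp: i_def bij_betw_def inv_into_into f_inv_into_f)
  have i_U: "i (On0 U x) = x" if "x \<in> Cell0 L" for x
    using that bij0 by (auto simp: i_def bij_betw_def)
  have iso: "iso_ftor (HomCat L x y) (HomCat K (On0 U x) (On0 U y)) (OnHom U x y)"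
    if "x \<in> Cell0 L" "y \<in> Cell0 L" for x y
    using that U bij1 bij2 by unfold_locales (auto simp: is_2functor_def)
  \<comment> \<open>The same functor with its target rewritten by \<open>On0 U (i x) = x\<close>; in
    this form it can be inverted on the hom-category of \<open>K\<close> between \<open>x\<close>
    and \<open>y\<close>.\<close>
  have iso': "iso_ftor (HomCat L (i x) (i y)) (HomCat K x y) (OnHom U (i x) (i y))"
    if "x \<in> Cell0 K" "y \<in> Cell0 K" for x y
    using iso[of "i x" "i y"] that i_mem by simp
  let ?F = "\<lparr> On0 = i, OnHom = (\<lambda>x y. inv_ftor (HomCat L (i x) (i y)) (HomCat K x y)
    (OnHom U (i x) (i y))) \<rparr>"
  have "is_2functor K L ?F"
    unfolding is_2functor_def
  proof (intro conjI ballI)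
    fix x y assume "x \<in> Cell0 K" "y \<in> Cell0 K"
    then show "is_functor (HomCat K x y) (HomCat L (On0 ?F x) (On0 ?F y)) (OnHom ?F x y)"
      using iso_ftor.is_functor_inv[OF iso'] by simp
  next
    fix x assume x: "x \<in> Cell0 K"
    interpret xx: iso_ftor "HomCat L (i x) (i x)" "HomCat K x x" "OnHom U (i x) (i x)"
      by (rule iso'[OF x x])
    have "Id1 K x = fobj (OnHom U (i x) (i x)) (Id1 L (i x))"
      using U i_mem[OF x] by (simp add: is_2functor_def)
    then show "fobj (OnHom ?F x x) (Id1 K x) = Id1 L (On0 ?F x)"
      using i_mem[OF x] by (simp add: L.Id1_mem)
  next
    fix x y z assume xyz: "x \<in> Cell0 K" "y \<in> Cell0 K" "z \<in> Cell0 K"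
    interpret xy: iso_ftor "HomCat L (i x) (i y)" "HomCat K x y" "OnHom U (i x) (i y)"
      by (rule iso'[OF xyz(1,2)])
    interpret yz: iso_ftor "HomCat L (i y) (i z)" "HomCat K y z" "OnHom U (i y) (i z)"
      by (rule iso'[OF xyz(2,3)])
    interpret xz: iso_ftor "HomCat L (i x) (i z)" "HomCat K x z" "OnHom U (i x) (i z)"
      by (rule iso'[OF xyz(1,3)])
    show "fobj (OnHom ?F x z) (Comp1 K x y z g f)
        = Comp1 L (On0 ?F x) (On0 ?F y) (On0 ?F z) (fobj (OnHom ?F y z) g) (fobj (OnHom ?F x y) f)"
      if fg: "f \<in> Obj (HomCat K x y)" "g \<in> Obj (HomCat K y z)" for f g
    proof -
      obtain f' where f': "f' \<in> Obj (HomCat L (i x) (i y))" "f = fobj (OnHom U (i x) (i y)) f'"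
        using fg(1) by (rule xy.ObjE)
      obtain g' where g': "g' \<in> Obj (HomCat L (i y) (i z))" "g = fobj (OnHom U (i y) (i z)) g'"
        using fg(2) by (rule yz.ObjE)
      have "Comp1 K x y z g f = fobj (OnHom U (i x) (i z)) (Comp1 L (i x) (i y) (i z) g' f')"
        using U xyz f' g' i_mem by (simp add: is_2functor_def)
      then show ?thesis
        using f' g' L.Comp1_mem xyz i_mem by simp
    qed
    show "farr (OnHom ?F x z) (Comp2 K x y z \<beta> \<alpha>)
        = Comp2 L (On0 ?F x) (On0 ?F y) (On0 ?F z) (farr (OnHom ?F y z) \<beta>) (farr (OnHom ?F x y) \<alpha>)"
      if ab: "\<alpha> \<in> Arr (HomCat K x y)" "\<beta> \<in> Arr (HomCat K y z)" for \<alpha> \<beta>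
    proof -
      obtain a where a: "a \<in> Arr (HomCat L (i x) (i y))" "\<alpha> = farr (OnHom U (i x) (i y)) a"
        using ab(1) by (rule xy.ArrE)
      obtain b where b: "b \<in> Arr (HomCat L (i y) (i z))" "\<beta> = farr (OnHom U (i y) (i z)) b"
        using ab(2) by (rule yz.ArrE)
      have "Comp2 K x y z \<beta> \<alpha> = farr (OnHom U (i x) (i z)) (Comp2 L (i x) (i y) (i z) b a)"
        using U xyz a b i_mem by (simp add: is_2functor_def)
      moreover have "Comp2 L (i x) (i y) (i z) b a \<in> Arr (HomCat L (i x) (i z))"
        using L.Comp2_mem[of "i x" "i y" "i z" a _ _ b] a b xyz i_mem by (auto simp: hom_iff)
      ultimately show ?thesis using a b by simp
    qed
  qed (use K L i_mem in auto)
  moreover have "retracts_2functor K U ?F" "retracts_2functor L ?F U"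
    using i_mem i_U iso_ftor.comp_inv_left[OF iso] iso_ftor.comp_inv_right[OF iso']
    by (auto simp: retracts_2functor_def)
  ultimately show ?thesis unfolding isomorphic_2cat_def using U by blast
qed

section \<open>2-categories whose 2-cells record their endpoints\<close>

text \<open>Common shape of \<open>dmc_hom\<close> and \<open>cc_hom\<close>: \<open>R\<close> is
  the condition on components, \<open>i\<close> gives the components of identities and
  \<open>v\<close> composes components vertically.\<close>

definition cell_cat :: "'f set \<Rightarrow> ('f \<Rightarrow> 'f \<Rightarrow> 'a \<Rightarrow> bool) \<Rightarrow> ('f \<Rightarrow> 'a) \<Rightarrow> ('a \<Rightarrow> 'a \<Rightarrow> 'a) \<Rightarrow>
    ('f, ('f, 'a) cell) cat"
  where "cell_cat Ob R i v =
    (let A = {Cell M N a | M N a. M \<in> Ob \<and> N \<in> Ob \<and> R M N a} in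
     \<lparr> Obj = Ob,
       Arr = A,
       Dom = restrict csrc A,
       Cod = restrict ctgt A,
       Id = (\<lambda>M \<in> Ob. Cell M M (i M)),
       Comp = (\<lambda>b a. if a \<in> A \<and> b \<in> A \<and> ctgt a = csrc b
         then Cell (csrc a) (ctgt b) (v (ccomp b) (ccomp a)) else undefined) \<rparr>)"

lemma cell_cat_simps:
  "Obj (cell_cat Ob R i v) = Ob"
  "c \<in> Arr (cell_cat Ob R i v) \<longleftrightarrow> csrc c \<in> Ob \<and> ctgt c \<in> Ob \<and> R (csrc c) (ctgt c) (ccomp c)"
  "c \<in> Arr (cell_cat Ob R i v) \<Longrightarrow> Dom (cell_cat Ob R i v) c = csrc c"
  "c \<in> Arr (cell_cat Ob R i v) \<Longrightarrow> Cod (cell_cat Ob R i v) c = ctgt c"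
  "M \<in> Ob \<Longrightarrow> Id (cell_cat Ob R i v) M = Cell M M (i M)"
  "\<lbrakk>c \<in> Arr (cell_cat Ob R i v); d \<in> Arr (cell_cat Ob R i v); ctgt c = csrc d\<rbrakk> \<Longrightarrow>
    d \<cdot>\<^bsub>cell_cat Ob R i v\<^esub> c = Cell (csrc c) (ctgt d) (v (ccomp d) (ccomp c))"
  by (cases c; cases d; auto simp: cell_cat_def Let_def)+

lemma category_cell_cat:
  assumes id: "\<And>M. M \<in> Ob \<Longrightarrow> R M M (i M)"
    and comp: "\<And>M N P a b. \<lbrakk>M \<in> Ob; N \<in> Ob; P \<in> Ob; R M N a; R N P b\<rbrakk> \<Longrightarrow> R M P (v b a)"
    and idr: "\<And>M N a. \<lbrakk>M \<in> Ob; N \<in> Ob; R M N a\<rbrakk> \<Longrightarrow> v a (i M) = a"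
    and idl: "\<And>M N a. \<lbrakk>M \<in> Ob; N \<in> Ob; R M N a\<rbrakk> \<Longrightarrow> v (i N) a = a"
    and assoc: "\<And>M N P Q a b c. \<lbrakk>M \<in> Ob; N \<in> Ob; P \<in> Ob; Q \<in> Ob; R M N a; R N P b; R P Q c\<rbrakk>
      \<Longrightarrow> v (v c b) a = v c (v b a)"
  shows "category (cell_cat Ob R i v)"
  by (rule categoryI)
    (auto simp: cell_cat_simps id comp idr idl assoc intro: comp, auto simp: cell_cat_def Let_def)

text \<open>Reduces the axioms of a 2-category to equations between components, once for display map
  categories and for comprehension categories. The horizontal composite \<open>h\<close> takes the
  source of the outer and the target of the inner 2-cell, as these are the two functors that occur
  in the formula of \<open>hcomp\<close>.\<close>

lemma two_category_cells:
  fixes K :: "('x, 'f, ('f, 'a) cell) twocat"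
  assumes HomCat: "\<And>x y. HomCat K x y = cell_cat (Ob x y) (R x y) (i x y) (v x y)"
    and Comp2: "\<And>x y z b a. Comp2 K x y z b a = Cell (Comp1 K x y z (csrc b) (csrc a))
      (Comp1 K x y z (ctgt b) (ctgt a)) (h x y z (csrc b) (ctgt a) (ccomp b) (ccomp a))"
    and id: "\<And>x y M. \<lbrakk>x \<in> Cell0 K; y \<in> Cell0 K; M \<in> Ob x y\<rbrakk> \<Longrightarrow> R x y M M (i x y M)"
    and vcomp: "\<And>x y M N P a b. \<lbrakk>x \<in> Cell0 K; y \<in> Cell0 K; M \<in> Ob x y; N \<in> Ob x y; P \<in> Ob x y;
      R x y M N a; R x y N P b\<rbrakk> \<Longrightarrow> R x y M P (v x y b a)"
    and idr: "\<And>x y M N a. \<lbrakk>x \<in> Cell0 K; y \<in> Cell0 K; M \<in> Ob x y; N \<in> Ob x y; R x y M N a\<rbrakk>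
      \<Longrightarrow> v x y a (i x y M) = a"
    and idl: "\<And>x y M N a. \<lbrakk>x \<in> Cell0 K; y \<in> Cell0 K; M \<in> Ob x y; N \<in> Ob x y; R x y M N a\<rbrakk>
      \<Longrightarrow> v x y (i x y N) a = a"
    and assoc: "\<And>x y M N P Q a b c. \<lbrakk>x \<in> Cell0 K; y \<in> Cell0 K; M \<in> Ob x y; N \<in> Ob x y;
      P \<in> Ob x y; Q \<in> Ob x y; R x y M N a; R x y N P b; R x y P Q c\<rbrakk>
      \<Longrightarrow> v x y (v x y c b) a = v x y c (v x y b a)"
    and Id1: "\<And>x. x \<in> Cell0 K \<Longrightarrow> Id1 K x \<in> Ob x x"
    and Comp1: "\<And>x y z M N. \<lbrakk>x \<in> Cell0 K; y \<in> Cell0 K; z \<in> Cell0 K; M \<in> Ob x y; N \<in> Ob y z\<rbrakk>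
      \<Longrightarrow> Comp1 K x y z N M \<in> Ob x z"
    and Comp1_Id_right: "\<And>x y M. \<lbrakk>x \<in> Cell0 K; y \<in> Cell0 K; M \<in> Ob x y\<rbrakk>
      \<Longrightarrow> Comp1 K x x y M (Id1 K x) = M"
    and Comp1_Id_left: "\<And>x y M. \<lbrakk>x \<in> Cell0 K; y \<in> Cell0 K; M \<in> Ob x y\<rbrakk>
      \<Longrightarrow> Comp1 K x y y (Id1 K y) M = M"
    and Comp1_assoc: "\<And>w x y z L M N. \<lbrakk>w \<in> Cell0 K; x \<in> Cell0 K; y \<in> Cell0 K; z \<in> Cell0 K;
      L \<in> Ob w x; M \<in> Ob x y; N \<in> Ob y z\<rbrakk>
      \<Longrightarrow> Comp1 K w x z (Comp1 K x y z N M) L = Comp1 K w y z N (Comp1 K w x y M L)"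
    and hcomp: "\<And>x y z M M' N N' a b. \<lbrakk>x \<in> Cell0 K; y \<in> Cell0 K; z \<in> Cell0 K; M \<in> Ob x y;
      M' \<in> Ob x y; N \<in> Ob y z; N' \<in> Ob y z; R x y M M' a; R y z N N' b\<rbrakk>
      \<Longrightarrow> R x z (Comp1 K x y z N M) (Comp1 K x y z N' M') (h x y z N M' b a)"
    and hid: "\<And>x y z M N. \<lbrakk>x \<in> Cell0 K; y \<in> Cell0 K; z \<in> Cell0 K; M \<in> Ob x y; N \<in> Ob y z\<rbrakk>
      \<Longrightarrow> h x y z N M (i y z N) (i x y M) = i x z (Comp1 K x y z N M)"
    and interchange: "\<And>x y z M M' M'' N N' N'' a a' b b'. \<lbrakk>x \<in> Cell0 K; y \<in> Cell0 K; z \<in> Cell0 K;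
      M \<in> Ob x y; M' \<in> Ob x y; M'' \<in> Ob x y; N \<in> Ob y z; N' \<in> Ob y z; N'' \<in> Ob y z;
      R x y M M' a; R x y M' M'' a'; R y z N N' b; R y z N' N'' b'\<rbrakk>
      \<Longrightarrow> h x y z N M'' (v y z b' b) (v x y a' a)
        = v x z (h x y z N' M'' b' a') (h x y z N M' b a)"
    and hidr: "\<And>x y M N a. \<lbrakk>x \<in> Cell0 K; y \<in> Cell0 K; M \<in> Ob x y; N \<in> Ob x y; R x y M N a\<rbrakk>
      \<Longrightarrow> h x x y M (Id1 K x) a (i x x (Id1 K x)) = a"
    and hidl: "\<And>x y M N a. \<lbrakk>x \<in> Cell0 K; y \<in> Cell0 K; M \<in> Ob x y; N \<in> Ob x y; R x y M N a\<rbrakk>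
      \<Longrightarrow> h x y y (Id1 K y) N (i y y (Id1 K y)) a = a"
    and hassoc: "\<And>w x y z L L' M M' N N' a b c. \<lbrakk>w \<in> Cell0 K; x \<in> Cell0 K; y \<in> Cell0 K;
      z \<in> Cell0 K; L \<in> Ob w x; L' \<in> Ob w x; M \<in> Ob x y; M' \<in> Ob x y; N \<in> Ob y z; N' \<in> Ob y z;
      R w x L L' a; R x y M M' b; R y z N N' c\<rbrakk>
      \<Longrightarrow> h w x z (Comp1 K x y z N M) L' (h x y z N M' c b) a
        = h w y z N (Comp1 K w x y M' L') c (h w x y M L' b a)"
  shows "two_category K"
proof (rule two_category.intro, goal_cases)
  case (1 x y)
  show ?case unfolding HomCat
    by (rule category_cell_cat) (fact id[OF 1] vcomp[OF 1] idr[OF 1] idl[OF 1] assoc[OF 1])+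
next
  case (2 x)
  then show ?case by (simp add: HomCat cell_cat_simps Id1)
next
  case (3 x y z f g)
  then show ?case by (simp add: HomCat cell_cat_simps Comp1)
next
  case (4 x y z \<alpha> f f' \<beta> g g')
  then show ?case by (auto simp: HomCat hom_iff cell_cat_simps Comp1 Comp2 hcomp)
next
  case (5 x y z f g)
  then show ?case by (simp add: HomCat cell_cat_simps Comp1 Comp2 hid)
next
  case (6 x y z \<alpha> f f' \<alpha>' f'' \<beta> g g' \<beta>' g'')
  then show ?case
    using interchange[OF 6(1-3), of f f' f'' g g' g'' "ccomp \<alpha>" "ccomp \<alpha>'" "ccomp \<beta>" "ccomp \<beta>'"]
    by (auto simp: HomCat hom_iff cell_cat_simps Comp1 Comp2 hcomp)
next
  case (7 x y f)
  then show ?case by (simp add: HomCat cell_cat_simps Comp1_Id_right)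
next
  case (8 x y f)
  then show ?case by (simp add: HomCat cell_cat_simps Comp1_Id_left)
next
  case (9 x y \<alpha>)
  then show ?case
    by (cases \<alpha>) (auto simp: HomCat cell_cat_simps Comp2 Id1 Comp1_Id_right hidr)
next
  case (10 x y \<alpha>)
  then show ?case
    by (cases \<alpha>) (auto simp: HomCat cell_cat_simps Comp2 Id1 Comp1_Id_left hidl)
next
  case (11 w x y z f g h)
  then show ?case by (simp add: HomCat cell_cat_simps Comp1_assoc)
next
  case (12 w x y z \<alpha> \<beta> \<gamma>)
  then show ?case by (auto simp: HomCat cell_cat_simps Comp2 Comp1_assoc hassoc)
qed

section \<open>Display map categories\<close>

lemma dmc_hom_cells:
  "dmc_hom X Y = cell_cat {F. dmc_map X Y F} (nat_trans (Ucat X) (Ucat Y))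
    (id_nat (Ucat X) (Ucat Y)) (vcomp (Ucat X) (Ucat Y))"
  by (simp add: dmc_hom_def cell_cat_def Let_def)

lemma pullback_square_squares: "pullback_square C s \<Longrightarrow> s \<in> squares C"
  by (simp add: pullback_square_def)

lemma squares_arrs:
  assumes "s \<in> squares C"
  shows "ssrc s \<in> Arr C" "stgt s \<in> Arr C" "stop s \<in> Arr C" "sbot s \<in> Arr C"
    "Dom C (stop s) = Dom C (ssrc s)" "Cod C (stop s) = Dom C (stgt s)"
    "Dom C (sbot s) = Cod C (ssrc s)" "Cod C (sbot s) = Cod C (stgt s)"
    "stgt s \<cdot>\<^bsub>C\<^esub> stop s = sbot s \<cdot>\<^bsub>C\<^esub> ssrc s"
  using assms by (auto simp: squares_def hom_iff)

lemma map_sq_comp_ftor: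
  "s \<in> squares C \<Longrightarrow> map_sq (farr (comp_ftor C G F)) s = map_sq (farr G) (map_sq (farr F) s)"
  by (auto simp: squares_arrs sq.map_sel intro!: sq.expand)

lemma map_sq_id_ftor: "s \<in> squares C \<Longrightarrow> map_sq (farr (id_ftor C)) s = s"
  by (auto simp: squares_arrs sq.map_sel intro!: sq.expand)

lemma dmc_map_is_functor: "dmc_map X Y F \<Longrightarrow> is_functor (Ucat X) (Ucat Y) F"
  by (simp add: dmc_map_def)

lemma dmc_map_id: "rooted_dmc X \<Longrightarrow> dmc_map X X (id_ftor (Ucat X))"
  by (auto simp: dmc_map_def rooted_dmc_def display_map_category_def category.is_functor_id
      map_sq_id_ftor pullback_square_squares terminal_def)

lemma dmc_map_comp:
  assumes "rooted_dmc X" "dmc_map X Y F" "dmc_map Y Z G"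
  shows "dmc_map X Z (comp_ftor (Ucat X) G F)"
proof -
  have "Disp X \<subseteq> Arr (Ucat X)" using assms(1) by (auto simp: rooted_dmc_def display_map_category_def)
  moreover have "terminal (Ucat X) t \<Longrightarrow> t \<in> Obj (Ucat X)" for t by (simp add: terminal_def)
  ultimately show ?thesis
    using assms(2,3)
    by (auto simp: dmc_map_def is_functor_comp map_sq_comp_ftor pullback_square_squares sq.map_sel)
qed

lemma two_category_DMC_rtd: "two_category DMC_rtd"
proof (rule two_category_cells[where Ob = "\<lambda>X Y. {F. dmc_map X Y F}"
      and R = "\<lambda>X Y. nat_trans (Ucat X) (Ucat Y)" and i = "\<lambda>X Y. id_nat (Ucat X) (Ucat Y)"
      and v = "\<lambda>X Y. vcomp (Ucat X) (Ucat Y)" and h = "\<lambda>X Y Z. hcomp (Ucat X) (Ucat Z)"])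
qed (auto simp: DMC_rtd_def dmc_hom_cells dmc_map_id dmc_map_comp
    intro: dmc_map_is_functor nat_trans_id nat_trans_vcomp vcomp_id_right vcomp_id_left vcomp_assoc
      comp_ftor_id_right comp_ftor_id_left comp_ftor_assoc nat_trans_hcomp hcomp_id hcomp_vcomp
      hcomp_id_right hcomp_id_left hcomp_assoc)

section \<open>Arrow categories\<close>

lemma arrow_cat_simps:
  "Obj (arrow_cat C) = Arr C"
  "Arr (arrow_cat C) = squares C"
  "s \<in> squares C \<Longrightarrow> Dom (arrow_cat C) s = ssrc s"
  "s \<in> squares C \<Longrightarrow> Cod (arrow_cat C) s = stgt s"
  "a \<in> Arr C \<Longrightarrow> Id (arrow_cat C) a = Sq a a (Id C (Dom C a)) (Id C (Cod C a))"
  "\<lbrakk>s \<in> squares C; t \<in> squares C; stgt s = ssrc t\<rbrakk>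
    \<Longrightarrow> t \<cdot>\<^bsub>arrow_cat C\<^esub> s = Sq (ssrc s) (stgt t) (stop t \<cdot>\<^bsub>C\<^esub> stop s) (sbot t \<cdot>\<^bsub>C\<^esub> sbot s)"
  by (simp_all add: arrow_cat_def)

lemma squaresI:
  "\<lbrakk>ssrc s \<in> Arr C; stgt s \<in> Arr C; stop s \<in> Arr C; sbot s \<in> Arr C;
    Dom C (stop s) = Dom C (ssrc s); Cod C (stop s) = Dom C (stgt s);
    Dom C (sbot s) = Cod C (ssrc s); Cod C (sbot s) = Cod C (stgt s);
    stgt s \<cdot>\<^bsub>C\<^esub> stop s = sbot s \<cdot>\<^bsub>C\<^esub> ssrc s\<rbrakk> \<Longrightarrow> s \<in> squares C"
  by (auto simp: squares_def hom_iff)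

context category begin

lemma Id_square: "a \<in> Arr C \<Longrightarrow> Sq a a (Id C (Dom C a)) (Id C (Cod C a)) \<in> squares C"
  by (auto intro!: squaresI)

lemma paste_squares:
  assumes s: "s \<in> squares C" and t: "t \<in> squares C" and st: "stgt s = ssrc t"
  shows "Sq (ssrc s) (stgt t) (stop t \<cdot>\<^bsub>C\<^esub> stop s) (sbot t \<cdot>\<^bsub>C\<^esub> sbot s) \<in> squares C"
proof (rule squaresI)
  note [simp] = squares_arrs(1-8)[OF s] squares_arrs(1-8)[OF t]
  have "stgt t \<cdot>\<^bsub>C\<^esub> (stop t \<cdot>\<^bsub>C\<^esub> stop s) = (stgt t \<cdot>\<^bsub>C\<^esub> stop t) \<cdot>\<^bsub>C\<^esub> stop s"
    using st by simp
  also have "\<dots> = sbot t \<cdot>\<^bsub>C\<^esub> (stgt s \<cdot>\<^bsub>C\<^esub> stop s)"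
    using st by (simp add: squares_arrs(9)[OF t])
  also have "\<dots> = (sbot t \<cdot>\<^bsub>C\<^esub> sbot s) \<cdot>\<^bsub>C\<^esub> ssrc s"
    using st by (simp add: squares_arrs(9)[OF s, unfolded st])
  finally show "stgt (Sq (ssrc s) (stgt t) (stop t \<cdot>\<^bsub>C\<^esub> stop s) (sbot t \<cdot>\<^bsub>C\<^esub> sbot s)) \<cdot>\<^bsub>C\<^esub>
      stop (Sq (ssrc s) (stgt t) (stop t \<cdot>\<^bsub>C\<^esub> stop s) (sbot t \<cdot>\<^bsub>C\<^esub> sbot s)) =
      sbot (Sq (ssrc s) (stgt t) (stop t \<cdot>\<^bsub>C\<^esub> stop s) (sbot t \<cdot>\<^bsub>C\<^esub> sbot s)) \<cdot>\<^bsub>C\<^esub>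
      ssrc (Sq (ssrc s) (stgt t) (stop t \<cdot>\<^bsub>C\<^esub> stop s) (sbot t \<cdot>\<^bsub>C\<^esub> sbot s))" by simp
qed (use squares_arrs[OF s] squares_arrs[OF t] st in simp_all)

lemma category_arrow_cat: "category (arrow_cat C)"
proof (rule categoryI)
  fix f g assume "\<not> (f \<in> Arr (arrow_cat C) \<and> g \<in> Arr (arrow_cat C)
    \<and> Cod (arrow_cat C) f = Dom (arrow_cat C) g)"
  then show "g \<cdot>\<^bsub>arrow_cat C\<^esub> f = undefined" by (auto simp: arrow_cat_def)
next
  fix f g assume "f \<in> Arr (arrow_cat C)" "g \<in> Arr (arrow_cat C)"
    "Cod (arrow_cat C) f = Dom (arrow_cat C) g"
  then show "g \<cdot>\<^bsub>arrow_cat C\<^esub> f \<in> Arr (arrow_cat C) \<and>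
      Dom (arrow_cat C) (g \<cdot>\<^bsub>arrow_cat C\<^esub> f) = Dom (arrow_cat C) f \<and>
      Cod (arrow_cat C) (g \<cdot>\<^bsub>arrow_cat C\<^esub> f) = Cod (arrow_cat C) g"
    by (simp add: arrow_cat_simps paste_squares)
next
  fix f g h assume "f \<in> Arr (arrow_cat C)" "g \<in> Arr (arrow_cat C)" "h \<in> Arr (arrow_cat C)"
    "Cod (arrow_cat C) f = Dom (arrow_cat C) g" "Cod (arrow_cat C) g = Dom (arrow_cat C) h"
  then show "(h \<cdot>\<^bsub>arrow_cat C\<^esub> g) \<cdot>\<^bsub>arrow_cat C\<^esub> f = h \<cdot>\<^bsub>arrow_cat C\<^esub> (g \<cdot>\<^bsub>arrow_cat C\<^esub> f)"
    using paste_squares[of f g] paste_squares[of g h]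
    by (simp add: arrow_cat_simps squares_arrs(1-8))
next
  fix f assume "f \<in> Arr (arrow_cat C)"
  then show "f \<cdot>\<^bsub>arrow_cat C\<^esub> Id (arrow_cat C) (Dom (arrow_cat C) f) = f"
    "Id (arrow_cat C) (Cod (arrow_cat C) f) \<cdot>\<^bsub>arrow_cat C\<^esub> f = f"
    by (auto simp: arrow_cat_simps Id_square squares_arrs(1-8) intro!: sq.expand)
qed (auto simp: arrow_cat_simps Id_square squares_arrs(1-8), auto simp: arrow_cat_def)

lemma is_functor_cod: "is_functor (arrow_cat C) C (cod_ftor C)"
  by (rule is_functorI)
    (auto simp: category_arrow_cat category_axioms cod_ftor_def arrow_cat_simps squares_arrs(1-8)
      Id_square paste_squares)

end

lemma fobj_cod_ftor [simp]: "a \<in> Arr C \<Longrightarrow> fobj (cod_ftor C) a = Cod C a"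
  and farr_cod_ftor [simp]: "s \<in> squares C \<Longrightarrow> farr (cod_ftor C) s = sbot s"
  by (simp_all add: cod_ftor_def)

lemma fobj_arrow_ftor [simp]: "a \<in> Arr C \<Longrightarrow> fobj (arrow_ftor C F) a = farr F a"
  and farr_arrow_ftor [simp]: "s \<in> squares C \<Longrightarrow> farr (arrow_ftor C F) s = map_sq (farr F) s"
  by (simp_all add: arrow_ftor_def)

lemma (in func) map_sq_squares [simp]: "s \<in> squares C \<Longrightarrow> map_sq (farr F) s \<in> squares D"
  using farr_Comp[of "stop s" "stgt s"] farr_Comp[of "ssrc s" "sbot s"] squares_arrs[of s C]
  by (intro squaresI) (auto simp: sq.map_sel)

lemma (in func) is_functor_arrow: "is_functor (arrow_cat C) (arrow_cat D) (arrow_ftor C F)"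
  by (rule is_functorI)
    (auto simp: S.category_arrow_cat T.category_arrow_cat arrow_cat_simps arrow_ftor_def sq.map_sel
      S.Id_square S.paste_squares squares_arrs(1-8))

lemma iso_arr_arrow_cat:
  assumes s: "iso_arr (arrow_cat C) s"
  shows "iso_arr C (stop s)" "iso_arr C (sbot s)"
proof -
  obtain t where t: "s \<in> squares C" "t \<in> squares C" "ssrc t = stgt s" "stgt t = ssrc s"
    "t \<cdot>\<^bsub>arrow_cat C\<^esub> s = Id (arrow_cat C) (ssrc s)" "s \<cdot>\<^bsub>arrow_cat C\<^esub> t = Id (arrow_cat C) (stgt s)"
    using s by (rule iso_arrE) (auto simp: arrow_cat_simps)
  then have "stop t \<cdot>\<^bsub>C\<^esub> stop s = Id C (Dom C (ssrc s))" "stop s \<cdot>\<^bsub>C\<^esub> stop t = Id C (Dom C (stgt s))"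
    "sbot t \<cdot>\<^bsub>C\<^esub> sbot s = Id C (Cod C (ssrc s))" "sbot s \<cdot>\<^bsub>C\<^esub> sbot t = Id C (Cod C (stgt s))"
    by (auto simp: arrow_cat_simps squares_arrs)
  then show "iso_arr C (stop s)" "iso_arr C (sbot s)"
    using t by (auto simp: squares_arrs intro: iso_arrI[where g = "stop t"] iso_arrI[where g = "sbot t"])
qed

text \<open>The inverses of the two edges again form a commutative square: in the commutation of
  \<open>s\<close>, cancel \<open>sbot s\<close> on the left and \<open>stop s\<close> on the
  right.\<close>

lemma (in category) iso_arr_arrow_catI:
  assumes s: "s \<in> squares C" and i: "iso_arr C (stop s)" "iso_arr C (sbot s)"
  shows "iso_arr (arrow_cat C) s"
proof -
  obtain t where t: "t \<in> Arr C" "Dom C t = Cod C (stop s)" "Cod C t = Dom C (stop s)"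
    "t \<cdot>\<^bsub>C\<^esub> stop s = Id C (Dom C (stop s))" "stop s \<cdot>\<^bsub>C\<^esub> t = Id C (Cod C (stop s))"
    using i(1) by (rule iso_arrE)
  obtain b where b: "b \<in> Arr C" "Dom C b = Cod C (sbot s)" "Cod C b = Dom C (sbot s)"
    "b \<cdot>\<^bsub>C\<^esub> sbot s = Id C (Dom C (sbot s))" "sbot s \<cdot>\<^bsub>C\<^esub> b = Id C (Cod C (sbot s))"
    using i(2) by (rule iso_arrE)
  note [simp] = squares_arrs(1-8)[OF s]
  have "ssrc s \<cdot>\<^bsub>C\<^esub> t = (b \<cdot>\<^bsub>C\<^esub> sbot s) \<cdot>\<^bsub>C\<^esub> (ssrc s \<cdot>\<^bsub>C\<^esub> t)"
    using t b by (simp del: Comp_assoc')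
  also have "\<dots> = b \<cdot>\<^bsub>C\<^esub> ((sbot s \<cdot>\<^bsub>C\<^esub> ssrc s) \<cdot>\<^bsub>C\<^esub> t)"
    using t b(1-3) by simp
  also have "\<dots> = b \<cdot>\<^bsub>C\<^esub> stgt s"
    using t b by (simp flip: squares_arrs(9)[OF s])
  finally have sq: "Sq (stgt s) (ssrc s) t b \<in> squares C"
    using t b by (intro squaresI) auto
  show ?thesis
    by (rule iso_arrI[where g = "Sq (stgt s) (ssrc s) t b"])
      (use t b sq s in \<open>simp_all add: arrow_cat_simps\<close>)
qed

section \<open>Comprehension categories\<close>

locale ccat =
  fixes X :: "('o, 'm, 't, 'n, 'z) compcat_scheme"
  assumes compr: "comprehension_category X"

sublocale ccat \<subseteq> Proj: func "Tot X" "Base X" "Proj X"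
  using compr by unfold_locales (simp add: comprehension_category_def fibration_def)
sublocale ccat \<subseteq> Chi: func "Tot X" "arrow_cat (Base X)" "Chi X"
  using compr by unfold_locales (simp add: comprehension_category_def)

context ccat begin

lemma fobj_Chi_Arr [simp]: "A \<in> Obj (Tot X) \<Longrightarrow> fobj (Chi X) A \<in> Arr (Base X)"
  and farr_Chi_square [simp]: "u \<in> Arr (Tot X) \<Longrightarrow> farr (Chi X) u \<in> squares (Base X)"
  using Chi.fobj_Obj[of A] Chi.farr_Arr[of u] by (simp_all add: arrow_cat_simps)

lemma ssrc_Chi [simp]: "u \<in> Arr (Tot X) \<Longrightarrow> ssrc (farr (Chi X) u) = fobj (Chi X) (Dom (Tot X) u)"
  and stgt_Chi [simp]: "u \<in> Arr (Tot X) \<Longrightarrow> stgt (farr (Chi X) u) = fobj (Chi X) (Cod (Tot X) u)"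
  using Chi.Dom_farr[of u] Chi.Cod_farr[of u] by (simp_all add: arrow_cat_simps)

lemma Proj_eq: "comp_ftor (Tot X) (cod_ftor (Base X)) (Chi X) = Proj X"
  using compr by (simp add: comprehension_category_def)

lemma Cod_Chi [simp]: "A \<in> Obj (Tot X) \<Longrightarrow> Cod (Base X) (fobj (Chi X) A) = fobj (Proj X) A"
  using arg_cong[OF Proj_eq, of "\<lambda>F. fobj F A"] by simp

lemma sbot_Chi [simp]: "u \<in> Arr (Tot X) \<Longrightarrow> sbot (farr (Chi X) u) = farr (Proj X) u"
  using arg_cong[OF Proj_eq, of "\<lambda>F. farr F u"] by simp

lemma Dom_Chi [simp]: "Dom (Base X) (fobj (Chi X) A) = ctx_ext X A"
  by (simp add: ctx_ext_def)

lemma ctx_ext_Obj [simp]: "A \<in> Obj (Tot X) \<Longrightarrow> ctx_ext X A \<in> Obj (Base X)"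
  by (simp flip: Dom_Chi)

lemma stop_Chi [simp]:
  assumes "u \<in> Arr (Tot X)"
  shows "stop (farr (Chi X) u) \<in> Arr (Base X)"
    "Dom (Base X) (stop (farr (Chi X) u)) = ctx_ext X (Dom (Tot X) u)"
    "Cod (Base X) (stop (farr (Chi X) u)) = ctx_ext X (Cod (Tot X) u)"
  using squares_arrs[OF farr_Chi_square[OF assms]] assms by simp_all

end

section \<open>Pseudo maps and the identity map\<close>

locale pmap =
  fixes X Y :: "('o, 'm, 't, 'n, 'z) compcat_scheme" and M :: "('o, 'm, 't, 'n, 'w) ccmap_scheme"
  assumes X_compr: "comprehension_category X"
    and Y_compr: "comprehension_category Y"
    and pseudo_map: "pseudo_map X Y M"

sublocale pmap \<subseteq> X: ccat X by unfold_locales (rule X_compr)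
sublocale pmap \<subseteq> Y: ccat Y by unfold_locales (rule Y_compr)
sublocale pmap \<subseteq> B: func "Base X" "Base Y" "BaseF M"
  using pseudo_map by unfold_locales (simp add: pseudo_map_def)
sublocale pmap \<subseteq> T: func "Tot X" "Tot Y" "TotF M"
  using pseudo_map by unfold_locales (simp add: pseudo_map_def)
sublocale pmap \<subseteq> P: ntrans "Tot X" "arrow_cat (Base Y)"
  "comp_ftor (Tot X) (Chi Y) (TotF M)"
  "comp_ftor (Tot X) (arrow_ftor (Base X) (BaseF M)) (Chi X)" "Phi M"
  using pseudo_map by unfold_locales (simp add: pseudo_map_def nat_iso_def)

context pmap begin

lemma Proj_TotF:
  "comp_ftor (Tot X) (Proj Y) (TotF M) = comp_ftor (Tot X) (BaseF M) (Proj X)"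
  using pseudo_map by (simp add: pseudo_map_def)

lemma fobj_Proj_TotF [simp]:
  "A \<in> Obj (Tot X) \<Longrightarrow> fobj (Proj Y) (fobj (TotF M) A) = fobj (BaseF M) (fobj (Proj X) A)"
  using arg_cong[OF Proj_TotF, of "\<lambda>F. fobj F A"] by simp

lemma farr_Proj_TotF [simp]:
  "u \<in> Arr (Tot X) \<Longrightarrow> farr (Proj Y) (farr (TotF M) u) = farr (BaseF M) (farr (Proj X) u)"
  using arg_cong[OF Proj_TotF, of "\<lambda>F. farr F u"] by simp

lemma cartesian_TotF: "cartesian (Tot X) (Base X) (Proj X) u
    \<Longrightarrow> cartesian (Tot Y) (Base Y) (Proj Y) (farr (TotF M) u)"
  using pseudo_map by (simp add: pseudo_map_def)

lemma Phi_square [simp]: "A \<in> Obj (Tot X) \<Longrightarrow> Phi M A \<in> squares (Base Y)"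
  using P.Arr[of A] by (simp add: arrow_cat_simps)

lemma ssrc_Phi [simp]: "A \<in> Obj (Tot X) \<Longrightarrow> ssrc (Phi M A) = fobj (Chi Y) (fobj (TotF M) A)"
  and stgt_Phi [simp]: "A \<in> Obj (Tot X) \<Longrightarrow> stgt (Phi M A) = farr (BaseF M) (fobj (Chi X) A)"
  using P.Dom[of A] P.Cod[of A] by (simp_all add: arrow_cat_simps)

lemma sbot_Phi [simp]:
  "A \<in> Obj (Tot X) \<Longrightarrow> sbot (Phi M A) = Id (Base Y) (fobj (BaseF M) (fobj (Proj X) A))"
  using pseudo_map by (simp add: pseudo_map_def)

lemma iso_arr_Phi: "A \<in> Obj (Tot X) \<Longrightarrow> iso_arr (arrow_cat (Base Y)) (Phi M A)"
  using pseudo_map by (simp add: pseudo_map_def nat_iso_def)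

lemma iso_arr_stop_Phi: "A \<in> Obj (Tot X) \<Longrightarrow> iso_arr (Base Y) (stop (Phi M A))"
  by (rule iso_arr_arrow_cat[OF iso_arr_Phi])

lemma stop_Phi [simp]:
  assumes "A \<in> Obj (Tot X)"
  shows "stop (Phi M A) \<in> Arr (Base Y)"
    "Dom (Base Y) (stop (Phi M A)) = ctx_ext Y (fobj (TotF M) A)"
    "Cod (Base Y) (stop (Phi M A)) = fobj (BaseF M) (ctx_ext X A)"
  using squares_arrs[OF Phi_square[OF assms]] assms by simp_all

text \<open>The bottom edges of \<open>Phi M\<close> are identities, so the content of its
  naturality lies in the top edges.\<close>

lemma stop_Phi_naturality:
  assumes "u \<in> Arr (Tot X)" "Cod (Tot X) u = A"
  shows "stop (Phi M A) \<cdot>\<^bsub>Base Y\<^esub> stop (farr (Chi Y) (farr (TotF M) u))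
    = farr (BaseF M) (stop (farr (Chi X) u)) \<cdot>\<^bsub>Base Y\<^esub> stop (Phi M (Dom (Tot X) u))"
  using arg_cong[OF P.naturality[OF assms], of stop] assms
  by (auto simp: arrow_cat_simps sq.map_sel)

end

lemma pseudo_mapI:
  assumes "comprehension_category X" "comprehension_category Y"
    and "is_functor (Base X) (Base Y) (BaseF M)" "is_functor (Tot X) (Tot Y) (TotF M)"
    and "\<And>A. A \<in> Obj (Tot X) \<Longrightarrow> fobj (Proj Y) (fobj (TotF M) A) = fobj (BaseF M) (fobj (Proj X) A)"
    and "\<And>u. u \<in> Arr (Tot X) \<Longrightarrow> farr (Proj Y) (farr (TotF M) u) = farr (BaseF M) (farr (Proj X) u)"
    and "\<And>u. cartesian (Tot X) (Base X) (Proj X) u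
      \<Longrightarrow> cartesian (Tot Y) (Base Y) (Proj Y) (farr (TotF M) u)"
    and "nat_trans (Tot X) (arrow_cat (Base Y)) (comp_ftor (Tot X) (Chi Y) (TotF M))
      (comp_ftor (Tot X) (arrow_ftor (Base X) (BaseF M)) (Chi X)) (Phi M)"
    and "\<And>A. A \<in> Obj (Tot X) \<Longrightarrow> iso_arr (arrow_cat (Base Y)) (Phi M A)"
    and "\<And>A. A \<in> Obj (Tot X) \<Longrightarrow> sbot (Phi M A) = Id (Base Y) (fobj (BaseF M) (fobj (Proj X) A))"
  shows "pseudo_map X Y M"
proof -
  interpret X: ccat X by unfold_locales fact
  interpret Y: ccat Y by unfold_locales fact
  have "comp_ftor (Tot X) (Proj Y) (TotF M) = comp_ftor (Tot X) (BaseF M) (Proj X)"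
    by (rule ftor_eqI[OF is_functor_comp[OF assms(4) Y.Proj.is_functor]
      is_functor_comp[OF X.Proj.is_functor assms(3)]]) (use assms in auto)
  then show ?thesis using assms by (simp add: pseudo_map_def nat_iso_def)
qed

lemma pseudo_map_id:
  assumes "comprehension_category X" shows "pseudo_map X X (id_rccmap X)"
proof -
  interpret X: ccat X by unfold_locales fact
  have "comp_ftor (Tot X) (arrow_ftor (Base X) (id_ftor (Base X))) (Chi X) = Chi X"
  proof (rule ftor_eqI[OF is_functor_comp[OF X.Chi.is_functor] X.Chi.is_functor])
    show "is_functor (arrow_cat (Base X)) (arrow_cat (Base X)) (arrow_ftor (Base X) (id_ftor (Base X)))"
      by (rule func.is_functor_arrow, unfold_locales, rule X.Proj.T.is_functor_id)
  qed (simp_all add: map_sq_id_ftor)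
  moreover have "iso_arr (arrow_cat (Base X)) (Id (arrow_cat (Base X)) (fobj (Chi X) A))"
    if "A \<in> Obj (Tot X)" for A
    using that by (intro X.Chi.T.iso_arr_Id) (simp add: arrow_cat_simps)
  ultimately show ?thesis
    using nat_trans_id[OF X.Chi.is_functor] assms
    by (intro pseudo_mapI)
      (auto simp: id_rccmap_def X.Proj.T.is_functor_id X.Proj.S.is_functor_id arrow_cat_simps
        comp_ftor_id_right[OF X.Chi.is_functor] cartesian_def)
qed

lemma rooted_map_id: "rooted_compcat X \<Longrightarrow> rooted_map X X (id_rccmap X)"
proof -
  assume X: "rooted_compcat X"
  interpret X: ccat X using X by unfold_locales (simp add: rooted_compcat_def)
  show ?thesis
    using X pseudo_map_id[OF X.compr] unfolding rooted_map_def
    by (auto simp: rooted_compcat_def terminal_def id_rccmap_def hom_iff X.Proj.T.iso_arr_Id)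
qed

section \<open>Composition of pseudo maps and of rooted maps\<close>

locale pmap_pair = M: pmap X Y M + N: pmap Y Z N
  for X Y Z :: "('o, 'm, 't, 'n) rcompcat" and M N :: "('o, 'm, 't, 'n) rccmap"
begin

lemma fobj_BaseF_comp [simp]: "x \<in> Obj (Base X) \<Longrightarrow>
    fobj (BaseF (comp_rccmap X Y Z N M)) x = fobj (BaseF N) (fobj (BaseF M) x)"
  and farr_BaseF_comp [simp]: "f \<in> Arr (Base X) \<Longrightarrow>
    farr (BaseF (comp_rccmap X Y Z N M)) f = farr (BaseF N) (farr (BaseF M) f)"
  and fobj_TotF_comp [simp]: "A \<in> Obj (Tot X) \<Longrightarrow>
    fobj (TotF (comp_rccmap X Y Z N M)) A = fobj (TotF N) (fobj (TotF M) A)"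
  and farr_TotF_comp [simp]: "u \<in> Arr (Tot X) \<Longrightarrow>
    farr (TotF (comp_rccmap X Y Z N M)) u = farr (TotF N) (farr (TotF M) u)"
  and RootIso_comp [simp]:
    "RootIso (comp_rccmap X Y Z N M) = RootIso N \<cdot>\<^bsub>Base Z\<^esub> farr (BaseF N) (RootIso M)"
  by (simp_all add: comp_rccmap_def)

lemma Phi_comp:
  "A \<in> Obj (Tot X) \<Longrightarrow> Phi (comp_rccmap X Y Z N M) A =
    Sq (fobj (Chi Z) (fobj (TotF N) (fobj (TotF M) A)))
      (farr (BaseF N) (farr (BaseF M) (fobj (Chi X) A)))
      (farr (BaseF N) (stop (Phi M A)) \<cdot>\<^bsub>Base Z\<^esub> stop (Phi N (fobj (TotF M) A)))
      (Id (Base Z) (fobj (BaseF N) (fobj (BaseF M) (fobj (Proj X) A))))"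
  by (simp add: comp_rccmap_def arrow_cat_simps sq.map_sel)

text \<open>In this form the naturality of the composite comparison needs no computation.\<close>

lemma Phi_comp_vcomp:
  "Phi (comp_rccmap X Y Z N M) = vcomp (Tot X) (arrow_cat (Base Z))
    (hcomp (Tot X) (arrow_cat (Base Z)) (arrow_ftor (Base Y) (BaseF N))
      (comp_ftor (Tot X) (arrow_ftor (Base X) (BaseF M)) (Chi X))
      (id_nat (arrow_cat (Base Y)) (arrow_cat (Base Z)) (arrow_ftor (Base Y) (BaseF N))) (Phi M))
    (hcomp (Tot X) (arrow_cat (Base Z)) (comp_ftor (Tot Y) (Chi Z) (TotF N)) (TotF M)
      (Phi N) (id_nat (Tot X) (Tot Y) (TotF M)))"
proof
  fix A
  show "Phi (comp_rccmap X Y Z N M) A = vcomp (Tot X) (arrow_cat (Base Z))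
    (hcomp (Tot X) (arrow_cat (Base Z)) (arrow_ftor (Base Y) (BaseF N))
      (comp_ftor (Tot X) (arrow_ftor (Base X) (BaseF M)) (Chi X))
      (id_nat (arrow_cat (Base Y)) (arrow_cat (Base Z)) (arrow_ftor (Base Y) (BaseF N))) (Phi M))
    (hcomp (Tot X) (arrow_cat (Base Z)) (comp_ftor (Tot Y) (Chi Z) (TotF N)) (TotF M)
      (Phi N) (id_nat (Tot X) (Tot Y) (TotF M))) A"
  proof (cases "A \<in> Obj (Tot X)")
    case True
    have "Id (arrow_cat (Base Z)) (farr (BaseF N) (farr (BaseF M) (fobj (Chi X) A)))
        \<cdot>\<^bsub>arrow_cat (Base Z)\<^esub> map_sq (farr (BaseF N)) (Phi M A) = map_sq (farr (BaseF N)) (Phi M A)"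
      using True by (intro N.Y.Chi.T.Comp_Id_l) (simp_all add: arrow_cat_simps sq.map_sel)
    moreover have "Phi N (fobj (TotF M) A) \<cdot>\<^bsub>arrow_cat (Base Z)\<^esub>
        Id (arrow_cat (Base Z)) (fobj (Chi Z) (fobj (TotF N) (fobj (TotF M) A)))
        = Phi N (fobj (TotF M) A)"
      using True by (intro N.Y.Chi.T.Comp_Id_r) (simp_all add: arrow_cat_simps)
    ultimately show ?thesis
      using True by (simp add: comp_rccmap_def arrow_cat_simps(1))
  next
    case False
    then show ?thesis by (simp add: comp_rccmap_def vcomp_def)
  qed
qed

lemma pseudo_map_comp: "pseudo_map X Z (comp_rccmap X Y Z N M)"
proof (rule pseudo_mapI)
  let ?AX = "arrow_cat (Base X)" and ?AY = "arrow_cat (Base Y)" and ?AZ = "arrow_cat (Base Z)"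
  let ?aM = "arrow_ftor (Base X) (BaseF M)" and ?aN = "arrow_ftor (Base Y) (BaseF N)"
  let ?c = "comp_rccmap X Y Z N M"
  show B: "is_functor (Base X) (Base Z) (BaseF ?c)"
    by (simp add: comp_rccmap_def is_functor_comp[OF M.B.is_functor N.B.is_functor])
  show T: "is_functor (Tot X) (Tot Z) (TotF ?c)"
    by (simp add: comp_rccmap_def is_functor_comp[OF M.T.is_functor N.T.is_functor])
  show "cartesian (Tot Z) (Base Z) (Proj Z) (farr (TotF ?c) u)"
    if "cartesian (Tot X) (Base X) (Proj X) u" for u
  proof -
    have "u \<in> Arr (Tot X)" using that by (simp add: cartesian_def)
    then show ?thesis using N.cartesian_TotF[OF M.cartesian_TotF[OF that]] by simp
  qed
  \<comment> \<open>Needed to reassociate the target of the composite comparison.\<close>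
  have a: "arrow_ftor (Base X) (BaseF ?c) = comp_ftor ?AX ?aN ?aM"
  proof (rule ftor_eqI[OF func.is_functor_arrow is_functor_comp[OF M.B.is_functor_arrow N.B.is_functor_arrow]])
    show "func (Base X) (Base Z) (BaseF ?c)" by unfold_locales (rule B)
  qed (auto simp: arrow_cat_simps comp_rccmap_def map_sq_comp_ftor)
  \<comment> \<open>These reassociations make the whiskered forms of \<open>Phi N\<close> and
    \<open>Phi M\<close> meet in the middle and give their composite the required endpoints.\<close>
  have "comp_ftor (Tot X) (Chi Z) (TotF ?c) = comp_ftor (Tot X) (comp_ftor (Tot Y) (Chi Z) (TotF N)) (TotF M)"
    "comp_ftor (Tot X) (arrow_ftor (Base X) (BaseF ?c)) (Chi X) =
      comp_ftor (Tot X) ?aN (comp_ftor (Tot X) ?aM (Chi X))"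
    "comp_ftor (Tot X) (comp_ftor (Tot Y) ?aN (Chi Y)) (TotF M) =
      comp_ftor (Tot X) ?aN (comp_ftor (Tot X) (Chi Y) (TotF M))"
    unfolding a
    by (simp_all add: comp_ftor_assoc[OF M.T.is_functor] comp_ftor_assoc[OF M.X.Chi.is_functor])
      (simp add: comp_rccmap_def)
  then show "nat_trans (Tot X) ?AZ (comp_ftor (Tot X) (Chi Z) (TotF ?c))
      (comp_ftor (Tot X) (arrow_ftor (Base X) (BaseF ?c)) (Chi X)) (Phi ?c)"
    using nat_trans_vcomp[OF nat_trans_hcomp[OF nat_trans_id[OF M.T.is_functor] N.P.nat_trans]
        nat_trans_hcomp[OF M.P.nat_trans nat_trans_id[OF N.B.is_functor_arrow],
          folded \<open>_ = comp_ftor (Tot X) ?aN (comp_ftor (Tot X) (Chi Y) (TotF M))\<close>]]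
    by (simp add: Phi_comp_vcomp)
  then interpret P: ntrans "Tot X" ?AZ "comp_ftor (Tot X) (Chi Z) (TotF ?c)"
    "comp_ftor (Tot X) (arrow_ftor (Base X) (BaseF ?c)) (Chi X)" "Phi ?c"
    by unfold_locales
  show "iso_arr ?AZ (Phi ?c A)" if A: "A \<in> Obj (Tot X)" for A
  proof (rule N.Y.Proj.T.iso_arr_arrow_catI)
    show "Phi ?c A \<in> squares (Base Z)" using P.Arr[OF A] by (simp add: arrow_cat_simps)
  qed (use A in \<open>auto simp: Phi_comp intro!: N.Y.Proj.T.iso_arr_Comp N.Y.Proj.T.iso_arr_Id
        N.B.iso_arr_farr M.iso_arr_stop_Phi N.iso_arr_stop_Phi\<close>)
qed (use M.X_compr N.Y_compr in \<open>simp_all add: Phi_comp\<close>)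

end

lemma rooted_compcat_compr: "rooted_compcat X \<Longrightarrow> comprehension_category X"
  by (simp add: rooted_compcat_def)

lemma rooted_map_pmap:
  "\<lbrakk>rooted_compcat X; rooted_compcat Y; rooted_map X Y M\<rbrakk> \<Longrightarrow> pmap X Y M"
  by unfold_locales (auto simp: rooted_compcat_def rooted_map_def)

lemma rooted_map_RootIso:
  "rooted_map X Y M \<Longrightarrow> RootIso M \<in> Arr (Base Y) \<and> Dom (Base Y) (RootIso M) = fobj (BaseF M) (Root X)
    \<and> Cod (Base Y) (RootIso M) = Root Y \<and> iso_arr (Base Y) (RootIso M)"
  by (simp add: rooted_map_def hom_iff)

lemma rooted_compcat_Root: "rooted_compcat X \<Longrightarrow> Root X \<in> Obj (Base X)"
  by (simp add: rooted_compcat_def terminal_def)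

lemma rooted_map_comp:
  assumes "rooted_compcat X" "rooted_compcat Y" "rooted_compcat Z" "rooted_map X Y M" "rooted_map Y Z N"
  shows "rooted_map X Z (comp_rccmap X Y Z N M)"
proof -
  interpret M: pmap X Y M using assms by (intro rooted_map_pmap)
  interpret N: pmap Y Z N using assms by (intro rooted_map_pmap)
  interpret pmap_pair X Y Z M N by unfold_locales
  note [simp] = rooted_map_RootIso[OF assms(4)] rooted_map_RootIso[OF assms(5)]
    rooted_compcat_Root[OF assms(1)]
  show ?thesis
    by (auto simp: rooted_map_def pseudo_map_comp hom_iff intro!: N.Y.Proj.T.iso_arr_Comp N.B.iso_arr_farr)
qed

lemma comp_rccmap_id_right:
  assumes "rooted_compcat X" "rooted_compcat Y" "rooted_map X Y M"
  shows "comp_rccmap X X Y M (id_rccmap X) = M"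
proof -
  interpret M: pmap X Y M using assms by (intro rooted_map_pmap)
  note [simp] = rooted_map_RootIso[OF assms(3)] rooted_compcat_Root[OF assms(1)]
  have "Phi (comp_rccmap X X Y M (id_rccmap X)) = Phi M"
  proof (rule extensionalityI[where A = "Obj (Tot X)"])
    fix A assume A: "A \<in> Obj (Tot X)"
    have "Id (arrow_cat (Base Y)) (farr (BaseF M) (fobj (Chi X) A)) \<cdot>\<^bsub>arrow_cat (Base Y)\<^esub> Phi M A = Phi M A"
      using A by (intro M.Y.Chi.T.Comp_Id_l) (simp_all add: arrow_cat_simps)
    then show "Phi (comp_rccmap X X Y M (id_rccmap X)) A = Phi M A"
      using A M.X.Proj.T.Id_square[of "fobj (Chi X) A"]
      by (simp add: comp_rccmap_def id_rccmap_def arrow_cat_simps)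
  qed (use M.P.ext in \<open>auto simp: comp_rccmap_def\<close>)
  then show ?thesis
    by (intro rccmap.equality)
      (simp_all add: comp_rccmap_def id_rccmap_def comp_ftor_id_right[OF M.B.is_functor]
        comp_ftor_id_right[OF M.T.is_functor])
qed

lemma comp_rccmap_id_left:
  assumes "rooted_compcat X" "rooted_compcat Y" "rooted_map X Y M"
  shows "comp_rccmap X Y Y (id_rccmap Y) M = M"
proof -
  interpret M: pmap X Y M using assms by (intro rooted_map_pmap)
  note [simp] = rooted_map_RootIso[OF assms(3)] rooted_compcat_Root[OF assms(1)]
  have "Phi (comp_rccmap X Y Y (id_rccmap Y) M) = Phi M"
  proof (rule extensionalityI[where A = "Obj (Tot X)"])
    fix A assume A: "A \<in> Obj (Tot X)"
    have "Phi M A \<cdot>\<^bsub>arrow_cat (Base Y)\<^esub> Id (arrow_cat (Base Y)) (fobj (Chi Y) (fobj (TotF M) A)) = Phi M A"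
      using A by (intro M.Y.Chi.T.Comp_Id_r) (simp_all add: arrow_cat_simps)
    then show "Phi (comp_rccmap X Y Y (id_rccmap Y) M) A = Phi M A"
      using A by (simp add: comp_rccmap_def id_rccmap_def map_sq_id_ftor)
  qed (use M.P.ext in \<open>auto simp: comp_rccmap_def\<close>)
  then show ?thesis
    by (intro rccmap.equality)
      (simp_all add: comp_rccmap_def id_rccmap_def comp_ftor_id_left[OF M.B.is_functor]
        comp_ftor_id_left[OF M.T.is_functor])
qed

text \<open>Once \<open>Phi_comp\<close> has written the comparisons edge by edge, what remains is
  associativity in the base and distribution of \<open>BaseF N\<close> over a composite.\<close>

lemma comp_rccmap_assoc:
  assumes "rooted_compcat W" "rooted_compcat X" "rooted_compcat Y" "rooted_compcat Z"
    and "rooted_map W X L" "rooted_map X Y M" "rooted_map Y Z N"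
  shows "comp_rccmap W X Z (comp_rccmap X Y Z N M) L = comp_rccmap W Y Z N (comp_rccmap W X Y M L)"
proof -
  interpret L: pmap W X L using assms by (intro rooted_map_pmap)
  interpret M: pmap X Y M using assms by (intro rooted_map_pmap)
  interpret N: pmap Y Z N using assms by (intro rooted_map_pmap)
  interpret c1: pmap_pair W X Y L M by unfold_locales
  interpret c2: pmap_pair X Y Z M N by unfold_locales
  interpret c1: pmap W Y "comp_rccmap W X Y M L"
    by unfold_locales (simp_all add: c1.pseudo_map_comp L.X_compr M.Y_compr)
  interpret c2: pmap X Z "comp_rccmap X Y Z N M"
    by unfold_locales (simp_all add: c2.pseudo_map_comp M.X_compr N.Y_compr)
  interpret l: pmap_pair W X Z L "comp_rccmap X Y Z N M" by unfold_locales
  interpret r: pmap_pair W Y Z "comp_rccmap W X Y M L" N by unfold_locales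
  note [simp] = rooted_map_RootIso[OF assms(5)] rooted_map_RootIso[OF assms(6)]
    rooted_map_RootIso[OF assms(7)] rooted_compcat_Root[OF assms(1)]
  have "Phi (comp_rccmap W X Z (comp_rccmap X Y Z N M) L)
      = Phi (comp_rccmap W Y Z N (comp_rccmap W X Y M L))"
  proof (rule extensionalityI[where A = "Obj (Tot W)"])
    fix A assume A: "A \<in> Obj (Tot W)"
    then show "Phi (comp_rccmap W X Z (comp_rccmap X Y Z N M) L) A
        = Phi (comp_rccmap W Y Z N (comp_rccmap W X Y M L)) A"
      by (simp add: l.Phi_comp r.Phi_comp c2.Phi_comp c1.Phi_comp)
  qed (auto simp: comp_rccmap_def[of W])
  moreover have "RootIso (comp_rccmap W X Z (comp_rccmap X Y Z N M) L)
      = RootIso (comp_rccmap W Y Z N (comp_rccmap W X Y M L))"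
    by simp
  ultimately show ?thesis
    by (intro rccmap.equality)
      (simp_all add: comp_rccmap_def comp_ftor_assoc[OF L.B.is_functor] comp_ftor_assoc[OF L.T.is_functor])
qed

section \<open>The 2-category of rooted comprehension categories\<close>

lemma cc_hom_cells:
  "cc_hom X Y = cell_cat {M. rooted_map X Y M} (rooted_transformation X Y)
    (\<lambda>M. (id_nat (Base X) (Base Y) (BaseF M), id_nat (Tot X) (Tot Y) (TotF M)))
    (\<lambda>b a. (vcomp (Base X) (Base Y) (fst b) (fst a), vcomp (Tot X) (Tot Y) (snd b) (snd a)))"
  by (simp add: cc_hom_def cell_cat_def Let_def)

lemma rooted_transformation_iff:
  "rooted_transformation X Y M N a \<longleftrightarrow>
    nat_trans (Base X) (Base Y) (BaseF M) (BaseF N) (fst a) \<and>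
    nat_trans (Tot X) (Tot Y) (TotF M) (TotF N) (snd a) \<and>
    (\<forall>A \<in> Obj (Tot X). farr (Proj Y) (snd a A) = fst a (fobj (Proj X) A)) \<and>
    (\<forall>A \<in> Obj (Tot X). stop (Phi N A) \<cdot>\<^bsub>Base Y\<^esub> stop (farr (Chi Y) (snd a A))
      = fst a (ctx_ext X A) \<cdot>\<^bsub>Base Y\<^esub> stop (Phi M A)) \<and>
    RootIso N \<cdot>\<^bsub>Base Y\<^esub> fst a (Root X) = RootIso M"
  by (auto simp: rooted_transformation_def cc_transformation_def split: prod.splits)

section \<open>Rooted transformations and their composites\<close>

locale rmap =
  fixes X Y :: "('o, 'm, 't, 'n) rcompcat" and M :: "('o, 'm, 't, 'n) rccmap"
  assumes X_rooted: "rooted_compcat X" and Y_rooted: "rooted_compcat Y"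
    and rooted_map: "rooted_map X Y M"

sublocale rmap \<subseteq> pmap X Y M
  by (rule rooted_map_pmap[OF X_rooted Y_rooted rooted_map])

lemma (in rmap) RootIso [simp]:
  "RootIso M \<in> Arr (Base Y)" "Dom (Base Y) (RootIso M) = fobj (BaseF M) (Root X)"
  "Cod (Base Y) (RootIso M) = Root Y" "iso_arr (Base Y) (RootIso M)"
  using rooted_map_RootIso[OF rooted_map] by auto

lemma (in rmap) Root_Obj [simp]: "Root X \<in> Obj (Base X)" "Root Y \<in> Obj (Base Y)"
  using rooted_compcat_Root X_rooted Y_rooted by auto

locale rtrans = M: rmap X Y M + N: rmap X Y N
  for X Y :: "('o, 'm, 't, 'n) rcompcat" and M N :: "('o, 'm, 't, 'n) rccmap" +
  fixes a :: "('o \<Rightarrow> 'm) \<times> ('t \<Rightarrow> 'n)"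
  assumes rooted_transformation: "rooted_transformation X Y M N a"

sublocale rtrans \<subseteq> b: ntrans "Base X" "Base Y" "BaseF M" "BaseF N" "fst a"
  using rooted_transformation by unfold_locales (simp add: rooted_transformation_iff)
sublocale rtrans \<subseteq> t: ntrans "Tot X" "Tot Y" "TotF M" "TotF N" "snd a"
  using rooted_transformation by unfold_locales (simp add: rooted_transformation_iff)

context rtrans begin

lemma Proj_snd [simp]: "A \<in> Obj (Tot X) \<Longrightarrow> farr (Proj Y) (snd a A) = fst a (fobj (Proj X) A)"
  using rooted_transformation by (simp add: rooted_transformation_iff)

lemma Phi_snd: "A \<in> Obj (Tot X) \<Longrightarrow> stop (Phi N A) \<cdot>\<^bsub>Base Y\<^esub> stop (farr (Chi Y) (snd a A))
    = fst a (ctx_ext X A) \<cdot>\<^bsub>Base Y\<^esub> stop (Phi M A)"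
  using rooted_transformation by (simp add: rooted_transformation_iff)

lemma RootIso_fst: "RootIso N \<cdot>\<^bsub>Base Y\<^esub> fst a (Root X) = RootIso M"
  using rooted_transformation by (simp add: rooted_transformation_iff)

end

lemma rooted_transformation_id:
  assumes "rooted_compcat X" "rooted_compcat Y" "rooted_map X Y M"
  shows "rooted_transformation X Y M M
    (id_nat (Base X) (Base Y) (BaseF M), id_nat (Tot X) (Tot Y) (TotF M))"
proof -
  interpret M: rmap X Y M using assms by unfold_locales
  show ?thesis
    by (auto simp: rooted_transformation_iff nat_trans_id[OF M.B.is_functor]
        nat_trans_id[OF M.T.is_functor] arrow_cat_simps)
qed

text \<open>The conditions at comprehension and at the root are pasted along the middle map
  \<open>N\<close>.\<close>

lemma rooted_transformation_vcomp:
  assumes "rooted_compcat X" "rooted_compcat Y" "rooted_map X Y M" "rooted_map X Y N" "rooted_map X Y P"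
    and "rooted_transformation X Y M N a" "rooted_transformation X Y N P b"
  shows "rooted_transformation X Y M P
    (vcomp (Base X) (Base Y) (fst b) (fst a), vcomp (Tot X) (Tot Y) (snd b) (snd a))"
proof -
  interpret a: rtrans X Y M N a using assms by unfold_locales
  interpret b: rtrans X Y N P b using assms by unfold_locales
  have "stop (Phi P A) \<cdot>\<^bsub>Base Y\<^esub> (stop (farr (Chi Y) (snd b A)) \<cdot>\<^bsub>Base Y\<^esub> stop (farr (Chi Y) (snd a A)))
    = fst b (ctx_ext X A) \<cdot>\<^bsub>Base Y\<^esub> (fst a (ctx_ext X A) \<cdot>\<^bsub>Base Y\<^esub> stop (Phi M A))"
    if A: "A \<in> Obj (Tot X)" for A
  proof -
    have "stop (Phi P A) \<cdot>\<^bsub>Base Y\<^esub> (stop (farr (Chi Y) (snd b A)) \<cdot>\<^bsub>Base Y\<^esub> stop (farr (Chi Y) (snd a A)))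
      = (stop (Phi P A) \<cdot>\<^bsub>Base Y\<^esub> stop (farr (Chi Y) (snd b A))) \<cdot>\<^bsub>Base Y\<^esub> stop (farr (Chi Y) (snd a A))"
      using A by simp
    also have "\<dots> = fst b (ctx_ext X A) \<cdot>\<^bsub>Base Y\<^esub>
        (stop (Phi N A) \<cdot>\<^bsub>Base Y\<^esub> stop (farr (Chi Y) (snd a A)))"
      unfolding b.Phi_snd[OF A] using A by simp
    finally show ?thesis unfolding a.Phi_snd[OF A] .
  qed
  moreover have "RootIso P \<cdot>\<^bsub>Base Y\<^esub> (fst b (Root X) \<cdot>\<^bsub>Base Y\<^esub> fst a (Root X)) = RootIso M"
  proof -
    have "RootIso P \<cdot>\<^bsub>Base Y\<^esub> (fst b (Root X) \<cdot>\<^bsub>Base Y\<^esub> fst a (Root X))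
      = (RootIso P \<cdot>\<^bsub>Base Y\<^esub> fst b (Root X)) \<cdot>\<^bsub>Base Y\<^esub> fst a (Root X)" by simp
    then show ?thesis by (simp only: b.RootIso_fst a.RootIso_fst)
  qed
  ultimately show ?thesis
    by (auto simp: rooted_transformation_iff arrow_cat_simps nat_trans_vcomp[OF a.b.nat_trans b.b.nat_trans]
        nat_trans_vcomp[OF a.t.nat_trans b.t.nat_trans])
qed

lemma rccmap_ftors:
  "BaseF (id_rccmap X) = id_ftor (Base X)" "TotF (id_rccmap X) = id_ftor (Tot X)"
  "BaseF (comp_rccmap X Y Z N M) = comp_ftor (Base X) (BaseF N) (BaseF M)"
  "TotF (comp_rccmap X Y Z N M) = comp_ftor (Tot X) (TotF N) (TotF M)"
  by (simp_all add: id_rccmap_def comp_rccmap_def)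

text \<open>The condition at comprehension pastes four squares: the condition on \<open>b\<close> at
  \<open>fobj (TotF M') A\<close>, naturality of \<open>Phi N\<close> at \<open>snd a A\<close>,
  naturality of \<open>fst b\<close> at \<open>stop (Phi M' A)\<close>, and the image under
  \<open>BaseF N\<close> of the condition on \<open>a\<close>. At the root, naturality of
  \<open>fst b\<close> at \<open>RootIso M'\<close> joins the two given conditions.\<close>

lemma rooted_transformation_hcomp:
  assumes "rooted_compcat X" "rooted_compcat Y" "rooted_compcat Z"
    and "rooted_map X Y M" "rooted_map X Y M'" "rooted_map Y Z N" "rooted_map Y Z N'"
    and "rooted_transformation X Y M M' a" "rooted_transformation Y Z N N' b"
  shows "rooted_transformation X Z (comp_rccmap X Y Z N M) (comp_rccmap X Y Z N' M')
    (hcomp (Base X) (Base Z) (BaseF N) (BaseF M') (fst b) (fst a),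
     hcomp (Tot X) (Tot Z) (TotF N) (TotF M') (snd b) (snd a))"
proof -
  interpret a: rtrans X Y M M' a using assms by unfold_locales
  interpret b: rtrans Y Z N N' b using assms by unfold_locales
  interpret NM: pmap_pair X Y Z M N by unfold_locales
  interpret NM': pmap_pair X Y Z M' N' by unfold_locales
  have "farr (BaseF N') (stop (Phi M' A)) \<cdot>\<^bsub>Base Z\<^esub> (stop (Phi N' (fobj (TotF M') A)) \<cdot>\<^bsub>Base Z\<^esub>
      (stop (farr (Chi Z) (snd b (fobj (TotF M') A))) \<cdot>\<^bsub>Base Z\<^esub> stop (farr (Chi Z) (farr (TotF N) (snd a A)))))
    = fst b (fobj (BaseF M') (ctx_ext X A)) \<cdot>\<^bsub>Base Z\<^esub> (farr (BaseF N) (fst a (ctx_ext X A)) \<cdot>\<^bsub>Base Z\<^esub>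
      (farr (BaseF N) (stop (Phi M A)) \<cdot>\<^bsub>Base Z\<^esub> stop (Phi N (fobj (TotF M) A))))"
    (is "?l = ?r") if A: "A \<in> Obj (Tot X)" for A
  proof -
    have "?l = farr (BaseF N') (stop (Phi M' A)) \<cdot>\<^bsub>Base Z\<^esub> ((stop (Phi N' (fobj (TotF M') A)) \<cdot>\<^bsub>Base Z\<^esub>
      stop (farr (Chi Z) (snd b (fobj (TotF M') A)))) \<cdot>\<^bsub>Base Z\<^esub> stop (farr (Chi Z) (farr (TotF N) (snd a A))))"
      using A by simp
    also have "\<dots> = farr (BaseF N') (stop (Phi M' A)) \<cdot>\<^bsub>Base Z\<^esub> (fst b (ctx_ext Y (fobj (TotF M') A)) \<cdot>\<^bsub>Base Z\<^esub>
      (stop (Phi N (fobj (TotF M') A)) \<cdot>\<^bsub>Base Z\<^esub> stop (farr (Chi Z) (farr (TotF N) (snd a A)))))"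
      unfolding b.Phi_snd[OF a.N.T.fobj_Obj[OF A]] using A by simp
    also have "stop (Phi N (fobj (TotF M') A)) \<cdot>\<^bsub>Base Z\<^esub> stop (farr (Chi Z) (farr (TotF N) (snd a A)))
      = farr (BaseF N) (stop (farr (Chi Y) (snd a A))) \<cdot>\<^bsub>Base Z\<^esub> stop (Phi N (fobj (TotF M) A))"
      using A by (simp add: b.M.stop_Phi_naturality)
    also have "farr (BaseF N') (stop (Phi M' A)) \<cdot>\<^bsub>Base Z\<^esub> (fst b (ctx_ext Y (fobj (TotF M') A)) \<cdot>\<^bsub>Base Z\<^esub>
        (farr (BaseF N) (stop (farr (Chi Y) (snd a A))) \<cdot>\<^bsub>Base Z\<^esub> stop (Phi N (fobj (TotF M) A))))
      = (farr (BaseF N') (stop (Phi M' A)) \<cdot>\<^bsub>Base Z\<^esub> fst b (ctx_ext Y (fobj (TotF M') A))) \<cdot>\<^bsub>Base Z\<^esub>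
        (farr (BaseF N) (stop (farr (Chi Y) (snd a A))) \<cdot>\<^bsub>Base Z\<^esub> stop (Phi N (fobj (TotF M) A)))"
      using A by simp
    also have "farr (BaseF N') (stop (Phi M' A)) \<cdot>\<^bsub>Base Z\<^esub> fst b (ctx_ext Y (fobj (TotF M') A))
      = fst b (fobj (BaseF M') (ctx_ext X A)) \<cdot>\<^bsub>Base Z\<^esub> farr (BaseF N) (stop (Phi M' A))"
      using A by (simp add: b.b.naturality)
    also have "(fst b (fobj (BaseF M') (ctx_ext X A)) \<cdot>\<^bsub>Base Z\<^esub> farr (BaseF N) (stop (Phi M' A))) \<cdot>\<^bsub>Base Z\<^esub>
        (farr (BaseF N) (stop (farr (Chi Y) (snd a A))) \<cdot>\<^bsub>Base Z\<^esub> stop (Phi N (fobj (TotF M) A)))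
      = fst b (fobj (BaseF M') (ctx_ext X A)) \<cdot>\<^bsub>Base Z\<^esub>
        (farr (BaseF N) (stop (Phi M' A) \<cdot>\<^bsub>Base Y\<^esub> stop (farr (Chi Y) (snd a A))) \<cdot>\<^bsub>Base Z\<^esub>
          stop (Phi N (fobj (TotF M) A)))"
      using A by simp
    also have "\<dots> = ?r" unfolding a.Phi_snd[OF A] using A by simp
    finally show ?thesis .
  qed
  moreover have "RootIso N' \<cdot>\<^bsub>Base Z\<^esub> (farr (BaseF N') (RootIso M') \<cdot>\<^bsub>Base Z\<^esub>
      (fst b (fobj (BaseF M') (Root X)) \<cdot>\<^bsub>Base Z\<^esub> farr (BaseF N) (fst a (Root X))))
    = RootIso N \<cdot>\<^bsub>Base Z\<^esub> farr (BaseF N) (RootIso M)"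
  proof -
    have "RootIso N' \<cdot>\<^bsub>Base Z\<^esub> (farr (BaseF N') (RootIso M') \<cdot>\<^bsub>Base Z\<^esub>
        (fst b (fobj (BaseF M') (Root X)) \<cdot>\<^bsub>Base Z\<^esub> farr (BaseF N) (fst a (Root X))))
      = RootIso N' \<cdot>\<^bsub>Base Z\<^esub> ((farr (BaseF N') (RootIso M') \<cdot>\<^bsub>Base Z\<^esub>
        fst b (fobj (BaseF M') (Root X))) \<cdot>\<^bsub>Base Z\<^esub> farr (BaseF N) (fst a (Root X)))" by simp
    also have "farr (BaseF N') (RootIso M') \<cdot>\<^bsub>Base Z\<^esub> fst b (fobj (BaseF M') (Root X))
      = fst b (Root Y) \<cdot>\<^bsub>Base Z\<^esub> farr (BaseF N) (RootIso M')"
      by (simp add: b.b.naturality)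
    also have "RootIso N' \<cdot>\<^bsub>Base Z\<^esub> ((fst b (Root Y) \<cdot>\<^bsub>Base Z\<^esub> farr (BaseF N) (RootIso M')) \<cdot>\<^bsub>Base Z\<^esub>
        farr (BaseF N) (fst a (Root X)))
      = (RootIso N' \<cdot>\<^bsub>Base Z\<^esub> fst b (Root Y)) \<cdot>\<^bsub>Base Z\<^esub>
        farr (BaseF N) (RootIso M' \<cdot>\<^bsub>Base Y\<^esub> fst a (Root X))" by simp
    finally show ?thesis by (simp only: b.RootIso_fst a.RootIso_fst)
  qed
  ultimately show ?thesis
    using nat_trans_hcomp[OF a.b.nat_trans b.b.nat_trans] nat_trans_hcomp[OF a.t.nat_trans b.t.nat_trans]
    by (auto simp: rooted_transformation_iff rccmap_ftors NM.Phi_comp NM'.Phi_comp arrow_cat_simps)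
qed

text \<open>Equations between 2-cells hold separately for base and total components, so they reduce
  to the laws for natural transformations.\<close>

lemma two_category_CompCat_rtd: "two_category CompCat_rtd"
proof (rule two_category_cells[where Ob = "\<lambda>X Y. {M. rooted_map X Y M}"
      and R = rooted_transformation
      and i = "\<lambda>X Y M. (id_nat (Base X) (Base Y) (BaseF M), id_nat (Tot X) (Tot Y) (TotF M))"
      and v = "\<lambda>X Y b a. (vcomp (Base X) (Base Y) (fst b) (fst a), vcomp (Tot X) (Tot Y) (snd b) (snd a))"
      and h = "\<lambda>X Y Z N M' b a. (hcomp (Base X) (Base Z) (BaseF N) (BaseF M') (fst b) (fst a),
        hcomp (Tot X) (Tot Z) (TotF N) (TotF M') (snd b) (snd a))"], goal_cases)
  case (3 X Y M)
  then show ?case by (simp add: CompCat_rtd_def rooted_transformation_id)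
next
  case (4 X Y M N P a b)
  then show ?case by (simp add: CompCat_rtd_def rooted_transformation_vcomp)
next
  case (13 X Y Z M M' N N' a b)
  then show ?case by (simp add: CompCat_rtd_def rooted_transformation_hcomp)
next
  case (14 X Y Z M N)
  then have "pmap X Y M" "pmap Y Z N" by (auto simp: CompCat_rtd_def intro: rooted_map_pmap)
  then interpret M: pmap X Y M + N: pmap Y Z N .
  show ?case
    by (simp add: CompCat_rtd_def comp_rccmap_def hcomp_id[OF M.B.is_functor N.B.is_functor]
        hcomp_id[OF M.T.is_functor N.T.is_functor])
qed (auto simp: CompCat_rtd_def cc_hom_cells rooted_map_id rooted_map_comp comp_rccmap_id_right
    comp_rccmap_id_left comp_rccmap_assoc rooted_transformation_iff rccmap_ftors prod_eq_iff
    intro: vcomp_id_right vcomp_id_left vcomp_assoc hcomp_vcomp hcomp_id_right hcomp_id_left hcomp_assoc)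

section \<open>Pullback squares\<close>

lemma hom_arrow_cat: "s \<in> hom (arrow_cat C) a b \<longleftrightarrow> s \<in> squares C \<and> ssrc s = a \<and> stgt s = b"
  by (auto simp: hom_iff arrow_cat_simps)

lemma pullback_squareE:
  assumes "pullback_square C s" "a \<in> Arr C" "b \<in> Arr C" "Dom C a = Dom C b"
    "Cod C a = Cod C (ssrc s)" "Cod C b = Dom C (stgt s)" "sbot s \<cdot>\<^bsub>C\<^esub> a = stgt s \<cdot>\<^bsub>C\<^esub> b"
  obtains u where "u \<in> Arr C" "Dom C u = Dom C b" "Cod C u = Dom C (ssrc s)"
    "ssrc s \<cdot>\<^bsub>C\<^esub> u = a" "stop s \<cdot>\<^bsub>C\<^esub> u = b"
  using assms unfolding pullback_square_def hom_iff by metis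

lemma pullback_square_unique:
  assumes "category C" "pullback_square C s" "u \<in> Arr C" "v \<in> Arr C" "Dom C u = Dom C v"
    "Cod C u = Dom C (ssrc s)" "Cod C v = Dom C (ssrc s)"
    "ssrc s \<cdot>\<^bsub>C\<^esub> u = ssrc s \<cdot>\<^bsub>C\<^esub> v" "stop s \<cdot>\<^bsub>C\<^esub> u = stop s \<cdot>\<^bsub>C\<^esub> v"
  shows "u = v"
proof -
  interpret category C by fact
  note s = squares_arrs[OF pullback_square_squares[OF assms(2)]]
  \<comment> \<open>The arrow \<open>v\<close> induces a cone on \<open>s\<close>; unique existence
    is then applied to this cone.\<close>
  have "sbot s \<cdot>\<^bsub>C\<^esub> (ssrc s \<cdot>\<^bsub>C\<^esub> v) = (stgt s \<cdot>\<^bsub>C\<^esub> stop s) \<cdot>\<^bsub>C\<^esub> v"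
    unfolding s(9) using s(1-8) assms(3-7) by simp
  also have "\<dots> = stgt s \<cdot>\<^bsub>C\<^esub> (stop s \<cdot>\<^bsub>C\<^esub> v)"
    using s(1-8) assms(3-7) by simp
  finally have eq: "sbot s \<cdot>\<^bsub>C\<^esub> (ssrc s \<cdot>\<^bsub>C\<^esub> v) = stgt s \<cdot>\<^bsub>C\<^esub> (stop s \<cdot>\<^bsub>C\<^esub> v)" .
  have ex1: "\<And>x a b. \<lbrakk>a \<in> hom C x (Cod C (ssrc s)); b \<in> hom C x (Dom C (stgt s));
      sbot s \<cdot>\<^bsub>C\<^esub> a = stgt s \<cdot>\<^bsub>C\<^esub> b\<rbrakk> \<Longrightarrow>
      \<exists>!u. u \<in> hom C x (Dom C (ssrc s)) \<and> ssrc s \<cdot>\<^bsub>C\<^esub> u = a \<and> stop s \<cdot>\<^bsub>C\<^esub> u = b"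
    using assms(2) unfolding pullback_square_def by blast
  have "\<exists>!w. w \<in> hom C (Dom C v) (Dom C (ssrc s)) \<and> ssrc s \<cdot>\<^bsub>C\<^esub> w = ssrc s \<cdot>\<^bsub>C\<^esub> v \<and>
      stop s \<cdot>\<^bsub>C\<^esub> w = stop s \<cdot>\<^bsub>C\<^esub> v"
    by (rule ex1[OF _ _ eq]) (use assms s in \<open>simp_all add: hom_iff\<close>)
  then show ?thesis using assms by (auto simp: hom_iff)
qed

lemma (in category) pullback_squareI:
  assumes s: "s \<in> squares C"
    and ex: "\<And>a b. \<lbrakk>a \<in> Arr C; b \<in> Arr C; Dom C a = Dom C b; Cod C a = Cod C (ssrc s);
      Cod C b = Dom C (stgt s); sbot s \<cdot>\<^bsub>C\<^esub> a = stgt s \<cdot>\<^bsub>C\<^esub> b\<rbrakk> \<Longrightarrow>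
      \<exists>u. u \<in> Arr C \<and> Dom C u = Dom C b \<and> Cod C u = Dom C (ssrc s) \<and>
        ssrc s \<cdot>\<^bsub>C\<^esub> u = a \<and> stop s \<cdot>\<^bsub>C\<^esub> u = b"
    and un: "\<And>u v. \<lbrakk>u \<in> Arr C; v \<in> Arr C; Dom C u = Dom C v; Cod C u = Dom C (ssrc s);
      Cod C v = Dom C (ssrc s); ssrc s \<cdot>\<^bsub>C\<^esub> u = ssrc s \<cdot>\<^bsub>C\<^esub> v;
      stop s \<cdot>\<^bsub>C\<^esub> u = stop s \<cdot>\<^bsub>C\<^esub> v\<rbrakk> \<Longrightarrow> u = v"
  shows "pullback_square C s"
  unfolding pullback_square_def
proof (intro conjI allI impI)
  fix x a b assume ab: "a \<in> hom C x (Cod C (ssrc s))" "b \<in> hom C x (Dom C (stgt s))"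
    "sbot s \<cdot>\<^bsub>C\<^esub> a = stgt s \<cdot>\<^bsub>C\<^esub> b"
  then obtain u where u: "u \<in> Arr C" "Dom C u = x" "Cod C u = Dom C (ssrc s)"
    "ssrc s \<cdot>\<^bsub>C\<^esub> u = a" "stop s \<cdot>\<^bsub>C\<^esub> u = b"
    using ex[of a b] by (auto simp: hom_iff)
  show "\<exists>!u. u \<in> hom C x (Dom C (ssrc s)) \<and> ssrc s \<cdot>\<^bsub>C\<^esub> u = a \<and> stop s \<cdot>\<^bsub>C\<^esub> u = b"
  proof (rule ex1I[of _ u])
    fix v assume "v \<in> hom C x (Dom C (ssrc s)) \<and> ssrc s \<cdot>\<^bsub>C\<^esub> v = a \<and> stop s \<cdot>\<^bsub>C\<^esub> v = b"
    then show "v = u" using u by - (rule un; auto simp: hom_iff)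
  qed (use u in \<open>auto simp: hom_iff\<close>)
qed (rule s)

text \<open>Transport of a pullback square along isomorphisms \<open>i\<close> and \<open>j\<close>
  of its upper corners, with the base edge kept fixed. It is applied with the top edges of a
  comparison \<open>Phi M\<close> as \<open>i\<close> and \<open>j\<close>.\<close>

lemma (in category) pullback_square_iso:
  assumes s: "pullback_square C s" and s': "s' \<in> squares C" and bot: "sbot s' = sbot s"
    and i: "iso_arr C i" "Dom C i = Dom C (ssrc s)" "Cod C i = Dom C (ssrc s')" "ssrc s' \<cdot>\<^bsub>C\<^esub> i = ssrc s"
    and j: "iso_arr C j" "Dom C j = Dom C (stgt s)" "Cod C j = Dom C (stgt s')" "stgt s' \<cdot>\<^bsub>C\<^esub> j = stgt s"
    and ij: "stop s' \<cdot>\<^bsub>C\<^esub> i = j \<cdot>\<^bsub>C\<^esub> stop s"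
  shows "pullback_square C s'"
proof -
  note [simp] = squares_arrs(1-8)[OF pullback_square_squares[OF s]] squares_arrs(1-8)[OF s']
    iso_arr_Arr[OF i(1)] i(2,3) iso_arr_Arr[OF j(1)] j(2,3)
  have cod: "Cod C (ssrc s) = Cod C (ssrc s')" "Cod C (stgt s) = Cod C (stgt s')"
    by (simp_all flip: i(4) j(4))
  obtain i' where i': "i' \<in> Arr C" "Dom C i' = Dom C (ssrc s')" "Cod C i' = Dom C (ssrc s)"
    "i' \<cdot>\<^bsub>C\<^esub> i = Id C (Dom C (ssrc s))" "i \<cdot>\<^bsub>C\<^esub> i' = Id C (Dom C (ssrc s'))"
    using i(1) by (rule iso_arrE) auto
  obtain j' where j': "j' \<in> Arr C" "Dom C j' = Dom C (stgt s')" "Cod C j' = Dom C (stgt s)"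
    "j' \<cdot>\<^bsub>C\<^esub> j = Id C (Dom C (stgt s))" "j \<cdot>\<^bsub>C\<^esub> j' = Id C (Dom C (stgt s'))"
    using j(1) by (rule iso_arrE) auto
  have ii [simp]: "i \<cdot>\<^bsub>C\<^esub> (i' \<cdot>\<^bsub>C\<^esub> u) = u" if "u \<in> Arr C" "Cod C u = Dom C (ssrc s')" for u
    using that i' by (simp flip: Comp_assoc')
  have jj [simp]: "j \<cdot>\<^bsub>C\<^esub> (j' \<cdot>\<^bsub>C\<^esub> u) = u" if "u \<in> Arr C" "Cod C u = Dom C (stgt s')" for u
    using that j' by (simp flip: Comp_assoc')
  show ?thesis
  proof (rule pullback_squareI[OF s'])
    fix a b assume ab: "a \<in> Arr C" "b \<in> Arr C" "Dom C a = Dom C b" "Cod C a = Cod C (ssrc s')"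
      "Cod C b = Dom C (stgt s')" "sbot s' \<cdot>\<^bsub>C\<^esub> a = stgt s' \<cdot>\<^bsub>C\<^esub> b"
    \<comment> \<open>The inverse of \<open>j\<close> turns a cone on \<open>s'\<close> into a cone
      on \<open>s\<close>.\<close>
    have "sbot s \<cdot>\<^bsub>C\<^esub> a = stgt s' \<cdot>\<^bsub>C\<^esub> (j \<cdot>\<^bsub>C\<^esub> (j' \<cdot>\<^bsub>C\<^esub> b))"
      using ab j' bot by simp
    also have "\<dots> = (stgt s' \<cdot>\<^bsub>C\<^esub> j) \<cdot>\<^bsub>C\<^esub> (j' \<cdot>\<^bsub>C\<^esub> b)"
      using ab j'(1-3) by (simp del: jj)
    finally have eq: "sbot s \<cdot>\<^bsub>C\<^esub> a = stgt s \<cdot>\<^bsub>C\<^esub> (j' \<cdot>\<^bsub>C\<^esub> b)" unfolding j(4) .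
    obtain u where u: "u \<in> Arr C" "Dom C u = Dom C (j' \<cdot>\<^bsub>C\<^esub> b)" "Cod C u = Dom C (ssrc s)"
      "ssrc s \<cdot>\<^bsub>C\<^esub> u = a" "stop s \<cdot>\<^bsub>C\<^esub> u = j' \<cdot>\<^bsub>C\<^esub> b"
      by (rule pullback_squareE[OF s _ _ _ _ _ eq]) (use ab j' cod in auto)
    have "ssrc s' \<cdot>\<^bsub>C\<^esub> (i \<cdot>\<^bsub>C\<^esub> u) = (ssrc s' \<cdot>\<^bsub>C\<^esub> i) \<cdot>\<^bsub>C\<^esub> u"
      "stop s' \<cdot>\<^bsub>C\<^esub> (i \<cdot>\<^bsub>C\<^esub> u) = (stop s' \<cdot>\<^bsub>C\<^esub> i) \<cdot>\<^bsub>C\<^esub> u" using u(1-3) by simp_all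
    then have "ssrc s' \<cdot>\<^bsub>C\<^esub> (i \<cdot>\<^bsub>C\<^esub> u) = a" "stop s' \<cdot>\<^bsub>C\<^esub> (i \<cdot>\<^bsub>C\<^esub> u) = b"
      unfolding i(4) ij using u ab j' by simp_all
    then show "\<exists>u. u \<in> Arr C \<and> Dom C u = Dom C b \<and> Cod C u = Dom C (ssrc s') \<and>
        ssrc s' \<cdot>\<^bsub>C\<^esub> u = a \<and> stop s' \<cdot>\<^bsub>C\<^esub> u = b"
      using u ab j' by (intro exI[of _ "i \<cdot>\<^bsub>C\<^esub> u"]) simp
  next
    fix u v assume uv: "u \<in> Arr C" "v \<in> Arr C" "Dom C u = Dom C v" "Cod C u = Dom C (ssrc s')"
      "Cod C v = Dom C (ssrc s')" "ssrc s' \<cdot>\<^bsub>C\<^esub> u = ssrc s' \<cdot>\<^bsub>C\<^esub> v" "stop s' \<cdot>\<^bsub>C\<^esub> u = stop s' \<cdot>\<^bsub>C\<^esub> v"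
    have src: "ssrc s \<cdot>\<^bsub>C\<^esub> (i' \<cdot>\<^bsub>C\<^esub> w) = ssrc s' \<cdot>\<^bsub>C\<^esub> w"
      and top: "j \<cdot>\<^bsub>C\<^esub> (stop s \<cdot>\<^bsub>C\<^esub> (i' \<cdot>\<^bsub>C\<^esub> w)) = stop s' \<cdot>\<^bsub>C\<^esub> w"
      if w: "w \<in> Arr C" "Cod C w = Dom C (ssrc s')" for w
    proof -
      have "ssrc s \<cdot>\<^bsub>C\<^esub> (i' \<cdot>\<^bsub>C\<^esub> w) = (ssrc s' \<cdot>\<^bsub>C\<^esub> i) \<cdot>\<^bsub>C\<^esub> (i' \<cdot>\<^bsub>C\<^esub> w)" by (simp only: i(4))
      then show "ssrc s \<cdot>\<^bsub>C\<^esub> (i' \<cdot>\<^bsub>C\<^esub> w) = ssrc s' \<cdot>\<^bsub>C\<^esub> w" using w i' by simp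
      have "j \<cdot>\<^bsub>C\<^esub> (stop s \<cdot>\<^bsub>C\<^esub> (i' \<cdot>\<^bsub>C\<^esub> w)) = (j \<cdot>\<^bsub>C\<^esub> stop s) \<cdot>\<^bsub>C\<^esub> (i' \<cdot>\<^bsub>C\<^esub> w)"
        using w i' by simp
      also have "\<dots> = (stop s' \<cdot>\<^bsub>C\<^esub> i) \<cdot>\<^bsub>C\<^esub> (i' \<cdot>\<^bsub>C\<^esub> w)" by (simp only: ij)
      finally show "j \<cdot>\<^bsub>C\<^esub> (stop s \<cdot>\<^bsub>C\<^esub> (i' \<cdot>\<^bsub>C\<^esub> w)) = stop s' \<cdot>\<^bsub>C\<^esub> w" using w i' by simp
    qed
    have "stop s \<cdot>\<^bsub>C\<^esub> (i' \<cdot>\<^bsub>C\<^esub> u) = stop s \<cdot>\<^bsub>C\<^esub> (i' \<cdot>\<^bsub>C\<^esub> v)"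
      by (rule iso_arr_mono[OF j(1)]) (use uv i' in \<open>auto simp: top\<close>)
    then have "i' \<cdot>\<^bsub>C\<^esub> u = i' \<cdot>\<^bsub>C\<^esub> v"
      using uv i' by - (rule pullback_square_unique[OF category_axioms s]; simp add: src)
    then have "i \<cdot>\<^bsub>C\<^esub> (i' \<cdot>\<^bsub>C\<^esub> u) = i \<cdot>\<^bsub>C\<^esub> (i' \<cdot>\<^bsub>C\<^esub> v)" by simp
    then show "u = v" using uv by simp
  qed
qed

text \<open>Together with repleteness this makes every pullback of a display map a display map, and
  not just the one supplied by a cartesian lift.\<close>

lemma (in category) pullback_square_ssrc_isomorphic:
  assumes s: "pullback_square C s" and s': "pullback_square C s'"
    and tgt: "stgt s' = stgt s" and bot: "sbot s' = sbot s"
  shows "isomorphic (arrow_cat C) (ssrc s) (ssrc s')"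
proof -
  note [simp] = squares_arrs(1-8)[OF pullback_square_squares[OF s]]
    squares_arrs(1-8)[OF pullback_square_squares[OF s']]
  have cod: "Cod C (ssrc s') = Cod C (ssrc s)" using bot by (metis squares_arrs(7) s s' pullback_square_squares)
  obtain u where u: "u \<in> Arr C" "Dom C u = Dom C (stop s)" "Cod C u = Dom C (ssrc s')"
    "ssrc s' \<cdot>\<^bsub>C\<^esub> u = ssrc s" "stop s' \<cdot>\<^bsub>C\<^esub> u = stop s"
    by (rule pullback_squareE[OF s', of "ssrc s" "stop s"])
      (auto simp: tgt bot cod squares_arrs(9)[OF pullback_square_squares[OF s]])
  obtain v where v: "v \<in> Arr C" "Dom C v = Dom C (stop s')" "Cod C v = Dom C (ssrc s)"
    "ssrc s \<cdot>\<^bsub>C\<^esub> v = ssrc s'" "stop s \<cdot>\<^bsub>C\<^esub> v = stop s'"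
    by (rule pullback_squareE[OF s, of "ssrc s'" "stop s'"])
      (use squares_arrs(9)[OF pullback_square_squares[OF s']] tgt bot cod in auto)
  have "ssrc s \<cdot>\<^bsub>C\<^esub> (v \<cdot>\<^bsub>C\<^esub> u) = (ssrc s \<cdot>\<^bsub>C\<^esub> v) \<cdot>\<^bsub>C\<^esub> u" "stop s \<cdot>\<^bsub>C\<^esub> (v \<cdot>\<^bsub>C\<^esub> u) = (stop s \<cdot>\<^bsub>C\<^esub> v) \<cdot>\<^bsub>C\<^esub> u"
    using u(1-3) v(1-3) by simp_all
  \<comment> \<open>The composite and the identity factor the same cone through
    \<open>s\<close>.\<close>
  then have vu: "v \<cdot>\<^bsub>C\<^esub> u = Id C (Dom C (ssrc s))"
    unfolding v(4,5) u(4,5) using u(1-3) v(1-3)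
    by - (rule pullback_square_unique[OF category_axioms s]; simp)
  have "ssrc s' \<cdot>\<^bsub>C\<^esub> (u \<cdot>\<^bsub>C\<^esub> v) = (ssrc s' \<cdot>\<^bsub>C\<^esub> u) \<cdot>\<^bsub>C\<^esub> v" "stop s' \<cdot>\<^bsub>C\<^esub> (u \<cdot>\<^bsub>C\<^esub> v) = (stop s' \<cdot>\<^bsub>C\<^esub> u) \<cdot>\<^bsub>C\<^esub> v"
    using u(1-3) v(1-3) by simp_all
  then have uv: "u \<cdot>\<^bsub>C\<^esub> v = Id C (Dom C (ssrc s'))"
    unfolding v(4,5) u(4,5) using u(1-3) v(1-3)
    by - (rule pullback_square_unique[OF category_axioms s']; simp)
  have iso: "iso_arr C u" by (rule iso_arrI[where g = v]) (use u v vu uv in auto)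
  let ?q = "Sq (ssrc s) (ssrc s') u (Id C (Cod C (ssrc s)))"
  have q: "?q \<in> squares C" by (rule squaresI) (use u cod in auto)
  show ?thesis
    by (rule isomorphicI[of _ ?q]) (use q iso in \<open>auto simp: arrow_cat_simps intro!: iso_arr_arrow_catI iso_arr_Id\<close>)
qed

section \<open>Full subcategories of the arrow category\<close>

text \<open>Covers both the total category of a given comprehension category and the one built from
  a clan, so that cartesian arrows are analysed once.\<close>

locale arrow_subcat = category C for C :: "('o, 'm) cat" +
  fixes D :: "'m set" and T :: "('m, 'm sq) cat" and p :: "('m, 'm sq, 'o, 'm) ftor"
  assumes D_Arr: "D \<subseteq> Arr C"
    and T_eq: "T = full_subcat (arrow_cat C) D"
    and p_eq: "p = comp_ftor T (cod_ftor C) (id_ftor T)"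
begin

lemma T_Obj: "Obj T = D"
  using D_Arr by (auto simp: T_eq full_subcat_simps arrow_cat_simps)

lemma T_Arr: "s \<in> Arr T \<longleftrightarrow> s \<in> squares C \<and> ssrc s \<in> D \<and> stgt s \<in> D"
  by (auto simp: T_eq full_subcat_simps arrow_cat_simps)

lemma T_Dom: "s \<in> Arr T \<Longrightarrow> Dom T s = ssrc s"
  and T_Cod: "s \<in> Arr T \<Longrightarrow> Cod T s = stgt s"
  by (auto simp: T_eq full_subcat_simps arrow_cat_simps)

lemma T_hom: "s \<in> hom T a b \<longleftrightarrow> s \<in> squares C \<and> ssrc s = a \<and> stgt s = b \<and> a \<in> D \<and> b \<in> D"
  by (auto simp: T_eq hom_full_subcat hom_arrow_cat)

lemma T_Id: "A \<in> D \<Longrightarrow> Id T A = Id (arrow_cat C) A"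
  using D_Arr by (auto simp: T_eq full_subcat_simps arrow_cat_simps)

lemma T_Comp: "\<lbrakk>s \<in> Arr T; t \<in> Arr T\<rbrakk> \<Longrightarrow> t \<cdot>\<^bsub>T\<^esub> s = t \<cdot>\<^bsub>arrow_cat C\<^esub> s"
  by (auto simp: T_eq full_subcat_simps arrow_cat_simps(1-4))

lemma p_fobj: "A \<in> D \<Longrightarrow> fobj p A = Cod C A"
  and p_farr: "s \<in> Arr T \<Longrightarrow> farr p s = sbot s"
  using D_Arr by (auto simp: p_eq T_Obj T_Arr)

lemma is_functor_incl: "is_functor T (arrow_cat C) (id_ftor T)"
  unfolding T_eq by (rule category.is_functor_full_subcat[OF category_arrow_cat])

lemma is_functor_p: "is_functor T C p"
  unfolding p_eq by (rule is_functor_comp[OF is_functor_incl is_functor_cod])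

text \<open>When \<open>D\<close> contains the identities, an object \<open>x\<close> of the base can be tested against by the
  object \<open>Id x\<close> of the subcategory, so cartesian squares are pullbacks.\<close>

lemma cartesian_iff:
  assumes ids: "\<And>x. x \<in> Obj C \<Longrightarrow> Id C x \<in> D"
  shows "cartesian T C p u \<longleftrightarrow> pullback_square C u \<and> ssrc u \<in> D \<and> stgt u \<in> D"
proof
  assume cart: "cartesian T C p u"
  then have u: "u \<in> Arr T" by (simp add: cartesian_def)
  then have u': "u \<in> squares C" "ssrc u \<in> D" "stgt u \<in> D" by (auto simp: T_Arr)
  note [simp] = squares_arrs(1-8)[OF u'(1)]
  have "pullback_square C u"
    unfolding pullback_square_def
  proof (intro conjI allI impI)
    fix x a b assume a: "a \<in> hom C x (Cod C (ssrc u))" and b: "b \<in> hom C x (Dom C (stgt u))"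
      and eq: "sbot u \<cdot>\<^bsub>C\<^esub> a = stgt u \<cdot>\<^bsub>C\<^esub> b"
    then have x: "x \<in> Obj C" by (auto simp: hom_iff)
    \<comment> \<open>The cone \<open>a\<close>, \<open>b\<close> is the same thing as a square from
      \<open>Id C x\<close> to \<open>stgt u\<close> whose bottom edge is factored through
      \<open>sbot u\<close> by \<open>a\<close>.\<close>
    let ?v = "Sq (Id C x) (stgt u) b (sbot u \<cdot>\<^bsub>C\<^esub> a)"
    have v: "?v \<in> squares C"
      using a b eq x by (intro squaresI) (auto simp: hom_iff)
    then have v': "?v \<in> hom T (Id C x) (Cod T u)"
      using u u' x ids by (simp add: T_hom T_Cod)
    have "a \<in> hom C (fobj p (Id C x)) (fobj p (Dom T u))" "farr p u \<cdot>\<^bsub>C\<^esub> a = farr p ?v"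
      using a x ids u u' v by (simp_all add: p_fobj p_farr T_Dom hom_iff T_Arr)
    then have ex1: "\<exists>!w. w \<in> hom T (Id C x) (Dom T u) \<and> farr p w = a \<and> u \<cdot>\<^bsub>T\<^esub> w = ?v"
      using cart v' unfolding cartesian_def by blast
    then obtain w where w: "w \<in> hom T (Id C x) (Dom T u)" "farr p w = a" "u \<cdot>\<^bsub>T\<^esub> w = ?v" by blast
    then have ws: "w \<in> squares C" "ssrc w = Id C x" "stgt w = ssrc u" "w \<in> Arr T"
      using u by (auto simp: T_hom T_Dom T_Arr)
    have wa: "sbot w = a" using w ws by (simp add: p_farr)
    have wb: "stop u \<cdot>\<^bsub>C\<^esub> stop w = b" using w(3) ws u u' by (simp add: T_Comp arrow_cat_simps)
    show "\<exists>!c. c \<in> hom C x (Dom C (ssrc u)) \<and> ssrc u \<cdot>\<^bsub>C\<^esub> c = a \<and> stop u \<cdot>\<^bsub>C\<^esub> c = b"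
    proof (rule ex1I[of _ "stop w"])
      show "stop w \<in> hom C x (Dom C (ssrc u)) \<and> ssrc u \<cdot>\<^bsub>C\<^esub> stop w = a \<and> stop u \<cdot>\<^bsub>C\<^esub> stop w = b"
        using squares_arrs[OF ws(1)] ws x wa wb a by (auto simp: hom_iff)
    next
      fix c assume c: "c \<in> hom C x (Dom C (ssrc u)) \<and> ssrc u \<cdot>\<^bsub>C\<^esub> c = a \<and> stop u \<cdot>\<^bsub>C\<^esub> c = b"
      \<comment> \<open>Any other solution \<open>c\<close> is itself the top edge of a lift of
        \<open>?v\<close>, so uniqueness of lifts applies.\<close>
      let ?w = "Sq (Id C x) (ssrc u) c a"
      have q: "?w \<in> squares C" using c a x by (intro squaresI) (auto simp: hom_iff)
      then have q': "?w \<in> Arr T" using x ids u' by (simp add: T_Arr)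
      have "?w \<in> hom T (Id C x) (Dom T u) \<and> farr p ?w = a \<and> u \<cdot>\<^bsub>T\<^esub> ?w = ?v"
        using q q' u u' c x ids by (auto simp: T_hom T_Dom p_farr T_Comp arrow_cat_simps)
      then have "?w = w" using ex1 w by blast
      then show "c = stop w" by auto
    qed
  qed (rule u')
  then show "pullback_square C u \<and> ssrc u \<in> D \<and> stgt u \<in> D" using u' by simp
next
  assume pb: "pullback_square C u \<and> ssrc u \<in> D \<and> stgt u \<in> D"
  then have u': "u \<in> squares C" "ssrc u \<in> D" "stgt u \<in> D" by (auto simp: pullback_square_def)
  then have u: "u \<in> Arr T" by (simp add: T_Arr)
  note [simp] = squares_arrs(1-8)[OF u'(1)]
  show "cartesian T C p u"
    unfolding cartesian_def
  proof (intro conjI allI ballI impI)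
    fix A v h assume v: "v \<in> hom T A (Cod T u)" and h: "h \<in> hom C (fobj p A) (fobj p (Dom T u))"
      and eq: "farr p u \<cdot>\<^bsub>C\<^esub> h = farr p v"
    then have v': "v \<in> squares C" "ssrc v = A" "stgt v = stgt u" "v \<in> Arr T" and A: "A \<in> D"
      using u by (auto simp: T_hom T_Cod T_Arr)
    note [simp] = squares_arrs(1-8)[OF v'(1)]
    have A': "A \<in> Arr C" using A D_Arr by auto
    have h': "h \<in> Arr C" "Dom C h = Cod C A" "Cod C h = Cod C (ssrc u)"
      using h A u u' by (auto simp: hom_iff p_fobj T_Dom)
    have eq': "sbot u \<cdot>\<^bsub>C\<^esub> h = sbot v" using eq u v' by (simp add: p_farr)
    \<comment> \<open>The factorisation \<open>h\<close> of the bottom edge makes \<open>h\<close>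
      after \<open>A\<close>, together with \<open>stop v\<close>, a cone on \<open>u\<close>; the
      arrow that it induces is the top edge of the lift.\<close>
    have "sbot u \<cdot>\<^bsub>C\<^esub> (h \<cdot>\<^bsub>C\<^esub> A) = (sbot u \<cdot>\<^bsub>C\<^esub> h) \<cdot>\<^bsub>C\<^esub> A" using h' A' by simp
    also have "\<dots> = stgt u \<cdot>\<^bsub>C\<^esub> stop v"
      using squares_arrs(9)[OF v'(1)] v' by (simp add: eq')
    finally have com: "sbot u \<cdot>\<^bsub>C\<^esub> (h \<cdot>\<^bsub>C\<^esub> A) = stgt u \<cdot>\<^bsub>C\<^esub> stop v" .
    obtain c where c: "c \<in> Arr C" "Dom C c = Dom C (stop v)" "Cod C c = Dom C (ssrc u)"
      "ssrc u \<cdot>\<^bsub>C\<^esub> c = h \<cdot>\<^bsub>C\<^esub> A" "stop u \<cdot>\<^bsub>C\<^esub> c = stop v"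
      by (rule pullback_squareE[OF conjunct1[OF pb] _ _ _ _ _ com]) (use h' A' v' in auto)
    let ?w = "Sq A (ssrc u) c h"
    have w: "?w \<in> squares C" using c A' h' v' by (intro squaresI) auto
    then have w': "?w \<in> Arr T" using A u' by (simp add: T_Arr)
    show "\<exists>!w. w \<in> hom T A (Dom T u) \<and> farr p w = h \<and> u \<cdot>\<^bsub>T\<^esub> w = v"
    proof (rule ex1I[of _ ?w])
      have "u \<cdot>\<^bsub>T\<^esub> ?w = v"
        by (rule sq.expand) (use w w' u u' c eq' v' in \<open>simp add: T_Comp arrow_cat_simps\<close>)
      then show "?w \<in> hom T A (Dom T u) \<and> farr p ?w = h \<and> u \<cdot>\<^bsub>T\<^esub> ?w = v"
        using w w' u u' A by (simp add: T_hom T_Dom p_farr)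
    next
      fix z assume z: "z \<in> hom T A (Dom T u) \<and> farr p z = h \<and> u \<cdot>\<^bsub>T\<^esub> z = v"
      then have z': "z \<in> squares C" "ssrc z = A" "stgt z = ssrc u" "z \<in> Arr T"
        using u by (auto simp: T_hom T_Dom T_Arr)
      then have zh: "sbot z = h" and "stop u \<cdot>\<^bsub>C\<^esub> stop z = stop v"
        using z u u' by (auto simp: p_farr T_Comp arrow_cat_simps)
      then have "stop z = c"
        using c z' squares_arrs[OF z'(1)] v'
        by - (rule pullback_square_unique[OF category_axioms conjunct1[OF pb]]; simp)
      then show "z = ?w" using z' zh by (intro sq.expand) simp
    qed
  qed (rule u)
qed

end

section \<open>Clans and their comprehension categories\<close>

definition clan_of :: "('o, 'm, 'm, 'm sq) rcompcat \<Rightarrow> ('o, 'm) rdmc"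
  where "clan_of X = \<lparr> Ucat = Base X, Disp = Obj (Tot X), Term = Root X \<rparr>"

lemma clan_of_simps [simp]:
  "Ucat (clan_of X) = Base X" "Disp (clan_of X) = Obj (Tot X)" "Term (clan_of X) = Root X"
  by (simp_all add: clan_of_def)

locale subcat_cc =
  fixes X :: "('o, 'm, 'm, 'm sq) rcompcat"
  assumes rooted: "rooted_compcat X" and replete: "replete X"
    and closed: "composition_closed X"

sublocale subcat_cc \<subseteq> ccat X
  by unfold_locales (rule rooted_compcat_compr[OF rooted])

context subcat_cc begin

lemma Chi_eq: "Chi X = id_ftor (Tot X)"
  using replete by (simp add: replete_def subcategorical_def)

lemma Tot_eq: "Tot X = full_subcat (arrow_cat (Base X)) (Obj (Tot X))"
proof -
  have "fobj (Chi X) ` Obj (Tot X) = Obj (Tot X)"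
    by (auto simp: Chi_eq)
  then show ?thesis using replete by (simp add: replete_def subcategorical_def)
qed

lemma Tot_Arr_Base: "Obj (Tot X) \<subseteq> Arr (Base X)"
  using fobj_Chi_Arr by (auto simp: Chi_eq)

end

sublocale subcat_cc \<subseteq> A: arrow_subcat "Base X" "Obj (Tot X)" "Tot X" "Proj X"
proof
  show "Tot X = full_subcat (arrow_cat (Base X)) (Obj (Tot X))" by (rule Tot_eq)
  show "Proj X = comp_ftor (Tot X) (cod_ftor (Base X)) (id_ftor (Tot X))"
    using Proj_eq by (simp add: Chi_eq)
qed (rule Tot_Arr_Base)

context subcat_cc begin

lemma Obj_Tot_Arr [simp]: "A \<in> Obj (Tot X) \<Longrightarrow> A \<in> Arr (Base X)"
  using Tot_Arr_Base by auto

lemma Chi_simps [simp]: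
  "A \<in> Obj (Tot X) \<Longrightarrow> fobj (Chi X) A = A"
  "u \<in> Arr (Tot X) \<Longrightarrow> farr (Chi X) u = u"
  by (simp_all add: Chi_eq)

lemma ctx_ext_eq [simp]: "A \<in> Obj (Tot X) \<Longrightarrow> ctx_ext X A = Dom (Base X) A"
  by (simp add: ctx_ext_def)

lemma Proj_simps [simp]:
  "A \<in> Obj (Tot X) \<Longrightarrow> fobj (Proj X) A = Cod (Base X) A"
  "u \<in> Arr (Tot X) \<Longrightarrow> farr (Proj X) u = sbot u"
  by (simp_all add: A.p_fobj A.p_farr)

lemma Id_Tot: "x \<in> Obj (Base X) \<Longrightarrow> Id (Base X) x \<in> Obj (Tot X)"
  and Comp_Tot: "\<lbrakk>f \<in> Obj (Tot X); g \<in> Obj (Tot X); Cod (Base X) f = Dom (Base X) g\<rbrakk>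
    \<Longrightarrow> g \<cdot>\<^bsub>Base X\<^esub> f \<in> Obj (Tot X)"
  using closed by (auto simp: composition_closed_def wide_comp_closed_def)

lemma iso_closed_Tot: "iso_closed (arrow_cat (Base X)) (Obj (Tot X))"
  using replete by (simp add: replete_def)

lemma isomorphic_Tot:
  "\<lbrakk>A \<in> Obj (Tot X); B \<in> Arr (Base X); isomorphic (arrow_cat (Base X)) A B\<rbrakk> \<Longrightarrow> B \<in> Obj (Tot X)"
  using iso_closed_Tot unfolding iso_closed_def arrow_cat_simps by blast

lemma cartesian_iff: "cartesian (Tot X) (Base X) (Proj X) u
    \<longleftrightarrow> pullback_square (Base X) u \<and> ssrc u \<in> Obj (Tot X) \<and> stgt u \<in> Obj (Tot X)"
  by (rule A.cartesian_iff) (rule Id_Tot)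

lemma pullback_exists:
  assumes "B \<in> Obj (Tot X)" "f \<in> Arr (Base X)" "Cod (Base X) f = Cod (Base X) B"
  shows "\<exists>s. pullback_square (Base X) s \<and> ssrc s \<in> Obj (Tot X) \<and> stgt s = B \<and> sbot s = f"
proof -
  have "fibration (Tot X) (Base X) (Proj X)"
    using compr by (simp add: comprehension_category_def)
  then obtain u where u: "cartesian (Tot X) (Base X) (Proj X) u" "Cod (Tot X) u = B" "farr (Proj X) u = f"
    using assms unfolding fibration_def by (metis Proj_simps(1))
  moreover have "u \<in> Arr (Tot X)" using u by (simp add: cartesian_def)
  ultimately show ?thesis using cartesian_iff[of u] by (auto simp: A.T_Cod)
qed

text \<open>The given square need not be the chosen lift, but its source is isomorphic to that of a
  lift of the same base arrow, and repleteness applies.\<close>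

lemma pullback_ssrc:
  assumes s: "pullback_square (Base X) s" and tgt: "stgt s \<in> Obj (Tot X)"
  shows "ssrc s \<in> Obj (Tot X)"
proof -
  note arrs = squares_arrs[OF pullback_square_squares[OF s]]
  obtain s' where s': "pullback_square (Base X) s'" "ssrc s' \<in> Obj (Tot X)" "stgt s' = stgt s" "sbot s' = sbot s"
    using pullback_exists[OF tgt arrs(4)] arrs by auto
  then have "isomorphic (arrow_cat (Base X)) (ssrc s') (ssrc s)"
    using s by (intro Proj.T.pullback_square_ssrc_isomorphic) auto
  then show ?thesis using s' arrs by (auto intro: isomorphic_Tot)
qed

lemma terminal_Root: "terminal (Base X) (Root X)"
  using rooted by (simp add: rooted_compcat_def)

text \<open>Closure under composition collapses the tower of projections from an iterated context
  down to the root into a single display map; the empty tower is an identity.\<close>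

lemma iterated_ctx_Tot:
  "\<Gamma> \<in> iterated_ctx X \<Longrightarrow> \<exists>d \<in> Obj (Tot X). Dom (Base X) d = \<Gamma> \<and> Cod (Base X) d = Root X"
proof (induction rule: iterated_ctx.induct)
  case root
  have "Root X \<in> Obj (Base X)" using terminal_Root by (simp add: terminal_def)
  then show ?case by (intro bexI[of _ "Id (Base X) (Root X)"]) (auto intro: Id_Tot)
next
  case (ext \<Gamma> A)
  then obtain d where d: "d \<in> Obj (Tot X)" "Dom (Base X) d = \<Gamma>" "Cod (Base X) d = Root X" by blast
  with ext show ?case
    by (intro bexI[of _ "d \<cdot>\<^bsub>Base X\<^esub> A"]) (auto intro: Comp_Tot)
qed

lemma rooted_dmc_clan_of: "rooted_dmc (clan_of X)"
proof -
  have "f \<in> composites (Base X) (Obj (Tot X))"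
    if f: "f \<in> Arr (Base X)" "Cod (Base X) f = Root X" for f
  proof -
    have "Dom (Base X) f \<in> Obj (Base X)" using f by simp
    then obtain \<Gamma> e where \<Gamma>: "\<Gamma> \<in> iterated_ctx X"
      and e: "e \<in> hom (Base X) (Dom (Base X) f) \<Gamma>" "iso_arr (Base X) e"
      using rooted unfolding rooted_compcat_def isomorphic_def by blast
    obtain d where d: "d \<in> Obj (Tot X)" "Dom (Base X) d = \<Gamma>" "Cod (Base X) d = Root X"
      using iterated_ctx_Tot[OF \<Gamma>] by blast
    \<comment> \<open>Both are arrows into the root, which is terminal; the right-hand side is a
      display map after an isomorphism.\<close>
    have "f = d \<cdot>\<^bsub>Base X\<^esub> e"
      by (rule Proj.T.terminal_unique[OF terminal_Root]) (use f d e in \<open>auto simp: hom_iff\<close>)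
    then show ?thesis
      using d e by (auto simp: hom_iff intro: composites.intros)
  qed
  then show ?thesis
    using pullback_exists Tot_Arr_Base terminal_Root iso_closed_Tot Proj.T.category_axioms
    by (auto simp: rooted_dmc_def display_map_category_def)
qed

lemma clan_of_Clan: "clan_of X \<in> Cell0 Clan"
  using rooted_dmc_clan_of closed
  by (simp add: Clan_def full_sub2cat_def DMC_rtd_def composition_closed_def)

end

section \<open>From clans to comprehension categories\<close>

definition cc_of :: "('o, 'm) rdmc \<Rightarrow> ('o, 'm, 'm, 'm sq) rcompcat"
  where "cc_of K = (let T = full_subcat (arrow_cat (Ucat K)) (Disp K) in
    \<lparr> Base = Ucat K, Tot = T, Proj = comp_ftor T (cod_ftor (Ucat K)) (id_ftor T), Chi = id_ftor T,
      Root = Term K \<rparr>)"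

lemma cc_of_simps [simp]:
  "Base (cc_of K) = Ucat K" "Tot (cc_of K) = full_subcat (arrow_cat (Ucat K)) (Disp K)"
  "Proj (cc_of K) = comp_ftor (Tot (cc_of K)) (cod_ftor (Ucat K)) (id_ftor (Tot (cc_of K)))"
  "Chi (cc_of K) = id_ftor (Tot (cc_of K))" "Root (cc_of K) = Term K"
  by (simp_all add: cc_of_def Let_def)

text \<open>Only the isomorphisms need an argument: in the arrow category each is isomorphic to the
  identity of its codomain, which lies in \<open>D\<close>.\<close>

lemma (in category) composites_subset:
  assumes D: "D \<subseteq> Arr C" "iso_closed (arrow_cat C) D" "wide_comp_closed C D"
    and f: "f \<in> composites C D"
  shows "f \<in> D"
  using f
proof induction
  case (iso f)
  obtain g where g: "f \<in> Arr C" "g \<in> Arr C" "Dom C g = Cod C f" "Cod C g = Dom C f"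
    "g \<cdot>\<^bsub>C\<^esub> f = Id C (Dom C f)" "f \<cdot>\<^bsub>C\<^esub> g = Id C (Cod C f)" "iso_arr C g"
    using iso_arr_inverse[OF iso] by metis
  let ?s = "Sq (Id C (Cod C f)) f g (Id C (Cod C f))"
  have s: "?s \<in> squares C" by (rule squaresI) (use g in auto)
  have "isomorphic (arrow_cat C) (Id C (Cod C f)) f"
    by (rule isomorphicI[of _ ?s])
      (use s g in \<open>auto simp: arrow_cat_simps intro!: iso_arr_arrow_catI iso_arr_Id\<close>)
  moreover have "Id C (Cod C f) \<in> D" using D g by (simp add: wide_comp_closed_def)
  ultimately show ?case using D g unfolding iso_closed_def arrow_cat_simps by blast
qed (use D in \<open>auto simp: wide_comp_closed_def\<close>)

lemma subcat_cc_cc_of: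
  assumes K: "K \<in> Cell0 Clan" shows "subcat_cc (cc_of K)"
proof -
  let ?C = "Ucat K" and ?D = "Disp K" and ?X = "cc_of K"
  have dmc: "display_map_category K" and wide: "wide_comp_closed ?C ?D"
    and trm: "terminal ?C (Term K)"
    and comps: "\<And>f. \<lbrakk>f \<in> Arr ?C; Cod ?C f = Term K\<rbrakk> \<Longrightarrow> f \<in> composites ?C ?D"
    using K by (auto simp: Clan_def full_sub2cat_def DMC_rtd_def rooted_dmc_def)
  then have C: "category ?C" and D: "?D \<subseteq> Arr ?C" "iso_closed (arrow_cat ?C) ?D"
    by (auto simp: display_map_category_def)
  interpret C: category ?C by (rule C)
  interpret A: arrow_subcat ?C ?D "Tot ?X" "Proj ?X"
    by unfold_locales (simp_all add: D)
  have cart: "cartesian (Tot ?X) ?C (Proj ?X) u \<longleftrightarrow> pullback_square ?C u \<and> ssrc u \<in> ?D \<and> stgt u \<in> ?D" for u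
    using wide by (intro A.cartesian_iff) (simp add: wide_comp_closed_def)
  have "fibration (Tot ?X) ?C (Proj ?X)"
    unfolding fibration_def
  proof (intro conjI ballI impI)
    fix B f assume B: "B \<in> Obj (Tot ?X)" and f: "f \<in> Arr ?C" "Cod ?C f = fobj (Proj ?X) B"
    then have "B \<in> ?D" by (simp only: A.T_Obj)
    moreover from this have "Cod ?C f = Cod ?C B" using f(2) by (simp only: A.p_fobj)
    ultimately obtain s where s: "pullback_square ?C s" "ssrc s \<in> ?D" "stgt s = B" "sbot s = f"
      using dmc f(1) unfolding display_map_category_def by metis
    then have "s \<in> Arr (Tot ?X)"
      using \<open>B \<in> ?D\<close> by (simp only: A.T_Arr pullback_square_squares)
    then show "\<exists>u. cartesian (Tot ?X) ?C (Proj ?X) u \<and> Cod (Tot ?X) u = B \<and> farr (Proj ?X) u = f"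
      using s \<open>B \<in> ?D\<close> by (intro exI[of _ s]) (simp only: cart A.T_Cod A.p_farr)
  qed (rule A.is_functor_p)
  moreover have "pullback_square ?C (farr (Chi ?X) u)" if "cartesian (Tot ?X) ?C (Proj ?X) u" for u
  proof -
    have "u \<in> Arr (Tot ?X)" using that by (simp add: cartesian_def)
    moreover have "pullback_square ?C u" using that by (simp only: cart)
    ultimately show ?thesis by simp
  qed
  ultimately have compr: "comprehension_category ?X"
    using A.is_functor_incl by (simp add: comprehension_category_def)
  have rooted: "rooted_compcat ?X"
    unfolding rooted_compcat_def
  proof (intro conjI ballI)
    fix x assume x: "x \<in> Obj (Base ?X)"
    then obtain f where f: "f \<in> Arr ?C" "Dom ?C f = x" "Cod ?C f = Term K"
      using trm unfolding terminal_def hom_iff by fastforce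
    \<comment> \<open>Since composites collapse into \<open>?D\<close>, the arrow from
      \<open>x\<close> to the root is one display map, and \<open>x\<close> is a context extension
      of length one.\<close>
    then have fD: "f \<in> ?D" using C.composites_subset[OF D wide comps] by blast
    then have "f \<in> Obj (Tot ?X)" "fobj (Proj ?X) f = Root ?X"
      using f by (simp_all add: full_subcat_simps arrow_cat_simps)
    then have "ctx_ext ?X f \<in> iterated_ctx ?X"
      by (rule iterated_ctx.ext[OF iterated_ctx.root])
    moreover have "ctx_ext ?X f = x" using f fD by (simp add: ctx_ext_def full_subcat_simps arrow_cat_simps)
    moreover have "isomorphic ?C x x"
      using x by (intro isomorphicI[OF C.iso_arr_Id]) auto
    ultimately show "\<exists>\<Gamma> \<in> iterated_ctx ?X. isomorphic (Base ?X) x \<Gamma>" by auto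
  qed (use compr trm in simp_all)
  have "fobj (Chi ?X) ` Obj (Tot ?X) = ?D"
    using A.T_Obj by (auto simp: image_def)
  moreover have "full_ftor (Tot ?X) (arrow_cat ?C) (Chi ?X)"
    unfolding full_ftor_def
  proof (intro ballI subsetI)
    fix x y f assume "x \<in> Obj (Tot ?X)" "y \<in> Obj (Tot ?X)"
      "f \<in> hom (arrow_cat (Ucat K)) (fobj (Chi ?X) x) (fobj (Chi ?X) y)"
    then have "f \<in> hom (Tot ?X) x y" by (auto simp: hom_full_subcat full_subcat_simps)
    moreover from this have "farr (Chi ?X) f = f" by (simp add: hom_iff)
    ultimately show "f \<in> farr (Chi ?X) ` hom (Tot ?X) x y" by (metis image_eqI)
  qed
  moreover have "faithful_ftor (Tot ?X) (Chi ?X)"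
    by (auto simp: faithful_ftor_def inj_on_def hom_iff)
  moreover have "inj_on (fobj (Chi ?X)) (Obj (Tot ?X))" by (auto simp: inj_on_def)
  ultimately have "subcategorical ?X" by (simp add: subcategorical_def)
  moreover have "Obj (Tot ?X) = ?D" by (rule A.T_Obj)
  ultimately show ?thesis
    using rooted wide D(2) by unfold_locales (simp_all add: replete_def composition_closed_def)
qed

lemma subcat_cc_iff: "subcat_cc X \<longleftrightarrow> X \<in> Cell0 CompCat_rtd_repl_compcl"
  by (auto simp: subcat_cc_def CompCat_rtd_repl_compcl_def full_sub2cat_def CompCat_rtd_def)

lemma bij_clan_of:
  "bij_betw clan_of (Cell0 (CompCat_rtd_repl_compcl :: ('o, 'm) subcat_CompCat))
    (Cell0 (Clan :: ('o, 'm) DMC_2cat))"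
proof (rule bij_betw_byWitness[where f' = cc_of]; clarify?)
  fix X :: "('o, 'm, 'm, 'm sq) rcompcat" assume "X \<in> Cell0 CompCat_rtd_repl_compcl"
  then interpret X: subcat_cc X by (simp add: subcat_cc_iff)
  have "cc_of (clan_of X) = X"
    by (rule rcompcat.equality)
      (simp_all add: X.Chi_eq X.A.p_eq flip: X.Tot_eq)
  then show "cc_of (clan_of X) = X" .
  show "clan_of X \<in> Cell0 Clan" by (rule X.clan_of_Clan)
next
  fix K :: "('o, 'm) rdmc" assume K: "K \<in> Cell0 Clan"
  then interpret X: subcat_cc "cc_of K" by (rule subcat_cc_cc_of)
  have "Disp K \<subseteq> Arr (Ucat K)"
    using K by (auto simp: Clan_def full_sub2cat_def DMC_rtd_def rooted_dmc_def display_map_category_def)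
  then have "Obj (Tot (cc_of K)) = Disp K" by (auto simp: full_subcat_simps arrow_cat_simps)
  then show "clan_of (cc_of K) = K"
    by (intro rdmc.equality) (simp_all del: cc_of_simps(2))
  show "cc_of K \<in> Cell0 CompCat_rtd_repl_compcl"
    using X.subcat_cc_axioms by (simp add: subcat_cc_iff)
qed

section \<open>Corestriction to full subcategories, and inverses of natural transformations\<close>

lemma is_functor_corestrict:
  assumes "is_functor B C G" "\<And>x. x \<in> Obj B \<Longrightarrow> fobj G x \<in> S"
  shows "is_functor B (full_subcat C S) G"
proof -
  interpret G: func B C G by unfold_locales fact
  \<comment> \<open>The record \<open>G\<close> itself serves, since it does not store a codomain
    category.\<close>
  show ?thesis
    by (rule is_functorI)
      (auto simp: full_subcat_simps assms(2) G.S.category_axioms G.T.category_full_subcat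
        G.fobj_ext G.farr_ext)
qed

lemma nat_trans_corestrict:
  assumes "nat_trans B C F G \<alpha>" "\<And>x. x \<in> Obj B \<Longrightarrow> fobj F x \<in> S" "\<And>x. x \<in> Obj B \<Longrightarrow> fobj G x \<in> S"
  shows "nat_trans B (full_subcat C S) F G \<alpha>"
proof -
  interpret a: ntrans B C F G \<alpha> by unfold_locales fact
  show ?thesis
    by (rule nat_transI)
      (auto simp: full_subcat_simps assms(2,3) a.ext a.naturality
        intro: is_functor_corestrict a.F.is_functor a.G.is_functor)
qed

text \<open>Naturality of the pointwise inverses follows by composing the naturality square of
  \<open>\<alpha>\<close> with them on both sides. The comparison \<open>Phi M\<close> of a pseudo
  map is inverted in this way.\<close>

lemma nat_trans_inverse:
  assumes "nat_trans C D F G \<alpha>" and iso: "\<And>x. x \<in> Obj C \<Longrightarrow> iso_arr D (\<alpha> x)"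
  obtains \<beta> where "nat_trans C D G F \<beta>"
    "\<And>x. x \<in> Obj C \<Longrightarrow> \<beta> x \<cdot>\<^bsub>D\<^esub> \<alpha> x = Id D (fobj F x)"
    "\<And>x. x \<in> Obj C \<Longrightarrow> \<alpha> x \<cdot>\<^bsub>D\<^esub> \<beta> x = Id D (fobj G x)"
proof -
  interpret a: ntrans C D F G \<alpha> by unfold_locales fact
  have "\<exists>b. b \<in> Arr D \<and> Dom D b = fobj G x \<and> Cod D b = fobj F x \<and>
      b \<cdot>\<^bsub>D\<^esub> \<alpha> x = Id D (fobj F x) \<and> \<alpha> x \<cdot>\<^bsub>D\<^esub> b = Id D (fobj G x)" if "x \<in> Obj C" for x
    using iso[OF that] that by (rule_tac iso_arrE[OF iso[OF that]]) auto
  then obtain b where b: "\<And>x. x \<in> Obj C \<Longrightarrow> b x \<in> Arr D" "\<And>x. x \<in> Obj C \<Longrightarrow> Dom D (b x) = fobj G x"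
      "\<And>x. x \<in> Obj C \<Longrightarrow> Cod D (b x) = fobj F x" "\<And>x. x \<in> Obj C \<Longrightarrow> b x \<cdot>\<^bsub>D\<^esub> \<alpha> x = Id D (fobj F x)"
      "\<And>x. x \<in> Obj C \<Longrightarrow> \<alpha> x \<cdot>\<^bsub>D\<^esub> b x = Id D (fobj G x)" by metis
  note [simp] = b(1-3)
  have "nat_trans C D G F (restrict b (Obj C))"
  proof (rule nat_transI)
    fix f assume f: "f \<in> Arr C"
    let ?x = "Dom C f" and ?y = "Cod C f"
    have "b ?y \<cdot>\<^bsub>D\<^esub> farr G f = b ?y \<cdot>\<^bsub>D\<^esub> (farr G f \<cdot>\<^bsub>D\<^esub> (\<alpha> ?x \<cdot>\<^bsub>D\<^esub> b ?x))"
      using f by (simp add: b(5))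
    also have "\<dots> = b ?y \<cdot>\<^bsub>D\<^esub> (\<alpha> ?y \<cdot>\<^bsub>D\<^esub> (farr F f \<cdot>\<^bsub>D\<^esub> b ?x))"
      using f by (simp add: a.naturality')
    also have "\<dots> = (b ?y \<cdot>\<^bsub>D\<^esub> \<alpha> ?y) \<cdot>\<^bsub>D\<^esub> (farr F f \<cdot>\<^bsub>D\<^esub> b ?x)"
      using f by simp
    also have "\<dots> = farr F f \<cdot>\<^bsub>D\<^esub> b ?x"
      using f by (simp add: b(4) del: a.F.T.Comp_assoc')
    finally show "restrict b (Obj C) ?y \<cdot>\<^bsub>D\<^esub> farr G f = farr F f \<cdot>\<^bsub>D\<^esub> restrict b (Obj C) ?x"
      using f by simp
  qed (auto simp: a.F.is_functor a.G.is_functor)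
  then show thesis by (rule that) (auto simp: b(4,5))
qed

section \<open>Maps of clans and maps of comprehension categories\<close>

text \<open>Here \<open>M\<close> is a pseudo map: both the forgetful 2-functor and the comparison
  of pseudo with strict maps draw on these facts.\<close>

locale subcat_map = X: subcat_cc X + Y: subcat_cc Y + rmap X Y M
  for X Y :: "('o, 'm, 'm, 'm sq) rcompcat" and M
begin

text \<open>\<open>Phi M A\<close> is an isomorphism in the arrow category from the display map
  \<open>fobj (TotF M) A\<close>, and display maps are closed under isomorphism.\<close>

lemma stgt_Phi_Tot: "A \<in> Obj (Tot X) \<Longrightarrow> farr (BaseF M) A \<in> Obj (Tot Y)"
  by (rule Y.isomorphic_Tot[OF T.fobj_Obj[of A] _ isomorphicI[OF iso_arr_Phi[of A]]])
    (simp_all add: arrow_cat_simps)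

text \<open>With an identity as bottom edge, the square \<open>Phi M A\<close> degenerates to a
  triangle.\<close>

lemma Phi_triangle: "A \<in> Obj (Tot X) \<Longrightarrow> farr (BaseF M) A \<cdot>\<^bsub>Base Y\<^esub> stop (Phi M A) = fobj (TotF M) A"
  using squares_arrs(9)[OF Phi_square[of A]] fobj_Proj_TotF[of A]
  by (simp del: fobj_Proj_TotF)

text \<open>Such a square is cartesian, so its image under \<open>TotF M\<close> is a pullback. The
  components of \<open>Phi M\<close> at its two ends carry this pullback to the image of
  \<open>s\<close> under \<open>BaseF M\<close>.\<close>

lemma BaseF_pullback:
  assumes s: "pullback_square (Base X) s" and tgt: "stgt s \<in> Obj (Tot X)"
  shows "pullback_square (Base Y) (map_sq (farr (BaseF M)) s)"
proof -
  have src: "ssrc s \<in> Obj (Tot X)" by (rule X.pullback_ssrc[OF s tgt])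
  have s': "s \<in> squares (Base X)" by (rule pullback_square_squares[OF s])
  have sT: "s \<in> Arr (Tot X)" using s' src tgt by (simp add: X.A.T_Arr)
  have tT: "farr (TotF M) s \<in> Arr (Tot Y)" using sT by simp
  have "cartesian (Tot X) (Base X) (Proj X) s" using s src tgt by (simp add: X.cartesian_iff)
  then have t: "pullback_square (Base Y) (farr (TotF M) s)"
    using cartesian_TotF Y.cartesian_iff by blast
  have bot: "sbot (farr (TotF M) s) = farr (BaseF M) (sbot s)"
    using farr_Proj_TotF[OF sT] sT by (simp del: farr_Proj_TotF)
  have ends: "ssrc (farr (TotF M) s) = fobj (TotF M) (ssrc s)" "stgt (farr (TotF M) s) = fobj (TotF M) (stgt s)"
    using T.Dom_farr[OF sT] T.Cod_farr[OF sT] sT tT by (simp_all add: X.A.T_Dom X.A.T_Cod Y.A.T_Dom Y.A.T_Cod)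
  show ?thesis
    by (rule Y.Proj.T.pullback_square_iso[OF t, where i = "stop (Phi M (ssrc s))" and j = "stop (Phi M (stgt s))"])
      (use s' src tgt bot ends sT tT stop_Phi_naturality[OF sT] in
        \<open>simp_all add: sq.map_sel Phi_triangle iso_arr_stop_Phi X.A.T_Dom X.A.T_Cod\<close>)
qed

text \<open>Any terminal object is isomorphic to \<open>Root X\<close>, and \<open>RootIso M\<close>
  links the image of \<open>Root X\<close> to the terminal object \<open>Root Y\<close>.\<close>

lemma BaseF_terminal:
  assumes t: "terminal (Base X) t" shows "terminal (Base Y) (fobj (BaseF M) t)"
proof -
  obtain f where f: "f \<in> Arr (Base X)" "Dom (Base X) f = t" "Cod (Base X) f = Root X"
    using t X.terminal_Root unfolding terminal_def hom_iff by metis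
  then have "iso_arr (Base X) f" using X.Proj.T.terminal_iso t X.terminal_Root by blast
  then have "iso_arr (Base Y) (RootIso M \<cdot>\<^bsub>Base Y\<^esub> farr (BaseF M) f)"
    using f by (intro Y.Proj.T.iso_arr_Comp B.iso_arr_farr) simp_all
  then show ?thesis
    by (rule Y.Proj.T.terminal_isomorphic[OF Y.terminal_Root]) (use f in simp_all)
qed

lemma dmc_map_BaseF: "dmc_map (clan_of X) (clan_of Y) (BaseF M)"
  using stgt_Phi_Tot BaseF_pullback BaseF_terminal B.is_functor by (simp add: dmc_map_def)

end

text \<open>The inverse of forgetting on 1-cells. As \<open>Chi Y\<close> is an inclusion,
  strictness leaves no choice for \<open>TotF\<close> and \<open>Phi\<close>; terminality of
  \<open>Root Y\<close> leaves none for \<open>RootIso\<close>, hence the definite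
  description.\<close>

definition cc_map_of :: "('o, 'm, 'm, 'm sq) rcompcat \<Rightarrow> ('o, 'm, 'm, 'm sq) rcompcat \<Rightarrow>
    ('o, 'm, 'o, 'm) ftor \<Rightarrow> ('o, 'm, 'm, 'm sq) rccmap"
  where "cc_map_of X Y F = (let T = comp_ftor (Tot X) (arrow_ftor (Base X) F) (Chi X) in
    \<lparr> BaseF = F, TotF = T, Phi = id_nat (Tot X) (arrow_cat (Base Y)) T,
      RootIso = (THE r. r \<in> hom (Base Y) (fobj F (Root X)) (Root Y)) \<rparr>)"

lemma cc_map_of_simps [simp]:
  "BaseF (cc_map_of X Y F) = F"
  "TotF (cc_map_of X Y F) = comp_ftor (Tot X) (arrow_ftor (Base X) F) (Chi X)"
  "Phi (cc_map_of X Y F) = id_nat (Tot X) (arrow_cat (Base Y)) (TotF (cc_map_of X Y F))"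
  by (simp_all add: cc_map_of_def Let_def)

locale clan_map = X: subcat_cc X + Y: subcat_cc Y
  for X Y :: "('o, 'm, 'm, 'm sq) rcompcat" +
  fixes F assumes dmc_map: "dmc_map (clan_of X) (clan_of Y) F"

sublocale clan_map \<subseteq> F: func "Base X" "Base Y" F
  using dmc_map by unfold_locales (simp add: dmc_map_def)

context clan_map begin

lemma farr_Tot [simp]: "A \<in> Obj (Tot X) \<Longrightarrow> farr F A \<in> Obj (Tot Y)"
  using dmc_map by (simp add: dmc_map_def)

lemma is_functor_TotF_arrow: "is_functor (Tot X) (arrow_cat (Base Y)) (TotF (cc_map_of X Y F))"
  using is_functor_comp[OF X.Chi.is_functor F.is_functor_arrow] by simp

lemma is_functor_TotF: "is_functor (Tot X) (Tot Y) (TotF (cc_map_of X Y F))"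
  by (subst Y.Tot_eq, rule is_functor_corestrict[OF is_functor_TotF_arrow]) simp

lemma Chi_TotF: "comp_ftor (Tot X) (Chi Y) (TotF (cc_map_of X Y F)) = TotF (cc_map_of X Y F)"
  unfolding Y.Chi_eq by (rule comp_ftor_id_left[OF is_functor_TotF])

lemma pseudo_map_cc_map_of: "pseudo_map X Y (cc_map_of X Y F)"
proof (rule pseudo_mapI)
  show "is_functor (Tot X) (Tot Y) (TotF (cc_map_of X Y F))" by (rule is_functor_TotF)
  show "nat_trans (Tot X) (arrow_cat (Base Y)) (comp_ftor (Tot X) (Chi Y) (TotF (cc_map_of X Y F)))
      (comp_ftor (Tot X) (arrow_ftor (Base X) (BaseF (cc_map_of X Y F))) (Chi X)) (Phi (cc_map_of X Y F))"
    using nat_trans_id[OF is_functor_TotF_arrow] unfolding Chi_TotF by simp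
  \<comment> \<open>On both sides cartesian means pullback square between display maps, and
    \<open>F\<close> preserves these.\<close>
  show "cartesian (Tot Y) (Base Y) (Proj Y) (farr (TotF (cc_map_of X Y F)) u)"
    if u: "cartesian (Tot X) (Base X) (Proj X) u" for u
  proof -
    have "u \<in> Arr (Tot X)" using u by (simp add: cartesian_def)
    then show ?thesis
      using u dmc_map
      by (simp add: X.cartesian_iff Y.cartesian_iff dmc_map_def sq.map_sel X.A.T_Arr)
  qed
  show "iso_arr (arrow_cat (Base Y)) (Phi (cc_map_of X Y F) A)" if A: "A \<in> Obj (Tot X)" for A
  proof -
    have "Phi (cc_map_of X Y F) A = Id (arrow_cat (Base Y)) (farr F A)" using A by simp
    then show ?thesis using A by (simp only:) (simp add: Y.Chi.T.iso_arr_Id arrow_cat_simps(1))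
  qed
qed (auto simp: X.compr Y.compr F.is_functor arrow_cat_simps X.A.T_Arr sq.map_sel Y.A.T_Arr Y.A.p_farr)

lemma strict_map_cc_map_of: "strict_map X Y (cc_map_of X Y F)"
  using pseudo_map_cc_map_of Chi_TotF by (simp add: strict_map_def)

lemma terminal_F_Root: "terminal (Base Y) (fobj F (Root X))"
  using dmc_map X.terminal_Root by (simp add: dmc_map_def)

lemma rooted_map_cc_map_of: "rooted_map X Y (cc_map_of X Y F)"
proof -
  have "\<exists>!r. r \<in> hom (Base Y) (fobj F (Root X)) (Root Y)"
    using terminal_F_Root Y.terminal_Root by (simp add: terminal_def)
  then have r: "RootIso (cc_map_of X Y F) \<in> hom (Base Y) (fobj F (Root X)) (Root Y)"
    unfolding cc_map_of_def Let_def by (simp, rule theI')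
  moreover from this have "iso_arr (Base Y) (RootIso (cc_map_of X Y F))"
    using Y.Proj.T.terminal_iso[OF terminal_F_Root Y.terminal_Root] by (simp add: hom_iff)
  ultimately show ?thesis using pseudo_map_cc_map_of by (simp add: rooted_map_def)
qed

end

context subcat_map begin

lemma clan_map_BaseF: "clan_map X Y (BaseF M)"
  by unfold_locales (rule dmc_map_BaseF)

text \<open>Both are arrows into a terminal object. Strictness of \<open>M\<close> is not assumed,
  so that a pseudo map and its strict replacement can be compared by a 2-cell with identity base
  component.\<close>

lemma RootIso_eq: "RootIso M = RootIso (cc_map_of X Y (BaseF M))"
proof -
  interpret c: clan_map X Y "BaseF M" by (rule clan_map_BaseF)
  show ?thesis
    using rooted_map_RootIso[OF c.rooted_map_cc_map_of]
    by (intro Y.Proj.T.terminal_unique[OF Y.terminal_Root]) simp_all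
qed

lemma Chi_TotF: "comp_ftor (Tot X) (Chi Y) (TotF M) = TotF M"
  unfolding Y.Chi_eq by (rule comp_ftor_id_left[OF T.is_functor])

lemma strict_eq:
  assumes "strict_map X Y M" shows "M = cc_map_of X Y (BaseF M)"
proof -
  have "TotF M = comp_ftor (Tot X) (arrow_ftor (Base X) (BaseF M)) (Chi X)"
    "Phi M = id_nat (Tot X) (arrow_cat (Base Y)) (TotF M)"
    using assms by (simp_all add: strict_map_def Chi_TotF)
  then show ?thesis
    using RootIso_eq by (intro rccmap.equality) simp_all
qed

end

text \<open>A transformation of strict maps is determined by its base component: both edges of the square
  \<open>snd a A\<close> are prescribed.\<close>

definition lift_nat :: "('o, 'm, 'm, 'm sq) rcompcat \<Rightarrow> ('o, 'm, 'o, 'm) ftor \<Rightarrow> ('o, 'm, 'o, 'm) ftor \<Rightarrow>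
    ('o \<Rightarrow> 'm) \<Rightarrow> 'm \<Rightarrow> 'm sq"
  where "lift_nat X F G \<alpha> = (\<lambda>A \<in> Obj (Tot X).
    Sq (farr F A) (farr G A) (\<alpha> (Dom (Base X) A)) (\<alpha> (Cod (Base X) A)))"

text \<open>The square at \<open>A\<close> commutes by naturality of \<open>\<alpha>\<close> at the
  arrow \<open>A\<close> itself, and naturality of the lift at \<open>u\<close> is naturality of
  \<open>\<alpha>\<close> at the two edges of \<open>u\<close>. The comparisons of
  \<open>cc_map_of\<close> are identities, so compatibility with comprehension is immediate.\<close>

lemma rooted_transformation_lift:
  assumes "clan_map X Y F" "clan_map X Y G" and \<alpha>: "nat_trans (Base X) (Base Y) F G \<alpha>"
  shows "rooted_transformation X Y (cc_map_of X Y F) (cc_map_of X Y G) (\<alpha>, lift_nat X F G \<alpha>)"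
proof -
  interpret X: subcat_cc X using assms(1) by (simp add: clan_map_def)
  interpret Y: subcat_cc Y using assms(1) by (simp add: clan_map_def)
  interpret F: clan_map X Y F by fact
  interpret G: clan_map X Y G by fact
  interpret a: ntrans "Base X" "Base Y" F G \<alpha> by unfold_locales fact
  note r = rooted_map_RootIso[OF F.rooted_map_cc_map_of] rooted_map_RootIso[OF G.rooted_map_cc_map_of]
  have sq: "lift_nat X F G \<alpha> A \<in> squares (Base Y)" if "A \<in> Obj (Tot X)" for A
    using that by (intro squaresI) (simp_all add: lift_nat_def a.naturality)
  have "nat_trans (Tot X) (arrow_cat (Base Y)) (TotF (cc_map_of X Y F)) (TotF (cc_map_of X Y G)) (lift_nat X F G \<alpha>)"
  proof (rule nat_transI[OF F.is_functor_TotF_arrow G.is_functor_TotF_arrow])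
    fix u assume u: "u \<in> Arr (Tot X)"
    then have u': "u \<in> squares (Base X)" "ssrc u \<in> Obj (Tot X)" "stgt u \<in> Obj (Tot X)"
      by (simp_all add: X.A.T_Arr)
    note [simp] = squares_arrs(1-8)[OF u'(1)]
    have "lift_nat X F G \<alpha> (stgt u) \<cdot>\<^bsub>arrow_cat (Base Y)\<^esub> map_sq (farr F) u
        = map_sq (farr G) u \<cdot>\<^bsub>arrow_cat (Base Y)\<^esub> lift_nat X F G \<alpha> (ssrc u)"
      using u' sq[OF u'(2)] sq[OF u'(3)]
      by (simp add: arrow_cat_simps lift_nat_def sq.map_sel a.naturality)
    then show "lift_nat X F G \<alpha> (Cod (Tot X) u) \<cdot>\<^bsub>arrow_cat (Base Y)\<^esub> farr (TotF (cc_map_of X Y F)) u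
        = farr (TotF (cc_map_of X Y G)) u \<cdot>\<^bsub>arrow_cat (Base Y)\<^esub> lift_nat X F G \<alpha> (Dom (Tot X) u)"
      using u u' by (simp add: X.A.T_Dom X.A.T_Cod)
  next
    fix A assume A: "A \<in> Obj (Tot X)"
    then show "lift_nat X F G \<alpha> A \<in> Arr (arrow_cat (Base Y)) \<and>
        Dom (arrow_cat (Base Y)) (lift_nat X F G \<alpha> A) = fobj (TotF (cc_map_of X Y F)) A \<and>
        Cod (arrow_cat (Base Y)) (lift_nat X F G \<alpha> A) = fobj (TotF (cc_map_of X Y G)) A"
      using sq[OF A] by (simp add: arrow_cat_simps) (simp add: lift_nat_def)
  qed (simp add: lift_nat_def)
  then have t: "nat_trans (Tot X) (Tot Y) (TotF (cc_map_of X Y F)) (TotF (cc_map_of X Y G)) (lift_nat X F G \<alpha>)"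
    by (subst Y.Tot_eq) (rule nat_trans_corestrict, simp_all)
  then interpret t: ntrans "Tot X" "Tot Y" "TotF (cc_map_of X Y F)" "TotF (cc_map_of X Y G)" "lift_nat X F G \<alpha>"
    by unfold_locales
  \<comment> \<open>Both sides are arrows into the terminal object \<open>Root Y\<close>.\<close>
  have "RootIso (cc_map_of X Y G) \<cdot>\<^bsub>Base Y\<^esub> \<alpha> (Root X) = RootIso (cc_map_of X Y F)"
    using r X.terminal_Root by (intro Y.Proj.T.terminal_unique[OF Y.terminal_Root]) (simp_all add: terminal_def)
  then show ?thesis
    using \<alpha> t t.Arr
    by (simp add: rooted_transformation_iff arrow_cat_simps) (simp add: lift_nat_def)
qed

lemma rooted_transformation_eqI:
  assumes "subcat_cc X" "subcat_cc Y"
    and "rooted_map X Y M" "rooted_map X Y N" and N: "strict_map X Y N"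
    and a: "rooted_transformation X Y M N a" and b: "rooted_transformation X Y M N b"
    and fst: "fst a = fst b"
  shows "a = b"
proof -
  interpret X: subcat_cc X by fact
  interpret Y: subcat_cc Y by fact
  interpret a: rtrans X Y M N a using assms X.rooted Y.rooted by unfold_locales
  interpret b: rtrans X Y M N b using assms X.rooted Y.rooted by unfold_locales
  have "snd a = snd b"
  proof (rule nat_trans_eqI[OF a.t.nat_trans b.t.nat_trans])
    fix A assume A: "A \<in> Obj (Tot X)"
    have sq: "snd a A \<in> squares (Base Y)" "snd b A \<in> squares (Base Y)"
      using a.t.Arr[OF A] b.t.Arr[OF A] by (simp_all add: Y.A.T_Arr del: a.t.Arr b.t.Arr)
    have ends: "ssrc (snd a A) = fobj (TotF M) A" "ssrc (snd b A) = fobj (TotF M) A"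
      "stgt (snd a A) = fobj (TotF N) A" "stgt (snd b A) = fobj (TotF N) A"
      using a.t.Dom[OF A] b.t.Dom[OF A] a.t.Cod[OF A] b.t.Cod[OF A] A
      by (simp_all add: Y.A.T_Dom Y.A.T_Cod del: a.t.Dom a.t.Cod b.t.Dom b.t.Cod)
    have "sbot (snd a A) = sbot (snd b A)"
      using a.Proj_snd[OF A] b.Proj_snd[OF A] fst A by (simp del: a.Proj_snd b.Proj_snd)
    \<comment> \<open>Compatibility with comprehension fixes the top edge after composition with the
      isomorphism \<open>stop (Phi N A)\<close>, which is then cancelled.\<close>
    moreover have "stop (snd a A) = stop (snd b A)"
      by (rule Y.Proj.T.iso_arr_mono[OF a.N.iso_arr_stop_Phi[OF A]])
        (use A a.Phi_snd[OF A] b.Phi_snd[OF A] fst squares_arrs[OF sq(1)] squares_arrs[OF sq(2)] ends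
          in simp_all)
    ultimately show "snd a A = snd b A" using ends by (intro sq.expand) simp
  qed
  then show ?thesis using fst by (simp add: prod_eq_iff)
qed

text \<open>Because \<open>Chi Y\<close> is an inclusion, \<open>Phi M\<close> is itself a
  transformation from \<open>TotF M\<close> to the total functor of the strict map, and can serve as
  total component over the identity. In this direction compatibility is trivial, as the comparison
  of the strict map is an identity; in the other it says that \<open>\<beta>\<close> is inverse to
  \<open>Phi M\<close>.\<close>

lemma (in subcat_map) isomorphic_cc_map_of:
  "isomorphic (cc_hom X Y) (cc_map_of X Y (BaseF M)) M"
proof -
  let ?S = "cc_map_of X Y (BaseF M)" and ?i = "id_nat (Base X) (Base Y) (BaseF M)"
  interpret S: clan_map X Y "BaseF M" by (rule clan_map_BaseF)
  interpret K: two_category CompCat_rtd by (rule two_category_CompCat_rtd)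
  interpret H: category "cc_hom X Y"
    using K.HomCat_category[of X Y] X.rooted Y.rooted by (simp add: CompCat_rtd_def)
  have P: "nat_trans (Tot X) (arrow_cat (Base Y)) (TotF M) (TotF ?S) (Phi M)"
    using P.nat_trans by (simp add: Chi_TotF)
  obtain \<beta> where \<beta>: "nat_trans (Tot X) (arrow_cat (Base Y)) (TotF ?S) (TotF M) \<beta>"
      "\<And>A. A \<in> Obj (Tot X) \<Longrightarrow> \<beta> A \<cdot>\<^bsub>arrow_cat (Base Y)\<^esub> Phi M A = Id (arrow_cat (Base Y)) (fobj (TotF M) A)"
      "\<And>A. A \<in> Obj (Tot X) \<Longrightarrow> Phi M A \<cdot>\<^bsub>arrow_cat (Base Y)\<^esub> \<beta> A = Id (arrow_cat (Base Y)) (fobj (TotF ?S) A)"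
    using nat_trans_inverse[OF P iso_arr_Phi] by metis
  interpret \<beta>: ntrans "Tot X" "arrow_cat (Base Y)" "TotF ?S" "TotF M" \<beta> by unfold_locales (rule \<beta>)
  have P': "nat_trans (Tot X) (Tot Y) (TotF M) (TotF ?S) (Phi M)"
    by (subst Y.Tot_eq, rule nat_trans_corestrict[OF P]) simp_all
  have \<beta>': "nat_trans (Tot X) (Tot Y) (TotF ?S) (TotF M) \<beta>"
    by (subst Y.Tot_eq, rule nat_trans_corestrict[OF \<beta>(1)]) simp_all
  interpret P': ntrans "Tot X" "Tot Y" "TotF M" "TotF ?S" "Phi M" by unfold_locales (rule P')
  interpret \<beta>': ntrans "Tot X" "Tot Y" "TotF ?S" "TotF M" \<beta> by unfold_locales (rule \<beta>')
  have id: "nat_trans (Base X) (Base Y) (BaseF M) (BaseF M) ?i" by (rule nat_trans_id[OF B.is_functor])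
  have \<beta>_sq: "\<beta> A \<in> squares (Base Y)" "ssrc (\<beta> A) = farr (BaseF M) A" "stgt (\<beta> A) = fobj (TotF M) A"
    if "A \<in> Obj (Tot X)" for A
    using \<beta>.Arr[OF that] \<beta>.Dom[OF that] \<beta>.Cod[OF that] that by (simp_all add: arrow_cat_simps)
  have Cod_TotF: "Cod (Base Y) (fobj (TotF M) A) = fobj (BaseF M) (Cod (Base X) A)" if "A \<in> Obj (Tot X)" for A
    using fobj_Proj_TotF[OF that] that by (simp del: fobj_Proj_TotF)
  \<comment> \<open>An inverse of a square with an identity as bottom edge has an identity there
    too; this lets \<open>\<beta>\<close> lie over \<open>?i\<close>.\<close>
  have \<beta>_bot: "sbot (\<beta> A) = Id (Base Y) (fobj (BaseF M) (Cod (Base X) A))" if A: "A \<in> Obj (Tot X)" for A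
    using \<beta>(2)[OF A] \<beta>_sq[OF A] A squares_arrs[OF \<beta>_sq(1)[OF A]]
    by (simp add: arrow_cat_simps Cod_TotF)
  have \<beta>_top: "stop (Phi M A) \<cdot>\<^bsub>Base Y\<^esub> stop (\<beta> A) = Id (Base Y) (fobj (BaseF M) (Dom (Base X) A))"
    if A: "A \<in> Obj (Tot X)" for A
    using \<beta>(3)[OF A] \<beta>_sq[OF A] A by (simp add: arrow_cat_simps)
  have c: "rooted_transformation X Y M ?S (?i, Phi M)"
    using id P' P'.Arr RootIso_eq rooted_map_RootIso[OF S.rooted_map_cc_map_of]
    by (simp add: rooted_transformation_iff arrow_cat_simps Cod_TotF)
  have d: "rooted_transformation X Y ?S M (?i, \<beta>)"
    using id \<beta>' \<beta>'.Arr RootIso_eq rooted_map_RootIso[OF S.rooted_map_cc_map_of]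
    by (simp add: rooted_transformation_iff arrow_cat_simps \<beta>_bot \<beta>_top)
  have base: "vcomp (Base X) (Base Y) ?i ?i = ?i" by (rule vcomp_id_right[OF id])
  have tot: "vcomp (Tot X) (Tot Y) \<beta> (Phi M) = id_nat (Tot X) (Tot Y) (TotF M)"
    "vcomp (Tot X) (Tot Y) (Phi M) \<beta> = id_nat (Tot X) (Tot Y) (TotF ?S)"
    using \<beta>(2,3) P'.Arr \<beta>'.Arr
    by (auto simp: vcomp_def id_nat_def Y.A.T_Comp Y.A.T_Id simp del: cc_map_of_simps intro!: restrict_ext)
  show ?thesis
  proof (rule isomorphicI[of _ "Cell ?S M (?i, \<beta>)"], rule iso_arrI[where g = "Cell M ?S (?i, Phi M)"])
  qed (use c d base tot rooted_map S.rooted_map_cc_map_of in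
      \<open>simp_all add: cc_hom_cells cell_cat_simps del: cc_map_of_simps(2,3)\<close>)
qed

section \<open>The forgetful 2-functor\<close>

lemma arrow_ftor_id: "category C \<Longrightarrow> arrow_ftor C (id_ftor C) = id_ftor (arrow_cat C)"
  by (rule ftor_eqI[OF func.is_functor_arrow category.is_functor_id])
    (auto simp: arrow_cat_simps map_sq_id_ftor func_def intro: category.category_arrow_cat category.is_functor_id)

lemma strict_map_id: "comprehension_category X \<Longrightarrow> strict_map X X (id_rccmap X)"
proof -
  assume X: "comprehension_category X"
  interpret X: ccat X by unfold_locales (rule X)
  show ?thesis
    using pseudo_map_id[OF X]
    by (simp add: strict_map_def id_rccmap_def comp_ftor_id_right[OF X.Chi.is_functor]
        comp_ftor_id_left[OF X.Chi.is_functor] arrow_ftor_id[OF X.Proj.T.category_axioms])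
qed

text \<open>Both comparisons are identities, and the arrow functor of \<open>BaseF N\<close>
  preserves identities, so the composite comparison is an identity as well.\<close>

lemma (in pmap_pair) strict_map_comp:
  assumes "strict_map X Y M" "strict_map Y Z N"
  shows "strict_map X Z (comp_rccmap X Y Z N M)"
proof -
  let ?c = "comp_rccmap X Y Z N M"
  interpret aN: func "arrow_cat (Base Y)" "arrow_cat (Base Z)" "arrow_ftor (Base Y) (BaseF N)"
    by unfold_locales (rule N.B.is_functor_arrow)
  have M: "fobj (Chi Y) (fobj (TotF M) A) = farr (BaseF M) (fobj (Chi X) A)" if "A \<in> Obj (Tot X)" for A
    using that assms(1) by (auto simp: strict_map_def dest: arg_cong[where f = "\<lambda>F. fobj F A"])
  have N: "fobj (Chi Z) (fobj (TotF N) A) = farr (BaseF N) (fobj (Chi Y) A)" if "A \<in> Obj (Tot Y)" for A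
    using that assms(2) by (auto simp: strict_map_def dest: arg_cong[where f = "\<lambda>F. fobj F A"])
  have M': "farr (Chi Y) (farr (TotF M) u) = map_sq (farr (BaseF M)) (farr (Chi X) u)" if "u \<in> Arr (Tot X)" for u
    using that assms(1) by (auto simp: strict_map_def dest: arg_cong[where f = "\<lambda>F. farr F u"])
  have N': "farr (Chi Z) (farr (TotF N) u) = map_sq (farr (BaseF N)) (farr (Chi Y) u)" if "u \<in> Arr (Tot Y)" for u
    using that assms(2) by (auto simp: strict_map_def dest: arg_cong[where f = "\<lambda>F. farr F u"])
  interpret c: pmap X Z ?c
    by unfold_locales (rule M.X_compr N.Y_compr pseudo_map_comp)+
  have "comp_ftor (Tot X) (Chi Z) (TotF ?c) = comp_ftor (Tot X) (arrow_ftor (Base X) (BaseF ?c)) (Chi X)"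
  proof (rule ftor_eqI[OF c.P.F.is_functor c.P.G.is_functor])
    fix u assume u: "u \<in> Arr (Tot X)"
    then show "farr (comp_ftor (Tot X) (Chi Z) (TotF ?c)) u =
        farr (comp_ftor (Tot X) (arrow_ftor (Base X) (BaseF ?c)) (Chi X)) u"
      by (simp add: N' M' rccmap_ftors map_sq_comp_ftor)
  qed (simp add: M N)
  moreover have "Phi ?c = id_nat (Tot X) (arrow_cat (Base Z)) (comp_ftor (Tot X) (Chi Z) (TotF ?c))"
  proof (rule extensionalityI[where A = "Obj (Tot X)"])
    fix A assume A: "A \<in> Obj (Tot X)"
    have "Phi M A = Id (arrow_cat (Base Y)) (farr (BaseF M) (fobj (Chi X) A))"
      "Phi N (fobj (TotF M) A) = Id (arrow_cat (Base Z)) (farr (BaseF N) (farr (BaseF M) (fobj (Chi X) A)))"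
      using assms A M N by (simp_all add: strict_map_def)
    then show "Phi ?c A = id_nat (Tot X) (arrow_cat (Base Z)) (comp_ftor (Tot X) (Chi Z) (TotF ?c)) A"
      using A by (simp add: comp_rccmap_def N M arrow_cat_simps(1) del: farr_arrow_ftor)
  qed (auto simp: comp_rccmap_def id_nat_def)
  ultimately show ?thesis using pseudo_map_comp by (simp add: strict_map_def)
qed

text \<open>Restricting 0-cells commutes with restricting 1-cells. This puts the strict 2-category
  into the form required by \<open>equivalent_2cat_locally_full\<close>.\<close>

lemma str2_eq_locally_full:
  "CompCat_str2_rtd_repl_compcl = locally_full_sub2cat CompCat_rtd_repl_compcl strict_map"
  by (simp add: CompCat_str2_rtd_repl_compcl_def CompCat_str2_rtd_def CompCat_rtd_repl_compcl_def
      full_sub2cat_def locally_full_sub2cat_def CompCat_rtd_def)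

lemma two_category_pseudo: "two_category CompCat_rtd_repl_compcl"
  unfolding CompCat_rtd_repl_compcl_def
  by (rule two_category_full_sub2cat[OF two_category_CompCat_rtd])

lemma two_category_strict: "two_category CompCat_str2_rtd_repl_compcl"
  unfolding str2_eq_locally_full
proof (rule two_category_locally_full_sub2cat[OF two_category_pseudo])
  fix X :: "('o, 'm, 'm, 'm sq) rcompcat" assume "X \<in> Cell0 CompCat_rtd_repl_compcl"
  then show "strict_map X X (Id1 CompCat_rtd_repl_compcl X)"
    by (simp add: CompCat_rtd_repl_compcl_def full_sub2cat_def CompCat_rtd_def strict_map_id
        rooted_compcat_compr)
next
  fix X Y Z :: "('o, 'm, 'm, 'm sq) rcompcat" and M N
  assume "X \<in> Cell0 CompCat_rtd_repl_compcl" "Y \<in> Cell0 CompCat_rtd_repl_compcl"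
    "Z \<in> Cell0 CompCat_rtd_repl_compcl" "M \<in> Obj (HomCat CompCat_rtd_repl_compcl X Y)"
    "N \<in> Obj (HomCat CompCat_rtd_repl_compcl Y Z)" and strict: "strict_map X Y M" "strict_map Y Z N"
  then have "pmap X Y M" "pmap Y Z N"
    by (auto simp: CompCat_rtd_repl_compcl_def full_sub2cat_def CompCat_rtd_def cc_hom_cells
        cell_cat_simps intro: rooted_map_pmap)
  then interpret pmap_pair X Y Z M N by (rule pmap_pair.intro)
  show "strict_map X Z (Comp1 CompCat_rtd_repl_compcl X Y Z N M)"
    using strict_map_comp[OF strict]
    by (simp add: CompCat_rtd_repl_compcl_def full_sub2cat_def CompCat_rtd_def)
qed

lemma strict_2cat_simps:
  "X \<in> Cell0 CompCat_str2_rtd_repl_compcl \<longleftrightarrow> subcat_cc X"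
  "M \<in> Obj (HomCat CompCat_str2_rtd_repl_compcl X Y) \<longleftrightarrow> rooted_map X Y M \<and> strict_map X Y M"
  "c \<in> Arr (HomCat CompCat_str2_rtd_repl_compcl X Y) \<longleftrightarrow>
    rooted_map X Y (csrc c) \<and> strict_map X Y (csrc c) \<and> rooted_map X Y (ctgt c) \<and> strict_map X Y (ctgt c) \<and>
    rooted_transformation X Y (csrc c) (ctgt c) (ccomp c)"
  "HomCat CompCat_str2_rtd_repl_compcl X Y = full_subcat (cc_hom X Y) {M. strict_map X Y M}"
  "Id1 CompCat_str2_rtd_repl_compcl = id_rccmap"
  "Comp1 CompCat_str2_rtd_repl_compcl = comp_rccmap"
  "Comp2 CompCat_str2_rtd_repl_compcl X Y Z b a =
    Cell (comp_rccmap X Y Z (csrc b) (csrc a)) (comp_rccmap X Y Z (ctgt b) (ctgt a))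
      (hcomp (Base X) (Base Z) (BaseF (csrc b)) (BaseF (ctgt a)) (fst (ccomp b)) (fst (ccomp a)),
       hcomp (Tot X) (Tot Z) (TotF (csrc b)) (TotF (ctgt a)) (snd (ccomp b)) (snd (ccomp a)))"
  by (auto simp: CompCat_str2_rtd_repl_compcl_def CompCat_str2_rtd_def full_sub2cat_def
      locally_full_sub2cat_def CompCat_rtd_def subcat_cc_def full_subcat_simps cc_hom_cells cell_cat_simps)

text \<open>The abstractions are bounded because a functor between hom-categories must be
  \<open>undefined\<close> outside its domain.\<close>

definition forget :: "(('o, 'm, 'm, 'm sq) rcompcat, ('o, 'm, 'm, 'm sq) rccmap, ('o, 'm, 'm, 'm sq) cc_2cell,
    ('o, 'm) rdmc, ('o, 'm, 'o, 'm) ftor, ('o, 'm) dmc_2cell) twoftor"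
  where "forget = \<lparr> On0 = clan_of, OnHom = (\<lambda>X Y. let H = HomCat CompCat_str2_rtd_repl_compcl X Y in
    \<lparr> fobj = (\<lambda>M \<in> Obj H. BaseF M),
      farr = (\<lambda>c \<in> Arr H. Cell (BaseF (csrc c)) (BaseF (ctgt c)) (fst (ccomp c))) \<rparr>) \<rparr>"

lemma forget_simps:
  "On0 forget = clan_of"
  "M \<in> Obj (HomCat CompCat_str2_rtd_repl_compcl X Y) \<Longrightarrow> fobj (OnHom forget X Y) M = BaseF M"
  "c \<in> Arr (HomCat CompCat_str2_rtd_repl_compcl X Y) \<Longrightarrow>
    farr (OnHom forget X Y) c = Cell (BaseF (csrc c)) (BaseF (ctgt c)) (fst (ccomp c))"
  by (simp_all add: forget_def Let_def)

section \<open>Forgetting is a 2-functor\<close>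

lemma Clan_simps:
  "HomCat Clan = dmc_hom" "Id1 Clan = (\<lambda>X. id_ftor (Ucat X))"
  "Comp1 Clan = (\<lambda>X Y Z G F. comp_ftor (Ucat X) G F)"
  "Comp2 Clan X Y Z b a = Cell (comp_ftor (Ucat X) (csrc b) (csrc a)) (comp_ftor (Ucat X) (ctgt b) (ctgt a))
    (hcomp (Ucat X) (Ucat Z) (csrc b) (ctgt a) (ccomp b) (ccomp a))"
  by (simp_all add: Clan_def full_sub2cat_def DMC_rtd_def)

lemma two_category_Clan: "two_category Clan"
  unfolding Clan_def by (rule two_category_full_sub2cat[OF two_category_DMC_rtd])

lemma subcat_mapI:
  "\<lbrakk>subcat_cc X; subcat_cc Y; rooted_map X Y M\<rbrakk> \<Longrightarrow> subcat_map X Y M"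
  by (auto simp: subcat_map_def rmap_def subcat_cc_def)

lemma is_functor_forget:
  assumes X: "subcat_cc X" and Y: "subcat_cc Y"
  shows "is_functor (HomCat CompCat_str2_rtd_repl_compcl X Y) (HomCat Clan (clan_of X) (clan_of Y))
    (OnHom forget X Y)"
proof -
  interpret S: two_category CompCat_str2_rtd_repl_compcl by (rule two_category_strict)
  interpret C: two_category Clan by (rule two_category_Clan)
  let ?H = "HomCat CompCat_str2_rtd_repl_compcl X Y" and ?K = "HomCat Clan (clan_of X) (clan_of Y)"
  interpret H: category ?H by (rule S.HomCat_category) (simp_all add: strict_2cat_simps X Y)
  have dmc: "dmc_map (clan_of X) (clan_of Y) (BaseF M)" if "rooted_map X Y M" for M
    by (rule subcat_map.dmc_map_BaseF[OF subcat_mapI[OF X Y that]])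
  have arr: "Cell (BaseF (csrc c)) (BaseF (ctgt c)) (fst (ccomp c)) \<in> Arr ?K" if "c \<in> Arr ?H" for c
    using that dmc by (simp add: strict_2cat_simps(3) Clan_simps dmc_hom_cells cell_cat_simps rooted_transformation_iff)
  have Dom: "Dom ?H c = csrc c" and Cod: "Cod ?H c = ctgt c" if "c \<in> Arr ?H" for c
    using that by (auto simp: strict_2cat_simps(4) full_subcat_simps cc_hom_cells cell_cat_simps)
  show ?thesis
  proof (rule is_functorI)
    show "category ?H" by (rule H.category_axioms)
    show "category ?K"
      using C.HomCat_category subcat_cc.clan_of_Clan X Y by blast
    fix M assume M: "M \<in> Obj ?H"
    then show "fobj (OnHom forget X Y) M \<in> Obj ?K"
      using dmc by (simp add: forget_simps strict_2cat_simps(2) Clan_simps dmc_hom_cells cell_cat_simps)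
    have "Id ?H M = Cell M M (id_nat (Base X) (Base Y) (BaseF M), id_nat (Tot X) (Tot Y) (TotF M))"
      using M by (simp add: strict_2cat_simps(4) full_subcat_simps cc_hom_cells cell_cat_simps)
    then show "farr (OnHom forget X Y) (Id ?H M) = Id ?K (fobj (OnHom forget X Y) M)"
      using H.Id_Arr[OF M] M dmc
      by (simp add: forget_simps strict_2cat_simps(2) Clan_simps dmc_hom_cells cell_cat_simps)
  next
    fix c assume c: "c \<in> Arr ?H"
    then show "farr (OnHom forget X Y) c \<in> Arr ?K \<and>
        Dom ?K (farr (OnHom forget X Y) c) = fobj (OnHom forget X Y) (Dom ?H c) \<and>
        Cod ?K (farr (OnHom forget X Y) c) = fobj (OnHom forget X Y) (Cod ?H c)"
      using arr[OF c] H.Dom_Obj[OF c] H.Cod_Obj[OF c]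
      by (simp add: forget_simps Dom Cod Clan_simps dmc_hom_cells cell_cat_simps(3,4))
    fix d assume d: "d \<in> Arr ?H" and cd: "Cod ?H c = Dom ?H d"
    then have "d \<cdot>\<^bsub>?H\<^esub> c = Cell (csrc c) (ctgt d) (vcomp (Base X) (Base Y) (fst (ccomp d)) (fst (ccomp c)),
        vcomp (Tot X) (Tot Y) (snd (ccomp d)) (snd (ccomp c)))"
      using c by (auto simp: strict_2cat_simps(4) full_subcat_simps cc_hom_cells cell_cat_simps)
    then show "farr (OnHom forget X Y) (d \<cdot>\<^bsub>?H\<^esub> c)
        = farr (OnHom forget X Y) d \<cdot>\<^bsub>?K\<^esub> farr (OnHom forget X Y) c"
      using arr[OF c] arr[OF d] H.Comp_Arr[OF c d cd] c d cd
      by (simp add: forget_simps Dom Cod Clan_simps dmc_hom_cells cell_cat_simps(6))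
  qed (auto simp: forget_def Let_def)
qed

lemma is_2functor_forget: "is_2functor CompCat_str2_rtd_repl_compcl Clan forget"
  unfolding is_2functor_def
proof (intro conjI ballI)
  interpret S: two_category CompCat_str2_rtd_repl_compcl by (rule two_category_strict)
  fix X Y Z :: "('o, 'm, 'm, 'm sq) rcompcat"
  assume X: "X \<in> Cell0 CompCat_str2_rtd_repl_compcl" and Y: "Y \<in> Cell0 CompCat_str2_rtd_repl_compcl"
  then show "is_functor (HomCat CompCat_str2_rtd_repl_compcl X Y) (HomCat Clan (On0 forget X) (On0 forget Y))
      (OnHom forget X Y)"
    by (simp add: is_functor_forget strict_2cat_simps(1) forget_simps(1))
  show "fobj (OnHom forget X X) (Id1 CompCat_str2_rtd_repl_compcl X) = Id1 Clan (On0 forget X)"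
    using S.Id1_mem[OF X] by (simp add: forget_simps Clan_simps strict_2cat_simps(5) rccmap_ftors)
  assume Z: "Z \<in> Cell0 CompCat_str2_rtd_repl_compcl"
  show "fobj (OnHom forget X Z) (Comp1 CompCat_str2_rtd_repl_compcl X Y Z N M) =
      Comp1 Clan (On0 forget X) (On0 forget Y) (On0 forget Z)
        (fobj (OnHom forget Y Z) N) (fobj (OnHom forget X Y) M)"
    if "M \<in> Obj (HomCat CompCat_str2_rtd_repl_compcl X Y)"
      "N \<in> Obj (HomCat CompCat_str2_rtd_repl_compcl Y Z)" for M N
    using that S.Comp1_mem[OF X Y Z that]
    by (simp add: forget_simps Clan_simps) (simp add: strict_2cat_simps(6) rccmap_ftors)
  show "farr (OnHom forget X Z) (Comp2 CompCat_str2_rtd_repl_compcl X Y Z b a) =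
      Comp2 Clan (On0 forget X) (On0 forget Y) (On0 forget Z)
        (farr (OnHom forget Y Z) b) (farr (OnHom forget X Y) a)"
    if a: "a \<in> Arr (HomCat CompCat_str2_rtd_repl_compcl X Y)"
      and b: "b \<in> Arr (HomCat CompCat_str2_rtd_repl_compcl Y Z)" for a b
  proof -
    have "Comp2 CompCat_str2_rtd_repl_compcl X Y Z b a \<in> Arr (HomCat CompCat_str2_rtd_repl_compcl X Z)"
      using S.Comp2_mem[OF X Y Z] a b by (auto simp: hom_iff)
    then show ?thesis
      using a b by (simp add: forget_simps Clan_simps) (simp add: strict_2cat_simps(7) rccmap_ftors)
  qed
qed (use subcat_cc.clan_of_Clan in \<open>auto simp: two_category_strict two_category_Clan
    strict_2cat_simps(1) forget_simps(1)\<close>)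

section \<open>Bijectivity of forgetting on 1-cells and 2-cells, and the conclusion\<close>

lemma clan_mapI:
  "\<lbrakk>subcat_cc X; subcat_cc Y; dmc_map (clan_of X) (clan_of Y) F\<rbrakk> \<Longrightarrow> clan_map X Y F"
  by (auto simp: clan_map_def clan_map_axioms_def)

lemma strict_eq_cc_map_of:
  "\<lbrakk>subcat_cc X; subcat_cc Y; rooted_map X Y M; strict_map X Y M\<rbrakk> \<Longrightarrow> cc_map_of X Y (BaseF M) = M"
  using subcat_map.strict_eq[OF subcat_mapI] by metis

lemma bij_forget_1cells:
  assumes X: "subcat_cc X" and Y: "subcat_cc Y"
  shows "bij_betw (fobj (OnHom forget X Y)) (Obj (HomCat CompCat_str2_rtd_repl_compcl X Y))
    (Obj (HomCat Clan (clan_of X) (clan_of Y)))"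
proof (rule bij_betw_byWitness[where f' = "cc_map_of X Y"])
  interpret f: func "HomCat CompCat_str2_rtd_repl_compcl X Y" "HomCat Clan (clan_of X) (clan_of Y)"
    "OnHom forget X Y" by unfold_locales (rule is_functor_forget[OF X Y])
  show "fobj (OnHom forget X Y) ` Obj (HomCat CompCat_str2_rtd_repl_compcl X Y)
      \<subseteq> Obj (HomCat Clan (clan_of X) (clan_of Y))" by auto
  show sub: "cc_map_of X Y ` Obj (HomCat Clan (clan_of X) (clan_of Y))
      \<subseteq> Obj (HomCat CompCat_str2_rtd_repl_compcl X Y)"
    using clan_map.rooted_map_cc_map_of[OF clan_mapI[OF X Y]] clan_map.strict_map_cc_map_of[OF clan_mapI[OF X Y]]
    by (auto simp: strict_2cat_simps(2) Clan_simps dmc_hom_cells cell_cat_simps)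
  show "\<forall>M \<in> Obj (HomCat CompCat_str2_rtd_repl_compcl X Y). cc_map_of X Y (fobj (OnHom forget X Y) M) = M"
    using X Y strict_eq_cc_map_of by (auto simp: forget_simps) (auto simp: strict_2cat_simps(2))
  show "\<forall>F \<in> Obj (HomCat Clan (clan_of X) (clan_of Y)). fobj (OnHom forget X Y) (cc_map_of X Y F) = F"
    using sub by (auto simp: forget_simps image_subset_iff)
qed

lemma bij_forget_2cells:
  assumes X: "subcat_cc X" and Y: "subcat_cc Y"
  shows "bij_betw (farr (OnHom forget X Y)) (Arr (HomCat CompCat_str2_rtd_repl_compcl X Y))
    (Arr (HomCat Clan (clan_of X) (clan_of Y)))"
  unfolding bij_betw_def
proof (intro conjI set_eqI iffI)
  let ?H = "HomCat CompCat_str2_rtd_repl_compcl X Y" and ?K = "HomCat Clan (clan_of X) (clan_of Y)"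
  interpret f: func ?H ?K "OnHom forget X Y" by unfold_locales (rule is_functor_forget[OF X Y])
  show "inj_on (farr (OnHom forget X Y)) (Arr ?H)"
  proof (rule inj_onI)
    fix c d assume c: "c \<in> Arr ?H" and d: "d \<in> Arr ?H"
      and eq: "farr (OnHom forget X Y) c = farr (OnHom forget X Y) d"
    then have e: "BaseF (csrc c) = BaseF (csrc d)" "BaseF (ctgt c) = BaseF (ctgt d)"
      "fst (ccomp c) = fst (ccomp d)" by (simp_all add: forget_simps)
    note cd = c[unfolded strict_2cat_simps(3)] d[unfolded strict_2cat_simps(3)]
    \<comment> \<open>Strict 1-cells are recovered from their base functors; the endpoints must
      agree before the components can be compared.\<close>
    have s: "csrc c = csrc d" "ctgt c = ctgt d"
      using cd e strict_eq_cc_map_of[OF X Y] by metis+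
    have "ccomp c = ccomp d"
      by (rule rooted_transformation_eqI[OF X Y]) (use cd e s in auto)
    then show "c = d" using s by (intro cell.expand) simp
  qed
  show "c \<in> Arr ?K" if "c \<in> farr (OnHom forget X Y) ` Arr ?H" for c using that by auto
  fix c assume "c \<in> Arr ?K"
  then have c: "dmc_map (clan_of X) (clan_of Y) (csrc c)" "dmc_map (clan_of X) (clan_of Y) (ctgt c)"
    "nat_trans (Base X) (Base Y) (csrc c) (ctgt c) (ccomp c)"
    by (simp_all add: Clan_simps dmc_hom_cells cell_cat_simps)
  interpret s: clan_map X Y "csrc c" by (rule clan_mapI[OF X Y c(1)])
  interpret t: clan_map X Y "ctgt c" by (rule clan_mapI[OF X Y c(2)])
  let ?c = "Cell (cc_map_of X Y (csrc c)) (cc_map_of X Y (ctgt c))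
    (ccomp c, lift_nat X (csrc c) (ctgt c) (ccomp c))"
  have "?c \<in> Arr ?H"
    using rooted_transformation_lift[OF s.clan_map_axioms t.clan_map_axioms c(3)]
      s.rooted_map_cc_map_of s.strict_map_cc_map_of t.rooted_map_cc_map_of t.strict_map_cc_map_of
    by (simp add: strict_2cat_simps(3) del: cc_map_of_simps)
  moreover from this have "farr (OnHom forget X Y) ?c = c"
    by (simp add: forget_simps del: cc_map_of_simps(2,3))
  ultimately show "c \<in> farr (OnHom forget X Y) ` Arr ?H" by (metis image_eqI)
qed

theorem theorem31:
  shows "isomorphic_2cat
      (Clan :: ('o, 'm) DMC_2cat)
      (CompCat_str2_rtd_repl_compcl :: ('o, 'm) subcat_CompCat)
    \<and> equivalent_2cat
      (CompCat_str2_rtd_repl_compcl :: ('o, 'm) subcat_CompCat)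
      (CompCat_rtd_repl_compcl :: ('o, 'm) subcat_CompCat)"
proof
  \<comment> \<open>\<open>bij_clan_of\<close> speaks of the 2-category with pseudo maps, which has
    the same 0-cells.\<close>
  have "Cell0 (CompCat_str2_rtd_repl_compcl :: ('o, 'm) subcat_CompCat) = Cell0 CompCat_rtd_repl_compcl"
    using subcat_cc_iff strict_2cat_simps(1) by blast
  then show "isomorphic_2cat (Clan :: ('o, 'm) DMC_2cat)
      (CompCat_str2_rtd_repl_compcl :: ('o, 'm) subcat_CompCat)"
    using bij_clan_of bij_forget_1cells bij_forget_2cells
    by (intro isomorphic_2catI[OF is_2functor_forget])
      (simp_all add: forget_simps(1) subcat_cc_iff)
  show "equivalent_2cat (CompCat_str2_rtd_repl_compcl :: ('o, 'm) subcat_CompCat)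
      (CompCat_rtd_repl_compcl :: ('o, 'm) subcat_CompCat)"
    unfolding str2_eq_locally_full
  proof (rule equivalent_2cat_locally_full[OF two_category_pseudo])
    show "two_category (locally_full_sub2cat CompCat_rtd_repl_compcl strict_map :: ('o, 'm) subcat_CompCat)"
      using two_category_strict by (simp add: str2_eq_locally_full)
    fix X Y :: "('o, 'm, 'm, 'm sq) rcompcat" and M
    assume XY: "X \<in> Cell0 CompCat_rtd_repl_compcl" "Y \<in> Cell0 CompCat_rtd_repl_compcl"
      and M: "M \<in> Obj (HomCat CompCat_rtd_repl_compcl X Y)"
    have hom: "HomCat CompCat_rtd_repl_compcl X Y = cc_hom X Y"
      by (simp add: CompCat_rtd_repl_compcl_def full_sub2cat_def CompCat_rtd_def)
    interpret M: subcat_map X Y M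
      using XY M by (intro subcat_mapI) (simp_all add: subcat_cc_iff hom cc_hom_cells cell_cat_simps)
    interpret S: clan_map X Y "BaseF M" by (rule M.clan_map_BaseF)
    show "\<exists>N \<in> Obj (HomCat CompCat_rtd_repl_compcl X Y). strict_map X Y N \<and>
        isomorphic (HomCat CompCat_rtd_repl_compcl X Y) N M"
      unfolding hom
      using S.rooted_map_cc_map_of S.strict_map_cc_map_of M.isomorphic_cc_map_of
      by (intro bexI[of _ "cc_map_of X Y (BaseF M)"]) (simp_all add: cc_hom_cells cell_cat_simps)
  qed
qed

end
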